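(* Let $A,B,C$ be multiplicative characters of $\mathbb{F}_q$ such that $A\neq\varepsilon$, $B\neq\varepsilon$, $C^2\neq\varepsilon$, $A\neq C^2$ and $B\neq C^2$. Write $y=\frac{-x^2}{4(1-x)}$ and $$M=\frac{\overline{A}(1-x)\,g(\overline{A}C)\,g(\overline{B}C\varphi)}{\varphi(-1)\,C(4)\,g(\varphi)\,g(\overline{A}C^2)\,g(\overline{B})}.$$ Then for every $x\in\mathbb{F}_q$ with $x\neq1$, \begin{align*} &{}_2F_1(A,B;\,C^2\mid x)\,{}_2F_1(A,C^2\overline{B};\,C^2\mid x)\\ &=\frac{q\,AB(-1)\,(\overline{A^2}B)(1-x)\,\overline{C^2}(x)}{g(A)\,g(\overline{B})\,g(\overline{A}C^2)\,g(B\overline{C^2})}\,\delta\!\left(\frac{x-2}{x-1}\right)+qM\,{}_4F_3(A,B,\overline{A}C^2,\overline{B}C^2;\,C^2,C,C\varphi\mid y)\\ &\quad+(q-1)M\Big[\tfrac{q-1}{q}\,{}_2F_1(A,B;\,C^2\mid y)\,\delta(\overline{A}C)\,\delta(\overline{B}C\varphi)-{}_3F_2(A,B,\overline{B}C^2;\,C^2,C\varphi\mid y)\,\delta(\overline{A}C)\\ &\qquad\qquad-{}_3F_2(A,B,\overline{A}C^2;\,C^2,C\mid y)\,\delta(\overline{B}C\varphi)\Big]\\ &\quad-\frac{(q-1)\,\overline{A}(1-x)\,\overline{C}(x^2)\,C(1-x)}{q\,g(A)\,g(\overline{B})\,g(B\overline{C^2})\,g(\overline{A}C^2)}\Big[(q-1)\delta(A\overline{C})\delta(B\overline{C})-q\,BC(-1)\delta(A\overline{C})-q\,AC(-1)\delta(B\overline{C})\\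 &\qquad+(q-1)\varphi(1-x)\delta(A\overline{C}\varphi)\delta(B\overline{C}\varphi)-q\,BC(-1)\varphi(x-1)\delta(A\overline{C}\varphi)-q\,AC(-1)\varphi(x-1)\delta(B\overline{C}\varphi)\Big]. \end{align*}
   Context: Let $p$ be an odd prime, $q=p^r$, and $\mathbb{F}_q$ the field with $q$ elements. Multiplicative characters of $\mathbb{F}_q^\times$ are extended to $\mathbb{F}_q$ by $\chi(0)=0$ (including the trivial character $\varepsilon$). $\varphi$ is the quadratic character. Characters are multiplied pointwise, $\overline{A}$ is the inverse of $A$, and an expression like $(\overline{A^2}B)(1-x)$ or $AB(-1)$ means the product character evaluated at that element of $\mathbb{F}_q$. For a character $A$, $\delta(A)=1$ if $A=\varepsilon$ and $0$ otherwise; for $x\in\mathbb{F}_q$, $\delta(x)=1$ if $x=0$ and $0$ otherwise. The Gauss sum is $g(\chi)=\sum_{x\in\mathbb{F}_q}\chi(x)\theta(x)$ with $\theta(\alpha)=\zeta_p^{\mathrm{tr}(\alpha)}$, $\zeta_p$ a fixed primitive $p$-th root of unity, $\mathrm{tr}$ the trace to $\mathbb{F}_p$. The binomial coefficient is $\binom{A}{B}=\frac{B(-1)}{q}\sum_{x\in\mathbb{F}_q}A(x)\overline{B}(1-x)$. Greene's series: ${}_{n+1}F_n(A_0,\dots,A_n;\,B_1,\dots,B_n\mid x)=\frac{q}{q-1}\sum_{\chi}\binom{A_0\chi}{\chi}\prod_{i=1}^n\binom{A_i\chi}{B_i\chi}\chi(x)$, summed over all multiplicative characters $\chi$. *)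

theory Defs
  imports
    Complex_Main
    "HOL-Library.Cardinality"
    "HOL-Library.Function_Division"
    "HOL-Computational_Algebra.Primes"
begin

text \<open>
  Multiplicative characters of a finite field \<open>'a\<close> are complex-valued functions on all of \<open>'a\<close>,
  extended by \<open>0\<close> at \<open>0\<close>.  Products, squares and inverses of characters are the pointwise
  operations of \<^theory>\<open>HOL-Library.Function_Algebras\<close> and
  \<^theory>\<open>HOL-Library.Function_Division\<close>; since \<open>inverse 0 = 0\<close> they respect the convention at \<open>0\<close>.
  The function \<open>1\<close> is not the trivial character (it does not vanish at \<open>0\<close>).
\<close>

definition mult_char :: "('a::{field,finite} \<Rightarrow> complex) \<Rightarrow> bool" where
  "mult_char \<chi> \<longleftrightarrow> \<chi> 0 = 0 \<and> \<chi> 1 = 1 \<and> (\<forall>x y. \<chi> (x * y) = \<chi> x * \<chi> y)"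

definition triv_char :: "'a::{field,finite} \<Rightarrow> complex" ("\<epsilon>") where
  "\<epsilon> x = (if x = 0 then 0 else 1)"

definition quad_char :: "'a::{field,finite} \<Rightarrow> complex" ("\<phi>") where
  "\<phi> x = (if x = 0 then 0 else if \<exists>z. x = z\<^sup>2 then 1 else - 1)"

definition delta_char :: "('a::{field,finite} \<Rightarrow> complex) \<Rightarrow> complex" where
  "delta_char A = (if A = \<epsilon> then 1 else 0)"

definition delta_elem :: "'a::{field,finite} \<Rightarrow> complex" where
  "delta_elem x = (if x = 0 then 1 else 0)"

definition primitive_root_of_unity :: "nat \<Rightarrow> complex \<Rightarrow> bool" where
  "primitive_root_of_unity n \<zeta> \<longleftrightarrow> \<zeta> ^ n = 1 \<and> (\<forall>k. 0 < k \<and> k < n \<longrightarrow> \<zeta> ^ k \<noteq> 1)"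

text \<open>The following three are meant for \<^prop>\<open>CARD('a::{field,finite}) = p ^ r\<close> with \<open>p\<close> prime.\<close>

definition field_trace :: "nat \<Rightarrow> nat \<Rightarrow> 'a::{field,finite} \<Rightarrow> 'a" where
  "field_trace p r \<alpha> = (\<Sum>i<r. \<alpha> ^ (p ^ i))"

text \<open>
  The trace lies in the prime field, i.e. it is \<open>of_nat k\<close> for a unique \<open>k < p\<close>, and this \<open>k\<close>
  is the exponent of the root of unity.
\<close>

definition add_char :: "nat \<Rightarrow> nat \<Rightarrow> complex \<Rightarrow> 'a::{field,finite} \<Rightarrow> complex" where
  "add_char p r \<zeta> \<alpha> = \<zeta> ^ (THE k. k < p \<and> of_nat k = field_trace p r \<alpha>)"

definition gauss_sum ::
  "nat \<Rightarrow> nat \<Rightarrow> complex \<Rightarrow> ('a::{field,finite} \<Rightarrow> complex) \<Rightarrow> complex" where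
  "gauss_sum p r \<zeta> \<chi> = (\<Sum>x\<in>UNIV. \<chi> x * add_char p r \<zeta> x)"

definition char_binom ::
  "('a::{field,finite} \<Rightarrow> complex) \<Rightarrow> ('a \<Rightarrow> complex) \<Rightarrow> complex" where
  "char_binom A B = B (- 1) / of_nat CARD('a) * (\<Sum>x\<in>UNIV. A x * inverse B (1 - x))"

text \<open>
  \<open>greene_F [A\<^sub>0, \<dots>, A\<^sub>n] [B\<^sub>1, \<dots>, B\<^sub>n] x\<close> is Greene's \<open>\<^bsub>n+1\<^esub>F\<^sub>n\<close>; as the lists are indexed
  from \<open>0\<close>, the pair \<open>A\<^sub>i, B\<^sub>i\<close> is \<open>As ! i, Bs ! (i - 1)\<close>.
\<close>

definition greene_F ::
  "('a::{field,finite} \<Rightarrow> complex) list \<Rightarrow> ('a \<Rightarrow> complex) list \<Rightarrow> 'a \<Rightarrow> complex" where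
  "greene_F As Bs x =
     of_nat CARD('a) / (of_nat CARD('a) - 1) *
     (\<Sum>\<chi> | mult_char \<chi>.
        char_binom (As ! 0 * \<chi>) \<chi> *
        (\<Prod>i=1..length Bs. char_binom (As ! i * \<chi>) (Bs ! (i - 1) * \<chi>)) * \<chi> x)"

end

theory Submission
  imports Defs "HOL-Algebra.Algebraic_Closure_Type"
begin

text \<open>
  Up to a correction that occurs when \<open>A = B\<close>, the binomial coefficient of \<open>A\<close> over \<open>B\<close> is a quotient
  of Gauss sums.  In the terms of the formula with a factor \<open>M\<close>, the bracket cancels precisely these
  corrections, and the Hasse--Davenport relation for the quadratic character merges the lower
  parameters \<open>C\<close> and \<open>C\<phi>\<close>.  What remains is a constant times a sum over \<open>\<chi>\<close> of a product of seven
  Gauss sums.  Regrouping these into three Jacobi sums (which fails only when \<open>A\<chi> = \<epsilon>\<close> and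
  \<open>C\<^sup>2\<chi>\<^sup>2 = \<epsilon>\<close>) and summing over \<open>\<chi>\<close> gives, with \<open>v = x / (x - 1)\<close> and \<open>x v = 4 y\<close>, the same constant
  times the sum over \<open>m, n\<close> of \<open>A(m / (1 - m)) B((1 - n) / (n (1 - x v m (1 - m) n))) C\<^sup>2((1 - m) n)\<close>.

  On the other side, Pfaff's transformation and the symmetry in \<open>A\<close> and \<open>B\<close> turn the product of
  the two series into that constant times the sum over \<open>s, t\<close> of
  \<open>A(s / ((1 - s) (1 - x t))) B(t / ((1 - t) (1 - v s))) C\<^sup>2((1 - s) (1 - t))\<close>.
  Equating the arguments of \<open>A\<close> and of \<open>C\<^sup>2\<close> defines a birational substitution
  from \<open>(s, t)\<close> to \<open>(m, n)\<close>, and the relation \<open>x + v = x v\<close> makes the arguments of \<open>B\<close> agree as well.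
  The few curves on which the substitution breaks down carry one-variable character sums; they produce
  the term for \<open>x = 2\<close> and a part of the last bracket.
\<close>

text \<open>The argument treats \<open>A\<close> and \<open>B\<close> unequally until the end. The
  last bracket of the theorem is symmetric in them, yet its halves have different origins:
  \<open>A * A = C * C\<close> is the case in which regrouping three Gauss sums into a Jacobi sum
  fails at \<open>\<chi> = inverse A\<close>, while \<open>B * B = C * C\<close> is the case in
  which the character sum over the curve where \<open>m\<close> has its pole does not cancel.

  The substitution leaves out two curves in the \<open>(s, t)\<close>-plane and three in the
  \<open>(m, n)\<close>-plane. On each of them some arguments become constant and a one-variable sum
  remains. Four of the five full sums vanish by the hypotheses on \<open>A\<close> and
  \<open>B\<close>, so that only the values at removed points are left, and these agree on the two
  sides. The exception to the vanishing is \<open>x = 2\<close>, where the argument of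
  \<open>B\<close> on one curve is constantly \<open>1\<close> and a multiple of the field size
  survives.

  The \<open>4\<close> in \<open>y\<close> comes from the Hasse--Davenport relation, which
  contributes \<open>\<chi> 4\<close> to every term. That \<open>C * C\<close> takes the value
  \<open>1\<close> at \<open>- 1\<close> removes most signs.\<close>

hide_const (open) Divisibility.prime

section \<open>Multiplicative characters\<close>

text \<open>
  The next rules must not be simplification rules: the left-hand side \<open>\<chi> 0\<close>, with a schematic
  \<open>\<chi>\<close>, matches every term that contains \<open>0\<close>.  They are instantiated with a fixed character.
\<close>

lemma mult_char_0: "mult_char \<chi> \<Longrightarrow> \<chi> 0 = 0"
  and mult_char_1: "mult_char \<chi> \<Longrightarrow> \<chi> 1 = 1"
  and mult_char_mult: "mult_char \<chi> \<Longrightarrow> \<chi> (x * y) = \<chi> x * \<chi> y"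
  by (auto simp: mult_char_def)

lemma mult_char_eq_0_iff:
  assumes "mult_char \<chi>" shows "\<chi> x = 0 \<longleftrightarrow> x = 0"
proof
  assume "\<chi> x = 0"
  then have "\<chi> (x * inverse x) = 0"
    using assms by (simp add: mult_char_mult)
  then show "x = 0"
    using mult_char_1[OF assms] by (cases "x = 0") auto
qed (simp add: mult_char_0[OF assms])

lemma mult_char_inverse:
  assumes "mult_char \<chi>" shows "\<chi> (inverse x) = inverse (\<chi> x)"
proof (cases "x = 0")
  case False
  then have "\<chi> x * \<chi> (inverse x) = 1"
    using mult_char_mult[OF assms, of x "inverse x"] mult_char_1[OF assms] by simp
  then show ?thesis
    by (metis inverse_unique)
qed (simp add: mult_char_0[OF assms])

lemma mult_char_divide:
  assumes "mult_char \<chi>" shows "\<chi> (x / y) = \<chi> x / \<chi> y"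
  using assms by (simp add: divide_inverse mult_char_mult mult_char_inverse)

lemma mult_char_power:
  assumes "mult_char \<chi>" shows "\<chi> (x ^ n) = \<chi> x ^ n"
  by (induction n) (simp_all add: mult_char_mult[OF assms] mult_char_1[OF assms])

lemmas mult_char_hom = mult_char_0 mult_char_1 mult_char_eq_0_iff mult_char_mult
  mult_char_divide mult_char_inverse mult_char_power

lemma mult_char_minus_1_square:
  assumes "mult_char \<chi>" shows "\<chi> (- 1) * \<chi> (- 1) = 1"
  by (simp add: mult_char_hom[OF assms] flip: mult_char_mult[OF assms])

lemma mult_char_minus:
  assumes "mult_char \<chi>" shows "\<chi> (- x) = \<chi> (- 1) * \<chi> x"
  using mult_char_mult[OF assms, of "-1" x] by simp

lemma mult_char_triv [simp]: "mult_char \<epsilon>"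
  by (auto simp: mult_char_def triv_char_def)

lemma mult_char_times [simp]: "mult_char \<chi> \<Longrightarrow> mult_char \<psi> \<Longrightarrow> mult_char (\<chi> * \<psi>)"
  by (simp add: mult_char_def mult.assoc mult.left_commute)

lemma mult_char_inv [simp]: "mult_char \<chi> \<Longrightarrow> mult_char (inverse \<chi>)"
  by (simp add: mult_char_def)

lemma triv_times [simp]: "mult_char \<chi> \<Longrightarrow> \<epsilon> * \<chi> = \<chi>"
  by (simp add: fun_eq_iff triv_char_def mult_char_0)

lemma times_triv [simp]: "mult_char \<chi> \<Longrightarrow> \<chi> * \<epsilon> = \<chi>"
  by (simp add: fun_eq_iff triv_char_def mult_char_0)

lemma inverse_triv [simp]: "inverse \<epsilon> = \<epsilon>"
  by (auto simp: fun_eq_iff triv_char_def)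

lemma inverse_inverse_fun [simp]: "inverse (inverse \<chi>) = (\<chi> :: 'b \<Rightarrow> complex)"
  by (auto simp: fun_eq_iff)

lemma inverse_times_fun: "inverse (\<chi> * \<psi>) = inverse \<chi> * inverse (\<psi> :: 'b \<Rightarrow> complex)"
  by (auto simp: fun_eq_iff)

lemma times_inverse_char [simp]: "mult_char \<chi> \<Longrightarrow> \<chi> * inverse \<chi> = \<epsilon>"
  by (simp add: fun_eq_iff triv_char_def mult_char_eq_0_iff)

lemma inverse_times_char [simp]: "mult_char \<chi> \<Longrightarrow> inverse \<chi> * \<chi> = \<epsilon>"
  by (simp add: fun_eq_iff triv_char_def mult_char_eq_0_iff)

lemma times_inverse_eq_triv_iff:
  assumes "mult_char \<chi>" "mult_char \<psi>" shows "\<chi> * inverse \<psi> = \<epsilon> \<longleftrightarrow> \<chi> = \<psi>"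
proof
  assume *: "\<chi> * inverse \<psi> = \<epsilon>"
  show "\<chi> = \<psi>"
  proof
    fix x
    show "\<chi> x = \<psi> x"
      using fun_cong[OF *, of x] mult_char_eq_0_iff[OF assms(2), of x]
        mult_char_0[OF assms(1)] mult_char_0[OF assms(2)]
      by (cases "x = 0") (simp_all add: triv_char_def field_simps)
  qed
qed (use assms in simp)

lemma times_eq_triv_iff:
  assumes "mult_char \<chi>" "mult_char \<psi>" shows "\<chi> * \<psi> = \<epsilon> \<longleftrightarrow> \<chi> = inverse \<psi>"
  using times_inverse_eq_triv_iff[of \<chi> "inverse \<psi>"] assms by simp

lemma inverse_eq_triv_iff [simp]: "inverse \<chi> = \<epsilon> \<longleftrightarrow> \<chi> = \<epsilon>"
proof
  assume "inverse \<chi> = \<epsilon>"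
  then have "inverse (inverse \<chi>) = inverse \<epsilon>" by (rule arg_cong)
  then show "\<chi> = \<epsilon>" unfolding inverse_inverse_fun inverse_triv .
qed (simp only: inverse_triv)

section \<open>Sums of one character over the field\<close>

lemma bij_mult_left: "c \<noteq> 0 \<Longrightarrow> bij (\<lambda>x::'a::field. c * x)"
  by (rule bij_betwI[where g = "\<lambda>x. x / c"]) auto

lemma sum_triv_char: "(\<Sum>x\<in>UNIV. \<epsilon> (x::'a::{field,finite})) = of_nat CARD('a) - 1"
proof -
  have "(\<Sum>x\<in>UNIV. \<epsilon> (x::'a)) = (\<Sum>x\<in>UNIV - {0::'a}. 1)"
    by (rule sum.mono_neutral_cong_right) (auto simp: triv_char_def)
  then show ?thesis
    by (simp add: card_Diff_subset of_nat_diff)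
qed

lemma sum_mult_char_nontriv:
  fixes \<chi> :: "'a::{field,finite} \<Rightarrow> complex"
  assumes "mult_char \<chi>" "\<chi> \<noteq> \<epsilon>"
  shows "(\<Sum>x\<in>UNIV. \<chi> x) = 0"
proof -
  obtain c where c: "c \<noteq> 0" "\<chi> c \<noteq> 1"
    using assms(2) mult_char_0[OF assms(1)] by (auto simp: fun_eq_iff triv_char_def split: if_splits)
  have "(\<Sum>x\<in>UNIV. \<chi> x) = (\<Sum>x\<in>UNIV. \<chi> (c * x))"
    by (rule sum.reindex_bij_betw[symmetric]) (rule bij_mult_left[OF c(1)])
  also have "\<dots> = \<chi> c * (\<Sum>x\<in>UNIV. \<chi> x)"
    using assms by (simp add: mult_char_mult sum_distrib_left)
  finally show ?thesis
    using c(2) by simp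
qed

lemma sum_mult_char:
  fixes \<chi> :: "'a::{field,finite} \<Rightarrow> complex"
  assumes "mult_char \<chi>"
  shows "(\<Sum>x\<in>UNIV. \<chi> x) = (of_nat CARD('a) - 1) * delta_char \<chi>"
  using assms sum_mult_char_nontriv sum_triv_char by (auto simp: delta_char_def)

section \<open>The cyclic multiplicative group and sums over all characters\<close>

lemma power_card_minus_1:
  fixes x :: "'a::{field,finite}"
  assumes "x \<noteq> 0" shows "x ^ (CARD('a) - 1) = 1"
proof -
  have "\<Prod>(UNIV - {0::'a}) = (\<Prod>y\<in>UNIV - {0}. x * y)"
    by (rule prod.reindex_bij_witness[of _ "\<lambda>y. x * y" "\<lambda>y. y / x"]) (use assms in auto)
  also have "\<dots> = x ^ (CARD('a) - 1) * \<Prod>(UNIV - {0})"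
    by (simp add: prod.distrib card_Diff_subset)
  finally show ?thesis by simp
qed

text \<open>\<open>ring_of_type_algebra\<close> turns the type into a ring record, for which the
  unit group is known to be cyclic. Exponents may be reduced modulo \<open>CARD('a) - 1\<close>, and
  a surjection between finite sets of equal size is bijective.\<close>

lemma mult_generator:
  obtains \<gamma> :: "'a::{field,finite}"
  where "\<gamma> \<noteq> 0" "bij_betw (\<lambda>i. \<gamma> ^ i) {..<CARD('a) - 1} (- {0})"
proof -
  let ?R = "ring_of_type_algebra :: 'a ring"
  interpret R: field ?R by (rule field_from_type_algebra)
  have carrier: "carrier (mult_of ?R) = - {0}"
    by (auto simp: ring_of_type_algebra_def)
  have pow: "x [^]\<^bsub>?R\<^esub> (n::nat) = x ^ n" for x n
    by (induction n) (auto simp: ring_of_type_algebra_def nat_pow_def)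
  obtain \<gamma> :: 'a where \<gamma>: "\<gamma> \<noteq> 0" "- {0} = {\<gamma> ^ i | i::nat. True}"
    using R.finite_field_mult_group_has_gen unfolding carrier pow
    by (auto simp: ring_of_type_algebra_def)
  let ?n = "CARD('a) - 1"
  have card: "card (- {0::'a}) = ?n"
    by (simp add: Compl_eq_Diff_UNIV card_Diff_subset)
  have "(1::'a) \<in> - {0}" by simp
  then have "- {0::'a} \<noteq> {}" by (metis empty_iff)
  then have "0 < ?n"
    unfolding card[symmetric] by (simp only: card_gt_0_iff finite simp_thms not_False_eq_True)
  have "(\<lambda>i. \<gamma> ^ i) ` {..<?n} = - {0}"
  proof -
    have "x \<in> (\<lambda>i. \<gamma> ^ i) ` {..<?n}" if "x \<noteq> 0" for x
    proof -
      have "x \<in> {\<gamma> ^ i | i::nat. True}"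
        using that unfolding \<gamma>(2)[symmetric] by simp
      then obtain i where "x = \<gamma> ^ i" by blast
      also have "\<gamma> ^ i = \<gamma> ^ (?n * (i div ?n) + i mod ?n)" by simp
      also have "\<dots> = \<gamma> ^ (i mod ?n)"
        unfolding power_add power_mult power_card_minus_1[OF \<gamma>(1)] by simp
      finally show ?thesis
        using \<open>0 < ?n\<close> by auto
    qed
    then show ?thesis
      using \<gamma>(1) by auto
  qed
  then have "bij_betw (\<lambda>i. \<gamma> ^ i) {..<?n} (- {0})"
    using card by (auto simp: bij_betw_def intro!: eq_card_imp_inj_on)
  then show ?thesis
    using that \<gamma>(1) by blast
qed

text \<open>The discrete logarithm \<open>lg\<close> is defined only modulo
  \<open>CARD('a) - 1\<close>, which is harmless because the powers of \<open>\<omega>\<close> have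
  that period too.\<close>

lemma mult_char_exists:
  fixes \<gamma> :: "'a::{field,finite}" and \<omega> :: complex
  assumes \<gamma>: "\<gamma> \<noteq> 0" "bij_betw (\<lambda>i. \<gamma> ^ i) {..<CARD('a) - 1} (- {0})"
    and \<omega>: "\<omega> ^ (CARD('a) - 1) = 1"
  obtains \<chi> where "mult_char \<chi>" "\<And>i. \<chi> (\<gamma> ^ i) = \<omega> ^ i"
proof -
  let ?n = "CARD('a) - 1"
  define lg where "lg = the_inv_into {..<?n} (\<lambda>i. \<gamma> ^ i)"
  define \<chi> where "\<chi> x = (if x = 0 then 0 else \<omega> ^ lg x)" for x
  have n: "0 < ?n"
    using bij_betw_same_card[OF \<gamma>(2)] \<gamma>(1) by (auto simp: card_eq_0_iff intro!: Nat.gr0I)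
  have red: "z ^ i = z ^ (i mod ?n)" if "z ^ ?n = 1" for z :: "'c::monoid_mult" and i
  proof -
    have "z ^ i = z ^ (?n * (i div ?n) + i mod ?n)" by simp
    then show ?thesis
      unfolding power_add power_mult that by simp
  qed
  have \<chi>: "\<chi> (\<gamma> ^ i) = \<omega> ^ i" for i
  proof -
    have "lg (\<gamma> ^ i) = lg (\<gamma> ^ (i mod ?n))"
      using red[OF power_card_minus_1[OF \<gamma>(1)], of i] by simp
    also have "\<dots> = i mod ?n"
      unfolding lg_def using \<gamma>(2) n by (intro the_inv_into_f_f) (auto simp: bij_betw_def)
    finally show ?thesis
      using \<gamma>(1) red[OF \<omega>, of i] by (simp add: \<chi>_def)
  qed
  have ex: "\<exists>i. x = \<gamma> ^ i" if "x \<noteq> 0" for x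
  proof -
    have "x \<in> (\<lambda>i. \<gamma> ^ i) ` {..<?n}"
      using \<gamma>(2) that unfolding bij_betw_def by auto
    then show ?thesis by auto
  qed
  have "\<chi> (x * y) = \<chi> x * \<chi> y" for x y
  proof (cases "x = 0 \<or> y = 0")
    case False
    then obtain i j where "x = \<gamma> ^ i" "y = \<gamma> ^ j"
      using ex by meson
    then show ?thesis
      using \<chi>[of "i + j"] \<chi>[of i] \<chi>[of j] by (simp add: power_add)
  qed (auto simp: \<chi>_def)
  moreover have "\<chi> 0 = 0" by (simp add: \<chi>_def)
  moreover have "\<chi> 1 = 1" using \<chi>[of 0] by simp
  ultimately show ?thesis
    using that \<chi> by (auto simp: mult_char_def)
qed

text \<open>The character that sends a generator to a primitive root of unity of order
  \<open>CARD('a) - 1\<close> is injective on the nonzero elements, so it tells every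
  \<open>u\<close> from \<open>1\<close>.\<close>

lemma mult_char_separates:
  fixes u :: "'a::{field,finite}"
  assumes "u \<noteq> 0" "u \<noteq> 1"
  obtains \<chi> where "mult_char \<chi>" "\<chi> u \<noteq> 1"
proof -
  let ?n = "CARD('a) - 1"
  obtain \<gamma> :: 'a where \<gamma>: "\<gamma> \<noteq> 0" "bij_betw (\<lambda>i. \<gamma> ^ i) {..<?n} (- {0})"
    by (rule mult_generator)
  have "u \<in> (\<lambda>i. \<gamma> ^ i) ` {..<?n}"
    using \<gamma>(2) assms unfolding bij_betw_def by auto
  then obtain i where i: "i < ?n" "u = \<gamma> ^ i" by auto
  define \<omega> where "\<omega> k = cis (2 * pi * real k / real ?n)" for k
  have bij: "bij_betw \<omega> {..<?n} {z. z ^ ?n = 1}"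
    unfolding \<omega>_def using i by (intro bij_betw_roots_unity) auto
  have pow: "\<omega> 1 ^ k = \<omega> k" for k
    by (simp add: \<omega>_def DeMoivre mult_ac)
  have "i \<noteq> 0" using i(2) assms(2) by (metis power_0)
  have "\<omega> i \<noteq> \<omega> 0"
    using bij i \<open>i \<noteq> 0\<close> unfolding bij_betw_def inj_on_def by (metis gr0I lessThan_iff less_nat_zero_code)
  then have "\<omega> 1 ^ i \<noteq> 1" unfolding pow by (simp add: \<omega>_def)
  moreover have "\<omega> 1 ^ ?n = 1"
    using i unfolding pow by (simp add: \<omega>_def)
  ultimately show ?thesis
    using mult_char_exists[OF \<gamma>, of "\<omega> 1"] i(2) that by metis
qed

text \<open>All values lie among \<open>0\<close> and the roots of unity of order dividing
  \<open>CARD('a) - 1\<close>. Finiteness matters because a sum over an infinite set is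
  \<open>0\<close> by convention.\<close>

lemma finite_mult_char: "finite {\<chi> :: 'a::{field,finite} \<Rightarrow> complex. mult_char \<chi>}"
proof -
  let ?n = "CARD('a) - 1"
  have n: "0 < ?n"
    using card_mono[of "UNIV :: 'a set" "{0, 1}"] by simp
  have "\<chi> x \<in> insert 0 {z. z ^ ?n = 1}" if "mult_char \<chi>" for \<chi> and x :: 'a
    using power_card_minus_1[of x] mult_char_power[OF that, of x ?n] mult_char_hom(1,2)[OF that]
    by (cases "x = 0") auto
  moreover have "finite (insert 0 {z::complex. z ^ ?n = 1})"
    using finite_roots_unity[of ?n, where 'a = complex] n by simp
  ultimately have "finite {\<chi> :: 'a \<Rightarrow> complex. \<forall>x. \<chi> x \<in> insert 0 {z. z ^ ?n = 1}}"
    using finite_set_of_finite_funs[of "UNIV :: 'a set" "insert 0 {z::complex. z ^ ?n = 1}" undefined]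
    by simp
  then show ?thesis
    by (rule rev_finite_subset) (use \<open>\<And>\<chi> x. mult_char \<chi> \<Longrightarrow> \<chi> x \<in> insert 0 {z. z ^ ?n = 1}\<close> in blast)
qed

lemma bij_betw_mult_char_times:
  assumes "mult_char \<psi>"
  shows "bij_betw (\<lambda>\<chi>. \<psi> * \<chi>) {\<chi>. mult_char \<chi>} {\<chi>. mult_char \<chi>}"
  by (rule bij_betwI[where g = "\<lambda>\<chi>. inverse \<psi> * \<chi>"])
    (use assms in \<open>auto simp flip: mult.assoc\<close>)

text \<open>For \<open>u \<noteq> 1\<close>, multiplication by a character that separates
  \<open>u\<close> from \<open>1\<close> permutes the summands. The value at \<open>1\<close>, which
  is the number of characters, is found without counting them: it equals the sum of
  \<open>?S u\<close> over all \<open>u\<close>, and after exchanging the summations only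
  \<open>\<epsilon>\<close> contributes.\<close>

lemma sum_all_mult_char:
  fixes u :: "'a::{field,finite}"
  shows "(\<Sum>\<chi> | mult_char \<chi>. \<chi> u) = (if u = 1 then of_nat CARD('a) - 1 else 0)"
proof -
  let ?S = "\<lambda>u::'a. \<Sum>\<chi> | mult_char \<chi>. \<chi> u"
  have 0: "?S u = 0" if "u \<noteq> 1" for u
  proof (cases "u = 0")
    case False
    then obtain \<psi> where \<psi>: "mult_char \<psi>" "\<psi> u \<noteq> 1"
      using mult_char_separates \<open>u \<noteq> 1\<close> by blast
    have "?S u = (\<Sum>\<chi> | mult_char \<chi>. (\<psi> * \<chi>) u)"
      using \<psi> by (intro sum.reindex_bij_betw[symmetric] bij_betw_mult_char_times)
    also have "\<dots> = \<psi> u * ?S u"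
      by (simp add: sum_distrib_left)
    finally show ?thesis
      using \<psi>(2) by simp
  next
    case True
    then show ?thesis by (simp add: mult_char_0)
  qed
  have "?S 1 = (\<Sum>u\<in>{1}. ?S u)" by simp
  also have "\<dots> = (\<Sum>u\<in>UNIV. ?S u)"
    by (rule sum.mono_neutral_left) (use 0 in auto)
  also have "\<dots> = (\<Sum>\<chi> | mult_char \<chi>. \<Sum>u\<in>(UNIV :: 'a set). \<chi> u)"
    by (rule sum.swap)
  also have "\<dots> = (\<Sum>\<chi> | mult_char \<chi>. (of_nat CARD('a) - 1) * delta_char (\<chi> :: 'a \<Rightarrow> complex))"
    by (intro sum.cong) (auto simp: sum_mult_char)
  also have "\<dots> = (\<Sum>\<chi> | mult_char \<chi>. if \<chi> = (\<epsilon> :: 'a \<Rightarrow> complex) then of_nat CARD('a) - 1 else 0)"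
    by (intro sum.cong) (auto simp: delta_char_def)
  also have "\<dots> = of_nat CARD('a) - 1"
    by (subst sum.delta) (auto simp: finite_mult_char)
  finally show ?thesis
    using 0 by auto
qed

section \<open>The quadratic character\<close>

lemma quad_char_generator:
  fixes \<gamma> :: "'a::{field,finite}"
  assumes \<gamma>: "\<gamma> \<noteq> 0" "bij_betw (\<lambda>i. \<gamma> ^ i) {..<CARD('a) - 1} (- {0})"
    and odd: "odd CARD('a)"
  shows "mult_char (\<phi> :: 'a \<Rightarrow> complex)" "\<phi> \<gamma> = - 1"
proof -
  \<comment> \<open>As \<open>CARD('a) - 1\<close> is even, \<open>- 1\<close> may be prescribed at
    the generator. The resulting character is the sign of the parity of the exponent, and even
    exponents give exactly the nonzero squares.\<close>
  have "(- 1 :: complex) ^ (CARD('a) - 1) = 1"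
    using odd by simp
  then obtain \<chi> where \<chi>: "mult_char \<chi>" "\<And>i. \<chi> (\<gamma> ^ i) = (- 1) ^ i"
    using mult_char_exists[OF \<gamma>] by metis
  have ex: "\<exists>i. x = \<gamma> ^ i" if "x \<noteq> 0" for x
  proof -
    have "x \<in> (\<lambda>i. \<gamma> ^ i) ` {..<CARD('a) - 1}"
      using \<gamma>(2) that unfolding bij_betw_def by auto
    then show ?thesis by auto
  qed
  have "\<chi> x = \<phi> x" for x
  proof (cases "x = 0")
    case False
    then obtain i where i: "x = \<gamma> ^ i" using ex by blast
    show ?thesis
    proof (cases "\<exists>z. x = z\<^sup>2")
      case True
      then obtain z where z: "x = z\<^sup>2" by blast
      with False obtain j where "z = \<gamma> ^ j" using ex by fastforce
      with z have "x = \<gamma> ^ (2 * j)" by (simp add: mult.commute flip: power_mult)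
      then show ?thesis
        using True False \<chi>(2)[of "2 * j"] by (simp add: quad_char_def)
    next
      case nsq: False
      have "odd i"
      proof
        assume "even i"
        then have "x = (\<gamma> ^ (i div 2))\<^sup>2" by (simp add: i flip: power_mult)
        then show False using nsq by blast
      qed
      then show ?thesis
        using nsq False \<chi>(2)[of i] i by (simp add: quad_char_def)
    qed
  qed (simp add: quad_char_def mult_char_0[OF \<chi>(1)])
  then have "\<chi> = \<phi>" by auto
  then show "mult_char (\<phi> :: 'a \<Rightarrow> complex)" "\<phi> \<gamma> = - 1"
    using \<chi>(1) \<chi>(2)[of 1] by auto
qed

lemma mult_char_quad:
  "odd CARD('a) \<Longrightarrow> mult_char (\<phi> :: 'a::{field,finite} \<Rightarrow> complex)"
  by (rule mult_generator[where 'a = 'a]) (auto intro: quad_char_generator(1))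

lemma quad_char_neq_triv:
  assumes "odd CARD('a)" shows "(\<phi> :: 'a::{field,finite} \<Rightarrow> complex) \<noteq> \<epsilon>"
proof -
  obtain \<gamma> :: 'a where \<gamma>: "\<gamma> \<noteq> 0" "bij_betw (\<lambda>i. \<gamma> ^ i) {..<CARD('a) - 1} (- {0})"
    by (rule mult_generator)
  then show ?thesis
    using quad_char_generator(2)[OF \<gamma> assms] by (auto simp: fun_eq_iff triv_char_def intro!: exI[of _ \<gamma>])
qed

lemma quad_char_times_self [simp]: "\<phi> * \<phi> = \<epsilon>"
  by (auto simp: fun_eq_iff quad_char_def triv_char_def)

lemma inverse_quad_char [simp]: "inverse \<phi> = \<phi>"
  by (auto simp: fun_eq_iff quad_char_def)

text \<open>A character is fixed by its value at a generator, and the two values with square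
  \<open>1\<close> belong to \<open>\<epsilon>\<close> and \<open>\<phi>\<close>.\<close>

lemma square_eq_triv_iff:
  fixes \<chi> :: "'a::{field,finite} \<Rightarrow> complex"
  assumes "odd CARD('a)" "mult_char \<chi>"
  shows "\<chi> * \<chi> = \<epsilon> \<longleftrightarrow> \<chi> = \<epsilon> \<or> \<chi> = \<phi>"
proof
  assume sq: "\<chi> * \<chi> = \<epsilon>"
  obtain \<gamma> :: 'a where \<gamma>: "\<gamma> \<noteq> 0" "bij_betw (\<lambda>i. \<gamma> ^ i) {..<CARD('a) - 1} (- {0})"
    by (rule mult_generator)
  have eqI: "\<chi> = \<psi>" if "mult_char \<psi>" "\<chi> \<gamma> = \<psi> \<gamma>" for \<psi>
  proof
    fix x show "\<chi> x = \<psi> x"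
    proof (cases "x = 0")
      case False
      then have "x \<in> (\<lambda>i. \<gamma> ^ i) ` {..<CARD('a) - 1}"
        using \<gamma>(2) unfolding bij_betw_def by auto
      then show ?thesis
        using that(2) mult_char_power[OF that(1)] mult_char_power[OF assms(2)] by auto
    qed (simp add: mult_char_0[OF that(1)] mult_char_0[OF assms(2)])
  qed
  have "\<chi> \<gamma> * \<chi> \<gamma> = 1"
    using fun_cong[OF sq, of \<gamma>] \<gamma>(1) by (simp add: triv_char_def)
  then have "\<chi> \<gamma> = 1 \<or> \<chi> \<gamma> = - 1"
    by (simp add: square_eq_1_iff)
  then show "\<chi> = \<epsilon> \<or> \<chi> = \<phi>"
    using eqI[of "\<epsilon>"] eqI[of \<phi>] quad_char_generator[OF \<gamma> assms(1)] \<gamma>(1)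
    by (auto simp: triv_char_def)
qed auto

section \<open>Gauss and Jacobi sums\<close>

definition jacobi_sum :: "('a::{field,finite} \<Rightarrow> complex) \<Rightarrow> ('a \<Rightarrow> complex) \<Rightarrow> complex" where
  "jacobi_sum A B = (\<Sum>x\<in>UNIV. A x * B (1 - x))"

lemma char_binom_jacobi:
  "char_binom A (B :: 'a::{field,finite} \<Rightarrow> complex) = B (- 1) / of_nat CARD('a) * jacobi_sum A (inverse B)"
  by (simp add: char_binom_def jacobi_sum_def)

lemma jacobi_sum_commute: "jacobi_sum A B = jacobi_sum B A"
  unfolding jacobi_sum_def
  by (rule sum.reindex_bij_witness[of _ "\<lambda>x. 1 - x" "\<lambda>x. 1 - x"]) auto

lemma jacobi_sum_triv: "jacobi_sum \<epsilon> (\<epsilon> :: 'a::{field,finite} \<Rightarrow> complex) = of_nat CARD('a) - 2"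
proof -
  have "jacobi_sum \<epsilon> (\<epsilon> :: 'a \<Rightarrow> complex) = (\<Sum>x\<in>UNIV - {0, 1::'a}. 1)"
    unfolding jacobi_sum_def by (rule sum.mono_neutral_cong_right) (auto simp: triv_char_def)
  moreover have "card {0, 1::'a} \<le> CARD('a)"
    by (rule card_mono) auto
  ultimately show ?thesis
    by (simp add: card_Diff_subset of_nat_diff)
qed

text \<open>The fractional linear map \<open>x / (1 - x)\<close> takes the values \<open>0\<close>
  and \<open>- 1\<close> at \<open>0\<close> and at infinity, hence the two subtracted
  terms.\<close>

lemma sum_ratio:
  fixes f :: "'a::{field,finite} \<Rightarrow> complex"
  shows "(\<Sum>x\<in>UNIV - {0, 1}. f (x / (1 - x))) = (\<Sum>u\<in>UNIV. f u) - f 0 - f (- 1)"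
proof -
  have "(\<Sum>x\<in>UNIV - {0, 1}. f (x / (1 - x))) = (\<Sum>u\<in>UNIV - {0, - 1}. f u)"
  proof (rule sum.reindex_bij_witness[of _ "\<lambda>u. u / (1 + u)" "\<lambda>x. x / (1 - x)"])
    fix u :: 'a assume u: "u \<in> UNIV - {0, - 1}"
    then have nz: "1 + u \<noteq> 0" by (metis DiffD2 add_eq_0_iff insertCI)
    then have "1 - u / (1 + u) = 1 / (1 + u)" by (simp add: field_simps)
    with u nz show "u / (1 + u) / (1 - u / (1 + u)) = u" "u / (1 + u) \<in> UNIV - {0, 1}"
      by auto
  next
    fix x :: 'a assume x: "x \<in> UNIV - {0, 1}"
    then have "1 + x / (1 - x) = 1 / (1 - x)" by (simp add: field_simps)
    with x show "x / (1 - x) / (1 + x / (1 - x)) = x" "x / (1 - x) \<in> UNIV - {0, - 1}"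
      by (auto simp: add_eq_0_iff)
  qed simp
  also have "\<dots> = (\<Sum>u\<in>UNIV. f u) - (\<Sum>u\<in>{0, - 1}. f u)"
    by (rule sum_diff) auto
  finally show ?thesis by simp
qed

lemma jacobi_sum_inverse:
  fixes A :: "'a::{field,finite} \<Rightarrow> complex"
  assumes "mult_char A" "A \<noteq> \<epsilon>"
  shows "jacobi_sum A (inverse A) = - A (- 1)"
proof -
  have "jacobi_sum A (inverse A) = (\<Sum>x\<in>UNIV - {0, 1}. A (x / (1 - x)))"
    unfolding jacobi_sum_def
    by (rule sum.mono_neutral_cong_right) (auto simp: mult_char_hom[OF assms(1)] divide_inverse)
  then show ?thesis
    using sum_mult_char_nontriv[OF assms] by (simp add: sum_ratio mult_char_0[OF assms(1)])
qed

text \<open>If \<open>2 = 0\<close>, then squaring is injective, so every element is a square and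
  \<open>\<phi> = \<epsilon>\<close>, which is impossible for odd cardinality.\<close>

lemma two_neq_0:
  assumes "odd CARD('a)" shows "(2::'a::{field,finite}) \<noteq> 0"
proof
  assume 2: "(2::'a) = 0"
  have "inj (\<lambda>z::'a. z\<^sup>2)"
  proof (rule injI)
    fix y z :: 'a
    assume "y\<^sup>2 = z\<^sup>2"
    moreover have "(y - z)\<^sup>2 = y\<^sup>2 - z\<^sup>2 - 2 * (z * (y - z))"
      by (simp add: power2_eq_square algebra_simps)
    ultimately show "y = z"
      unfolding 2 by simp
  qed
  then have "surj (\<lambda>z::'a. z\<^sup>2)"
    by (rule finite_UNIV_inj_surj[OF finite])
  then have "(\<phi> :: 'a \<Rightarrow> complex) = \<epsilon>"
    by (auto simp: fun_eq_iff quad_char_def triv_char_def surj_def)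
  then show False
    using quad_char_neq_triv[OF assms] by blast
qed

lemma four_neq_0:
  assumes "odd CARD('a)" shows "(4::'a::{field,finite}) \<noteq> 0"
proof -
  have "(4::'a) = 2 * 2" by simp
  then show ?thesis using two_neq_0[OF assms] by (metis mult_eq_0_iff)
qed

text \<open>The fibre of squaring over \<open>u\<close> has \<open>1 + \<phi> u\<close> elements; at
  \<open>u = 0\<close> this is the single root \<open>0\<close>, as \<open>\<phi>\<close> vanishes
  there.\<close>

lemma sum_square_arg:
  fixes f :: "'a::{field,finite} \<Rightarrow> complex"
  assumes "odd CARD('a)"
  shows "(\<Sum>w\<in>UNIV. f (w\<^sup>2)) = (\<Sum>u\<in>UNIV. f u * (1 + \<phi> u))"
proof -
  have roots: "of_nat (card {w. w\<^sup>2 = u}) = 1 + \<phi> u" for u :: 'a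
  proof (cases "\<exists>z. u = z\<^sup>2")
    case True
    then obtain z where z: "u = z\<^sup>2" by blast
    have set: "{w. w\<^sup>2 = u} = {z, - z}"
      by (auto simp: z power2_eq_iff)
    show ?thesis
    proof (cases "z = 0")
      case False
      have "z + z \<noteq> 0"
        using two_neq_0[OF assms] False by (metis mult_2 mult_eq_0_iff)
      then have "z \<noteq> - z" by (metis add.right_inverse)
      then show ?thesis
        using True z False unfolding set by (auto simp: quad_char_def)
    qed (use z in \<open>auto simp: quad_char_def set\<close>)
  next
    case False
    then have set: "{w. w\<^sup>2 = u} = {}" by blast
    moreover have "u \<noteq> 0"
      using False by (metis zero_power2)
    ultimately show ?thesis
      using False by (simp add: quad_char_def)
  qed
  have "(\<Sum>w\<in>UNIV. f (w\<^sup>2)) = (\<Sum>u\<in>UNIV. \<Sum>w\<in>{w. w \<in> UNIV \<and> w\<^sup>2 = u}. f (w\<^sup>2))"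
    by (rule sum.group[symmetric]) auto
  also have "\<dots> = (\<Sum>u\<in>UNIV. f u * (1 + \<phi> u))"
    by (intro sum.cong) (simp_all flip: roots)
  finally show ?thesis .
qed

text \<open>Completing the square: \<open>x = (1 + w) / 2\<close> turns \<open>x * (1 - x)\<close>
  into \<open>(1 - w\<^sup>2) / 4\<close>. Counting the square roots of \<open>u\<close> by
  \<open>1 + \<phi> u\<close> leaves a plain sum of \<open>A\<close>, which vanishes, and a Jacobi
  sum with \<open>\<phi>\<close>.\<close>

lemma jacobi_sum_self:
  fixes A :: "'a::{field,finite} \<Rightarrow> complex"
  assumes odd: "odd CARD('a)" and A: "mult_char A" "A \<noteq> \<epsilon>"
  shows "jacobi_sum A A = inverse (A 4) * jacobi_sum A \<phi>"
proof -
  have 2: "(2::'a) \<noteq> 0" by (rule two_neq_0[OF odd])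
  have 4: "(4::'a) \<noteq> 0" by (rule four_neq_0[OF odd])
  have "jacobi_sum A A = (\<Sum>w\<in>UNIV. A ((1 - w\<^sup>2) / 4))"
    unfolding jacobi_sum_def mult_char_mult[OF A(1), symmetric]
  proof (rule sum.reindex_bij_witness[of _ "\<lambda>w. (1 + w) / 2" "\<lambda>x. 2 * x - 1"])
    fix x :: 'a
    have "(1 - (2 * x - 1)\<^sup>2) / 4 = x * (1 - x)"
      using 4 by (simp add: field_simps power2_eq_square)
    then show "A ((1 - (2 * x - 1)\<^sup>2) / 4) = A (x * (1 - x))" by (rule arg_cong)
  qed (use 2 in \<open>auto simp: field_simps\<close>)
  also have "\<dots> = inverse (A 4) * (\<Sum>w\<in>UNIV. A (1 - w\<^sup>2))"
    by (simp add: mult_char_divide[OF A(1)] sum_distrib_left field_simps)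
  also have "(\<Sum>w\<in>UNIV. A (1 - w\<^sup>2)) = (\<Sum>u\<in>UNIV. A (1 - u) * (1 + \<phi> u))"
    by (rule sum_square_arg[OF odd])
  also have "\<dots> = (\<Sum>u\<in>UNIV. A (1 - u)) + jacobi_sum \<phi> A"
    by (simp add: jacobi_sum_def sum.distrib algebra_simps)
  also have "(\<Sum>u\<in>UNIV. A (1 - u)) = (\<Sum>u\<in>UNIV. A u)"
    by (rule sum.reindex_bij_witness[of _ "\<lambda>x. 1 - x" "\<lambda>x. 1 - x"]) auto
  finally show ?thesis
    by (simp add: sum_mult_char_nontriv[OF A] jacobi_sum_commute[of A \<phi>])
qed

text \<open>Gauss sums are developed for an arbitrary nontrivial homomorphism on the additive group;
  the trace matters only for showing that the given character is one.\<close>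

locale additive_char =
  fixes \<theta> :: "'a::{field,finite} \<Rightarrow> complex"
  assumes \<theta>_add: "\<theta> (x + y) = \<theta> x * \<theta> y"
    and \<theta>_0: "\<theta> 0 = 1"
    and \<theta>_nontriv: "\<exists>x. \<theta> x \<noteq> 1"
begin

definition gauss :: "('a \<Rightarrow> complex) \<Rightarrow> complex" where
  "gauss \<chi> = (\<Sum>x\<in>UNIV. \<chi> x * \<theta> x)"

lemma sum_\<theta>: "(\<Sum>x\<in>UNIV. \<theta> x) = 0"
proof -
  obtain c where c: "\<theta> c \<noteq> 1" using \<theta>_nontriv by blast
  have "(\<Sum>x\<in>UNIV. \<theta> x) = (\<Sum>x\<in>UNIV. \<theta> (c + x))"
    by (rule sum.reindex_bij_witness[of _ "\<lambda>x. c + x" "\<lambda>x. x - c"]) auto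
  also have "\<dots> = \<theta> c * (\<Sum>x\<in>UNIV. \<theta> x)"
    by (simp add: \<theta>_add sum_distrib_left)
  finally show ?thesis using c by simp
qed

lemma gauss_triv: "gauss \<epsilon> = - 1"
proof -
  have "gauss \<epsilon> = (\<Sum>x\<in>UNIV - {0}. \<theta> x)"
    unfolding gauss_def by (rule sum.mono_neutral_cong_right) (auto simp: triv_char_def)
  then show ?thesis
    by (simp add: sum_diff1 sum_\<theta> \<theta>_0)
qed

text \<open>The product is collected by \<open>s = x + y\<close>. For \<open>s \<noteq> 0\<close>,
  scaling by \<open>s\<close> produces the Jacobi sum; the line \<open>s = 0\<close> contributes the
  full sum of \<open>A * B\<close>, which survives only for
  \<open>A * B = \<epsilon>\<close>.\<close>

lemma gauss_times:
  assumes A: "mult_char A" and B: "mult_char B"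
  shows "gauss A * gauss B = jacobi_sum A B * gauss (A * B) + B (- 1) * (of_nat CARD('a) - 1) * delta_char (A * B)"
proof -
  have inner: "(\<Sum>x\<in>UNIV. A x * B (s - x)) = (A * B) s * jacobi_sum A B + (if s = 0 then B (- 1) * (of_nat CARD('a) - 1) * delta_char (A * B) else 0)" for s
  proof (cases "s = 0")
    case True
    have "(\<Sum>x\<in>UNIV. A x * B (s - x)) = (\<Sum>x\<in>UNIV. B (- 1) * (A * B) x)"
    proof (rule sum.cong)
      fix x
      show "A x * B (s - x) = B (- 1) * (A * B) x"
        using mult_char_minus[OF B, of x] True by simp
    qed simp
    then show ?thesis
      using sum_mult_char[of "A * B"] A B True
      by (simp add: mult_char_0[OF A] flip: sum_distrib_left)
  next
    case False
    have "(\<Sum>x\<in>UNIV. A x * B (s - x)) = (\<Sum>x\<in>UNIV. A (s * x) * B (s - s * x))"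
      by (rule sum.reindex_bij_witness[of _ "\<lambda>x. s * x" "\<lambda>x. x / s"]) (use False in auto)
    also have "\<dots> = (\<Sum>x\<in>UNIV. (A * B) s * (A x * B (1 - x)))"
    proof (rule sum.cong)
      fix x
      have "s - s * x = s * (1 - x)" by (simp add: algebra_simps)
      then show "A (s * x) * B (s - s * x) = (A * B) s * (A x * B (1 - x))"
        by (simp add: mult_char_mult[OF A] mult_char_mult[OF B])
    qed simp
    finally show ?thesis
      using False by (simp add: jacobi_sum_def sum_distrib_left)
  qed
  have "gauss A * gauss B = (\<Sum>x\<in>UNIV. \<Sum>y\<in>UNIV. A x * B y * \<theta> (x + y))"
    by (simp add: gauss_def sum_product \<theta>_add mult_ac)
  also have "\<dots> = (\<Sum>x\<in>UNIV. \<Sum>s\<in>UNIV. A x * B (s - x) * \<theta> s)"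
  proof (rule sum.cong)
    fix x
    show "(\<Sum>y\<in>UNIV. A x * B y * \<theta> (x + y)) = (\<Sum>s\<in>UNIV. A x * B (s - x) * \<theta> s)"
      by (rule sum.reindex_bij_witness[of _ "\<lambda>s. s - x" "\<lambda>y. x + y"]) auto
  qed simp
  also have "\<dots> = (\<Sum>s\<in>UNIV. (\<Sum>x\<in>UNIV. A x * B (s - x)) * \<theta> s)"
    by (subst sum.swap) (simp add: sum_distrib_right)
  also have "\<dots> = (\<Sum>s\<in>UNIV. jacobi_sum A B * ((A * B) s * \<theta> s))
      + (\<Sum>s\<in>UNIV. if s = 0 then B (- 1) * (of_nat CARD('a) - 1) * delta_char (A * B) * \<theta> s else 0)"
    unfolding inner by (subst sum.distrib[symmetric]) (auto intro!: sum.cong simp: algebra_simps)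
  also have "\<dots> = jacobi_sum A B * gauss (A * B) + B (- 1) * (of_nat CARD('a) - 1) * delta_char (A * B)"
    by (simp add: gauss_def sum_distrib_left \<theta>_0)
  finally show ?thesis .
qed

lemma gauss_inverse:
  assumes "mult_char A" "A \<noteq> \<epsilon>"
  shows "gauss A * gauss (inverse A) = A (- 1) * of_nat CARD('a)"
  using gauss_times[of A "inverse A"] assms mult_char_inverse[OF assms(1), of "- 1"]
  by (simp add: jacobi_sum_inverse gauss_triv delta_char_def algebra_simps)

lemma gauss_nonzero:
  assumes "mult_char A" shows "gauss A \<noteq> 0"
proof (cases "A = \<epsilon>")
  case False
  then show ?thesis
    using gauss_inverse[OF assms] mult_char_eq_0_iff[OF assms, of "- 1"] by auto
qed (simp add: gauss_triv)

text \<open>The correction has the opposite sign to that in \<open>gauss_times\<close>, because it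
  is present only when the division is by \<open>gauss \<epsilon> = - 1\<close>.\<close>

lemma jacobi_sum_gauss:
  assumes "mult_char A" "mult_char B"
  shows "jacobi_sum A B = gauss A * gauss B / gauss (A * B) + (of_nat CARD('a) - 1) * A (- 1) * delta_char (A * B)"
proof (cases "A * B = \<epsilon>")
  case True
  then have "A = inverse B" using assms by (simp add: times_eq_triv_iff)
  then have "A (- 1) = B (- 1)"
    using mult_char_inverse[OF assms(2), of "- 1"] by simp
  then show ?thesis
    using gauss_times[OF assms] True by (simp add: gauss_triv delta_char_def)
next
  case False
  then show ?thesis
    using gauss_times[OF assms] gauss_nonzero[of "A * B"] assms by (simp add: delta_char_def)
qed

text \<open>If \<open>A * A \<noteq> \<epsilon>\<close>, the squared Gauss sum of \<open>A\<close>
  and the product of those of \<open>A\<close> and \<open>\<phi>\<close> both contain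
  \<open>jacobi_sum A \<phi>\<close>, the first by \<open>jacobi_sum_self\<close>; eliminating it
  and cancelling \<open>gauss A\<close> gives the relation. For \<open>A = \<epsilon>\<close> and
  \<open>A = \<phi>\<close> both sides contain the same two Gauss sums, and \<open>4\<close> is a
  square.\<close>

lemma hasse_davenport_quad:
  assumes odd: "odd CARD('a)" and A: "mult_char A"
  shows "gauss A * gauss (A * \<phi>) = inverse (A 4) * gauss \<phi> * gauss (A * A)"
proof -
  note \<phi> = mult_char_quad[where 'a = 'a, OF odd]
  have 4: "(4::'a) = 2\<^sup>2" "(4::'a) \<noteq> 0"
    by (simp add: power2_eq_square) (rule four_neq_0[OF odd])
  consider "A = \<epsilon>" | "A = \<phi>" | "A * A \<noteq> \<epsilon>" "A \<noteq> \<epsilon>"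
    using square_eq_triv_iff[OF odd A] by blast
  then show ?thesis
  proof cases
    case 1
    then show ?thesis using \<phi> 4 by (simp add: triv_char_def mult.commute)
  next
    case 2
    moreover have "\<phi> (4::'a) = 1"
      unfolding quad_char_def using 4 by metis
    ultimately show ?thesis by simp
  next
    case 3
    have "A * \<phi> \<noteq> \<epsilon>"
      using 3 A \<phi> by (auto simp: times_eq_triv_iff)
    then have *: "gauss A * gauss \<phi> = jacobi_sum A \<phi> * gauss (A * \<phi>)"
      using gauss_times[OF A \<phi>] by (simp add: delta_char_def)
    have "gauss A * gauss A = inverse (A 4) * jacobi_sum A \<phi> * gauss (A * A)"
      using gauss_times[OF A A] 3 by (simp add: delta_char_def jacobi_sum_self[OF odd A])
    then have "gauss A * (gauss A * gauss (A * \<phi>))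
        = inverse (A 4) * (jacobi_sum A \<phi> * gauss (A * \<phi>)) * gauss (A * A)"
      by (simp flip: mult.assoc)
    then have "gauss A * (gauss A * gauss (A * \<phi>)) = gauss A * (inverse (A 4) * gauss \<phi> * gauss (A * A))"
      unfolding *[symmetric] by (simp only: mult_ac)
    then show ?thesis
      using gauss_nonzero[OF A] by simp
  qed
qed

end

section \<open>The canonical additive character\<close>

text \<open>Translation by \<open>1\<close> permutes the field, so the sum of all elements does not
  change when \<open>1\<close> is added \<open>CARD('a)\<close> times. Thus \<open>p ^ r\<close>,
  and hence \<open>p\<close>, is \<open>0\<close> in the field.\<close>

lemma CHAR_prime_power_card:
  assumes p: "prime p" and card: "CARD('a::{field,finite}) = p ^ r"
  shows "CHAR('a) = p"
proof -
  have "(\<Sum>x\<in>UNIV. x) = (\<Sum>x\<in>UNIV. x + (1::'a))"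
    by (rule sum.reindex_bij_witness[of _ "\<lambda>x. x + 1" "\<lambda>x. x - 1"]) auto
  then have "of_nat CARD('a) = (0::'a)"
    by (simp add: sum.distrib)
  then have "of_nat p = (0::'a)"
    unfolding card by simp
  then have "CHAR('a) dvd p"
    by (simp add: of_nat_eq_0_iff_char_dvd)
  then show ?thesis
    using p CHAR_not_1'[where 'a = 'a] by (auto simp: prime_nat_iff)
qed

context
  fixes p r :: nat and \<zeta> :: complex
  assumes p: "prime p" and card: "CARD('a::{field,finite}) = p ^ r"
begin

lemma char_p: "CHAR('a) = p"
  using CHAR_prime_power_card[OF p card] .

lemma r_pos: "0 < r"
proof (rule Nat.gr0I)
  assume "r = 0"
  then have "CARD('a) = 1" using card by simp
  then have "(0::'a) = 1" by (metis UNIV_I card_1_singletonE singletonD)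
  then show False by simp
qed

lemma field_trace_add: "field_trace p r (x + y :: 'a) = field_trace p r x + field_trace p r y"
  using freshmans_dream'[where 'a = 'a] p
  by (simp add: field_trace_def char_p sum.distrib)

lemma field_trace_0: "field_trace p r (0 :: 'a) = 0"
  using prime_gt_0_nat[OF p] by (simp add: field_trace_def power_0_left)

lemma power_card: "(x :: 'a) ^ (p ^ r) = x"
proof (cases "x = 0")
  case True
  then show ?thesis using prime_gt_0_nat[OF p] by simp
next
  case False
  have "p ^ r = Suc (CARD('a) - 1)"
    using zero_less_card_finite[where 'a = 'a] card by linarith
  then have "x ^ (p ^ r) = x ^ Suc (CARD('a) - 1)"
    by (rule arg_cong)
  also have "\<dots> = x"
    by (simp only: power_Suc power_card_minus_1[OF False] mult_1_right)
  finally show ?thesis .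
qed

text \<open>Frobenius is additive and shifts the conjugates cyclically: the new last term
  \<open>x ^ (p ^ r)\<close> equals the first one, \<open>x\<close>, that was lost.\<close>

lemma field_trace_power: "field_trace p r (x :: 'a) ^ p = field_trace p r x"
proof -
  have "field_trace p r x ^ p = (\<Sum>i<r. (x ^ (p ^ i)) ^ p)"
    unfolding field_trace_def by (rule freshmans_dream_sum) (simp_all only: char_p p)
  also have "\<dots> = (\<Sum>i<r. x ^ (p ^ Suc i))"
    by (simp only: power_mult[symmetric] power_Suc2)
  also have "\<dots> = (\<Sum>i<Suc r. x ^ (p ^ i)) - x ^ (p ^ 0)"
    by (simp only: sum.lessThan_Suc_shift add_diff_cancel_left')
  also have "\<dots> = field_trace p r x"
    by (simp add: power_card field_trace_def)
  finally show ?thesis .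
qed

text \<open>The fixed points of Frobenius are roots of a polynomial of degree \<open>p\<close>, and
  the images of \<open>0, ..., p - 1\<close> already are \<open>p\<close> of them. This makes the
  \<open>THE\<close> in \<open>add_char\<close> meaningful.\<close>

lemma prime_field_of_nat:
  assumes "(t :: 'a) ^ p = t"
  shows "\<exists>!k. k < p \<and> of_nat k = t"
proof -
  have p1: "1 < p" using p prime_gt_1_nat by blast
  have inj: "inj_on (of_nat :: nat \<Rightarrow> 'a) {..<p}"
  proof (rule inj_onI)
    fix i j assume "i \<in> {..<p}" "j \<in> {..<p}" and eq: "of_nat i = (of_nat j :: 'a)"
    then have "of_nat (i - j) = (0 :: 'a)" "of_nat (j - i) = (0 :: 'a)"
      by (cases "i \<le> j"; simp add: of_nat_diff)+
    then have "p dvd i - j" "p dvd j - i"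
      by (simp_all add: of_nat_eq_0_iff_char_dvd char_p)
    then show "i = j"
      using \<open>i \<in> _\<close> \<open>j \<in> _\<close> by (auto dest!: dvd_imp_le)
  qed
  define P where "P = monom (1::'a) p - monom 1 1"
  have P: "P \<noteq> 0"
  proof
    assume "P = 0"
    then have "coeff P p = 0" by simp
    then show False using p1 by (simp add: P_def)
  qed
  have "degree P \<le> p"
    unfolding P_def using p1 by (intro degree_diff_le) (auto simp: degree_monom_eq)
  then have le: "card {t::'a. t ^ p = t} \<le> p"
    using card_poly_roots_bound[OF P] by (simp add: P_def poly_monom)
  have frob: "(of_nat k :: 'a) ^ p = of_nat k" for k
  proof (induction k)
    case 0
    then show ?case using p1 by simp
  next
    case (Suc k)
    have "(1 + of_nat k :: 'a) ^ p = 1 ^ p + of_nat k ^ p"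
      by (rule freshmans_dream) (simp_all only: char_p p)
    then show ?case by (simp only: of_nat_Suc Suc.IH power_one)
  qed
  have "of_nat ` {..<p} = {t::'a. t ^ p = t}"
    by (rule card_seteq) (use frob le in \<open>auto simp: card_image[OF inj]\<close>)
  then have "t \<in> of_nat ` {..<p}" using assms by simp
  then show ?thesis
    using inj by (auto simp: inj_on_def)
qed

lemma additive_char_add_char:
  assumes \<zeta>: "primitive_root_of_unity p \<zeta>"
  shows "additive_char (add_char p r \<zeta> :: 'a \<Rightarrow> complex)"
proof -
  define k where "k \<alpha> = (THE k. k < p \<and> of_nat k = field_trace p r \<alpha>)" for \<alpha> :: 'a
  have k: "k \<alpha> < p" "of_nat (k \<alpha>) = field_trace p r \<alpha>" for \<alpha>
    using theI'[OF prime_field_of_nat[OF field_trace_power[of \<alpha>]]] by (simp_all add: k_def)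
  have k_eq: "k \<alpha> = i" if "i < p" "of_nat i = field_trace p r \<alpha>" for \<alpha> i
    using prime_field_of_nat[OF field_trace_power[of \<alpha>]] k[of \<alpha>] that by blast
  have add_char: "add_char p r \<zeta> \<alpha> = \<zeta> ^ k \<alpha>" for \<alpha> :: 'a
    by (simp add: add_char_def k_def)
  have p0: "0 < p" using p prime_gt_0_nat by blast
  have p1: "1 < p" using p prime_gt_1_nat by blast
  have red: "\<zeta> ^ i = \<zeta> ^ (i mod p)" for i
  proof -
    have "\<zeta> ^ i = \<zeta> ^ (p * (i div p) + i mod p)" by simp
    then show ?thesis
      using \<zeta> unfolding primitive_root_of_unity_def power_add power_mult by simp
  qed
  show ?thesis
  proof
    fix x y :: 'a
    have "of_nat ((k x + k y) mod p) = (of_nat (k x + k y) :: 'a)"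
      using of_nat_CHAR[where 'a = 'a] unfolding char_p
      by (metis add.right_neutral mult_div_mod_eq mult_zero_left of_nat_add of_nat_mult add_0)
    then have "k (x + y) = (k x + k y) mod p"
      using p0 by (intro k_eq) (simp_all add: field_trace_add k(2))
    then show "add_char p r \<zeta> (x + y) = add_char p r \<zeta> x * add_char p r \<zeta> y"
      using red[of "k x + k y"] by (simp add: add_char power_add)
  next
    have "k 0 = 0" using p0 by (intro k_eq) (simp_all add: field_trace_0)
    then show "add_char p r \<zeta> (0::'a) = 1" by (simp add: add_char)
  next
    \<comment> \<open>Nontriviality: the trace is a polynomial function of degree at most
      \<open>p ^ (r - 1)\<close>, less than the field size, and its linear coefficient is
      \<open>1\<close>, from \<open>i = 0\<close> alone. An element of nonzero trace has an exponent
      strictly between \<open>0\<close> and \<open>p\<close>, where primitivity of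
      \<open>\<zeta>\<close> excludes the value \<open>1\<close>.\<close>
    define P where "P = (\<Sum>i<r. monom (1::'a) (p ^ i))"
    have "coeff P 1 = (\<Sum>i<r. if i = 0 then 1 else 0)"
      using p1 unfolding P_def coeff_sum by (intro sum.cong) auto
    then have "coeff P 1 = 1" using r_pos by simp
    then have P: "P \<noteq> 0" by auto
    have "degree P \<le> p ^ (r - 1)"
      unfolding P_def using p1
      by (intro degree_sum_le) (auto simp: degree_monom_eq intro!: power_increasing)
    also have "\<dots> < p ^ r"
      using p1 r_pos by (intro power_strict_increasing) auto
    finally have "card {\<alpha>. poly P \<alpha> = 0} < CARD('a)"
      using card_poly_roots_bound[OF P] card by linarith
    then have "{\<alpha>. poly P \<alpha> = 0} \<noteq> UNIV" by auto
    then obtain \<alpha> where "poly P \<alpha> \<noteq> 0" by blast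
    then have "field_trace p r \<alpha> \<noteq> 0"
      by (simp add: P_def poly_sum poly_monom field_trace_def)
    then have "0 < k \<alpha>" using k(2)[of \<alpha>] by (metis gr0I of_nat_0)
    then show "\<exists>x::'a. add_char p r \<zeta> x \<noteq> 1"
      using \<zeta> k(1)[of \<alpha>] unfolding primitive_root_of_unity_def add_char by blast
  qed
qed

end

section \<open>Two double character sums\<close>

text \<open>Moves the condition into the summand, so that splitting a sum along several curves
  becomes an identity for each single pair.\<close>

lemma sum_filter_pairs:
  assumes "finite S"
  shows "sum f {(s, t) \<in> S. P s t} = (\<Sum>a\<in>S. if P (fst a) (snd a) then f a else 0)"
proof -
  have "{(s, t) \<in> S. P s t} = {a \<in> S. P (fst a) (snd a)}" by auto
  then show ?thesis using sum.inter_filter[OF assms] by simp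
qed

lemma sum_ratio_punctured:
  fixes f :: "'a::{field,finite} \<Rightarrow> complex"
  assumes "w \<noteq> 0" "w \<noteq> 1"
  shows "(\<Sum>x\<in>UNIV - {0, 1, w}. f (x / (1 - x)))
    = (\<Sum>u\<in>UNIV. f u) - f 0 - f (- 1) - f (w / (1 - w))"
proof -
  have "UNIV - {0, 1, w} = (UNIV - {0, 1}) - {w}" by auto
  then show ?thesis
    using assms by (simp add: sum_diff1 sum_ratio[symmetric])
qed

text \<open>The map \<open>t / (t - c)\<close> omits just the value \<open>1\<close>, which it takes
  at infinity; so the vanishing full sum loses \<open>B 1\<close>.\<close>

lemma sum_char_ratio_shift:
  fixes B :: "'a::{field,finite} \<Rightarrow> complex"
  assumes B: "mult_char B" "B \<noteq> \<epsilon>" and c: "c \<noteq> 0"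
  shows "(\<Sum>t\<in>UNIV - {c}. B (t / (t - c))) = - 1"
proof -
  have "(\<Sum>t\<in>UNIV - {c}. B (t / (t - c))) = (\<Sum>u\<in>UNIV - {1}. B u)"
  proof (rule sum.reindex_bij_witness[of _ "\<lambda>u. c * u / (u - 1)" "\<lambda>t. t / (t - c)"])
    fix t assume "t \<in> UNIV - {c}"
    then have t: "t - c \<noteq> 0" by simp
    then have *: "t / (t - c) - 1 = c / (t - c)" by (simp add: field_simps)
    show "c * (t / (t - c)) / (t / (t - c) - 1) = t"
      unfolding * using t c by simp
    have "t / (t - c) - 1 \<noteq> 0"
      unfolding * using t c by simp
    then show "t / (t - c) \<in> UNIV - {1}" by auto
  next
    fix u :: 'a assume "u \<in> UNIV - {1}"
    then have u: "u - 1 \<noteq> 0" by simp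
    have *: "c * u / (u - 1) - c = c / (u - 1)"
      using u by (simp add: field_simps)
    show "c * u / (u - 1) / (c * u / (u - 1) - c) = u"
      unfolding * using u c by simp
    have "c * u / (u - 1) - c \<noteq> 0"
      unfolding * using u c by simp
    then show "c * u / (u - 1) \<in> UNIV - {c}" by auto
  qed simp
  then show ?thesis
    by (simp add: sum_diff1 sum_mult_char_nontriv[OF B] mult_char_1[OF B(1)])
qed

section \<open>The two double sums and the substitution between them\<close>

definition lhs_term :: "('a::{field,finite} \<Rightarrow> complex) \<Rightarrow> ('a \<Rightarrow> complex) \<Rightarrow> ('a \<Rightarrow> complex) \<Rightarrow> 'a \<Rightarrow> 'a \<Rightarrow> 'a \<times> 'a \<Rightarrow> complex" where
  "lhs_term A B E x v = (\<lambda>(s, t).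
     A (s / ((1 - s) * (1 - x * t))) * B (t / ((1 - t) * (1 - v * s))) * E ((1 - s) * (1 - t)))"

definition rhs_term :: "('a::{field,finite} \<Rightarrow> complex) \<Rightarrow> ('a \<Rightarrow> complex) \<Rightarrow> ('a \<Rightarrow> complex) \<Rightarrow> 'a \<Rightarrow> 'a \<Rightarrow> 'a \<times> 'a \<Rightarrow> complex" where
  "rhs_term A B E x v = (\<lambda>(m, n).
     A (m / (1 - m)) * B ((1 - n) / (n * (1 - x * v * (m * (1 - m) * n)))) * E ((1 - m) * n))"

text \<open>Outside the support the term is \<open>0\<close>, since a division by zero yields
  \<open>0\<close> and characters vanish at \<open>0\<close>. Inside it, every argument is a genuine
  nonzero quotient. The same holds for \<open>rhs_supp\<close>.\<close>

definition lhs_supp :: "'a::field \<Rightarrow> 'a \<Rightarrow> ('a \<times> 'a) set" where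
  "lhs_supp x v = {(s, t). s \<noteq> 0 \<and> s \<noteq> 1 \<and> t \<noteq> 0 \<and> t \<noteq> 1 \<and> x * t \<noteq> 1 \<and> v * s \<noteq> 1}"

definition rhs_supp :: "'a::field \<Rightarrow> 'a \<Rightarrow> ('a \<times> 'a) set" where
  "rhs_supp x v = {(m, n). m \<noteq> 0 \<and> m \<noteq> 1 \<and> n \<noteq> 0 \<and> n \<noteq> 1 \<and> x * v * (m * (1 - m) * n) \<noteq> 1}"

context
  fixes A B E :: "'a::{field,finite} \<Rightarrow> complex" and x v :: 'a
  assumes A: "mult_char A" and B: "mult_char B" and E: "mult_char E"
    and x: "x \<noteq> 0" "x \<noteq> 1" and v: "v = x / (x - 1)"
begin

abbreviation "termL \<equiv> lhs_term A B E x v"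
abbreviation "termR \<equiv> rhs_term A B E x v"
abbreviation "suppL \<equiv> lhs_supp x v"
abbreviation "suppR \<equiv> rhs_supp x v"

text \<open>The relation \<open>x + v = x * v\<close> means \<open>(1 - x) * (1 - v) = 1\<close>.
  The quotient \<open>x / v\<close> is the constant argument or factor that \<open>B\<close>
  receives on two of the exceptional curves.\<close>

lemma v_neq_0: "v \<noteq> 0" and vx: "v * (x - 1) = x" and xv: "x + v = x * v" and x_div_v: "x / v = x - 1"
proof -
  have x1: "x - 1 \<noteq> 0" using x by simp
  show "v \<noteq> 0" using x x1 by (simp add: v)
  show vx: "v * (x - 1) = x" using x1 by (simp add: v)
  show "x + v = x * v" using vx by (simp add: algebra_simps)
  show "x / v = x - 1" using x x1 by (simp add: v)
qed

text \<open>
  The formulas for \<open>m\<close> and \<open>n\<close> solve \<open>m / (1 - m) = s / ((1 - s) (1 - x t))\<close> and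
  \<open>(1 - m) n = (1 - s) (1 - t)\<close>; the two excluded conditions are \<open>1 - x t + x s t = 0\<close>, where \<open>m\<close> has
  a pole, and \<open>1 - x t - x s + x s t = 0\<close>, where \<open>n = 1\<close>.
\<close>

lemma forward_map:
  assumes st: "(s, t) \<in> suppL" and L1: "x * t * (1 - s) \<noteq> 1" and L2: "x * ((1 - s) * (1 - t)) \<noteq> x - 1"
  defines "d \<equiv> 1 - x * t + x * s * t"
  defines "m \<equiv> s / d" and "n \<equiv> (1 - t) * d / (1 - x * t)"
  shows "(m, n) \<in> suppR" "x * m * n \<noteq> 1" "x * m \<noteq> 1" "x * ((1 - m) * n) \<noteq> x - 1"
    and "(1 - n) / (1 - x * m * n) = t" "m * (1 - x + x * ((1 - m) * n)) / (1 - x * m) = s"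
    and "termR (m, n) = termL (s, t)"
proof -
  define u where "u = 1 - x * t"
  \<comment> \<open>Each of \<open>1 - n\<close>, \<open>1 - x * m * n\<close>,
    \<open>1 - x * m\<close> and \<open>1 - x + x * ((1 - m) * n)\<close> will turn out to be
    \<open>e\<close> times a nonzero factor. Hence the single condition \<open>e \<noteq> 0\<close>
    secures four conditions on \<open>(m, n)\<close>.\<close>
  define e where "e = 1 - x * t - x * s + x * s * t"
  have st0: "s \<noteq> 0" "1 - s \<noteq> 0" "t \<noteq> 0" "1 - t \<noteq> 0" "1 - v * s \<noteq> 0"
    using st by (auto simp: lhs_supp_def)
  have u: "u \<noteq> 0" using st by (auto simp: lhs_supp_def u_def)
  have d: "d \<noteq> 0" using L1 by (simp add: d_def algebra_simps)
  have e: "e \<noteq> 0" using L2 by (simp add: e_def algebra_simps)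
  have m: "m = s / d" and n: "n = (1 - t) * d / u" by (simp_all add: m_def n_def u_def)
  have "d - s = (1 - s) * u" by (simp add: d_def u_def algebra_simps)
  then have 1: "1 - m = (1 - s) * u / d" using d by (simp add: m diff_divide_eq_iff)
  have 2: "(1 - m) * n = (1 - s) * (1 - t)" unfolding 1 n using d u by simp
  have "u - (1 - t) * d = t * e" by (simp add: d_def u_def e_def algebra_simps)
  then have 3: "1 - n = t * e / u" using u by (simp add: n diff_divide_eq_iff)
  have 4: "m * (1 - m) * n = s * ((1 - s) * (1 - t)) / d"
    using 2 by (simp add: mult.assoc) (simp add: m)
  \<comment> \<open>Here the relation between \<open>x\<close> and \<open>v\<close> enters: the
    defect \<open>s * (x + v - x * v)\<close> vanishes, and the factor \<open>1 - v * s\<close>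
    required by the argument of \<open>B\<close> splits off.\<close>
  have "d - x * v * (s * ((1 - s) * (1 - t))) = e * (1 - v * s) + s * (x + v - x * v)"
    by (simp add: d_def e_def algebra_simps)
  then have "d - x * v * (s * ((1 - s) * (1 - t))) = e * (1 - v * s)"
    by (simp add: xv)
  then have 5: "1 - x * v * (m * (1 - m) * n) = e * (1 - v * s) / d"
    unfolding 4 using d by (simp add: diff_divide_eq_iff)
  have "u - x * s * (1 - t) = e" by (simp add: u_def e_def algebra_simps)
  moreover have "m * n = s * (1 - t) / u" using d by (simp add: m n)
  ultimately have 6: "1 - x * m * n = e / u" using u by (simp add: mult.assoc diff_divide_eq_iff)
  have "d - x * s = e" by (simp add: d_def e_def algebra_simps)
  then have 7: "1 - x * m = e / d" using d by (simp add: m diff_divide_eq_iff)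
  have 8: "1 - x + x * ((1 - m) * n) = e" unfolding 2 by (simp add: e_def algebra_simps)
  have "m \<noteq> 0" "1 - m \<noteq> 0" "n \<noteq> 0" "1 - n \<noteq> 0" "1 - x * v * (m * (1 - m) * n) \<noteq> 0"
  proof -
    show "m \<noteq> 0" "n \<noteq> 0" using st0 u d by (simp_all add: m n)
    show "1 - m \<noteq> 0" unfolding 1 using st0 u d by simp
    show "1 - n \<noteq> 0" unfolding 3 using st0 u e by simp
    show "1 - x * v * (m * (1 - m) * n) \<noteq> 0" unfolding 5 using st0 d e by simp
  qed
  then show "(m, n) \<in> suppR" by (auto simp: rhs_supp_def)
  have "1 - x * m * n \<noteq> 0" "1 - x * m \<noteq> 0" unfolding 6 7 using e u d by simp_all
  then show "x * m * n \<noteq> 1" "x * m \<noteq> 1" by auto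
  show "x * ((1 - m) * n) \<noteq> x - 1"
  proof
    assume *: "x * ((1 - m) * n) = x - 1"
    show False using 8 e unfolding * by simp
  qed
  show "(1 - n) / (1 - x * m * n) = t" unfolding 3 6 using e u by simp
  show "m * (1 - x + x * ((1 - m) * n)) / (1 - x * m) = s" unfolding 7 8 using e d by (simp add: m)
  have "m / (1 - m) = s / ((1 - s) * (1 - x * t))" unfolding 1 using d by (simp add: m u_def)
  moreover have "(1 - n) / (n * (1 - x * v * (m * (1 - m) * n))) = t / ((1 - t) * (1 - v * s))"
    unfolding 3 5 using d u e by (simp add: n)
  ultimately show "termR (m, n) = termL (s, t)"
    by (simp add: rhs_term_def lhs_term_def 2)
qed

text \<open>The formulas are read off from the forward direction. There
  \<open>1 - n = t * e / u\<close> and \<open>1 - x * m * n = e / u\<close> have quotient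
  \<open>t\<close>; from \<open>1 - x + x * ((1 - m) * n) = e\<close> and
  \<open>1 - x * m = e / d\<close> one recovers \<open>d\<close>, and \<open>s = m * d\<close>. The
  excluded curves are the zeros of the denominators \<open>h\<close> and \<open>k\<close>, and of
  \<open>l\<close>, which would give \<open>s = 0\<close> and \<open>x * t = 1\<close>.\<close>

lemma backward_map:
  assumes mn: "(m, n) \<in> suppR" and R1: "x * m * n \<noteq> 1" and R2: "x * m \<noteq> 1" and R3: "x * ((1 - m) * n) \<noteq> x - 1"
  defines "s \<equiv> m * (1 - x + x * ((1 - m) * n)) / (1 - x * m)" and "t \<equiv> (1 - n) / (1 - x * m * n)"
  shows "(s, t) \<in> suppL" "x * t * (1 - s) \<noteq> 1" "x * ((1 - s) * (1 - t)) \<noteq> x - 1"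
    and "s / (1 - x * t + x * s * t) = m" "(1 - t) * (1 - x * t + x * s * t) / (1 - x * t) = n"
proof -
  define h where "h = 1 - x * m * n"
  define k where "k = 1 - x * m"
  define l where "l = 1 - x + x * ((1 - m) * n)"
  have mn0: "m \<noteq> 0" "1 - m \<noteq> 0" "n \<noteq> 0" "1 - n \<noteq> 0" "1 - x * v * (m * (1 - m) * n) \<noteq> 0"
    using mn by (auto simp: rhs_supp_def)
  have h: "h \<noteq> 0" and k: "k \<noteq> 0" using R1 R2 by (simp_all add: h_def k_def)
  have l: "l \<noteq> 0"
  proof
    assume "l = 0"
    then have "x - 1 + l = x - 1" by simp
    then have "x * ((1 - m) * n) = x - 1" by (simp add: l_def)
    with R3 show False by simp
  qed
  have s: "s = m * l / k" and t: "t = (1 - n) / h" by (simp_all add: s_def t_def h_def k_def l_def)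
  have "h - (1 - n) = n * k" by (simp add: h_def k_def algebra_simps)
  then have 1: "1 - t = n * k / h" using h by (simp add: t diff_divide_eq_iff)
  have "h - x * (1 - n) = l" by (simp add: h_def l_def algebra_simps)
  then have 2: "1 - x * t = l / h" using h by (simp add: t diff_divide_eq_iff)
  have "k - m * l = (1 - m) * h" by (simp add: h_def k_def l_def algebra_simps)
  then have 3: "1 - s = (1 - m) * h / k" using k by (simp add: s diff_divide_eq_iff)
  have "k - v * (m * l) = 1 - x * v * (m * (1 - m) * n) - m * (x + v - x * v)"
    by (simp add: k_def l_def algebra_simps)
  then have "k - v * (m * l) = 1 - x * v * (m * (1 - m) * n)"
    by (simp add: xv)
  then have 4: "1 - v * s = (1 - x * v * (m * (1 - m) * n)) / k"
    using k by (simp add: s diff_divide_eq_iff)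
  have "l * k + x * (m * l * (1 - n)) = l * h" by (simp add: h_def k_def algebra_simps)
  moreover have "1 - x * t + x * s * t = (l * k + x * (m * l * (1 - n))) / (h * k)"
    unfolding 2 using h k by (simp add: s t add_divide_distrib mult_ac)
  ultimately have 5: "1 - x * t + x * s * t = l / k"
    using h by simp
  have "s \<noteq> 0" "t \<noteq> 0" "1 - s \<noteq> 0" "1 - t \<noteq> 0" "1 - x * t \<noteq> 0" "1 - v * s \<noteq> 0"
    unfolding 1 2 3 4 using mn0 h k l by (simp_all add: s t)
  then show "(s, t) \<in> suppL" by (auto simp: lhs_supp_def)
  have "1 - x * t * (1 - s) = 1 - x * t + x * s * t" by (simp add: algebra_simps)
  then have "1 - x * t * (1 - s) \<noteq> 0" unfolding 5 using l k by simp
  then show "x * t * (1 - s) \<noteq> 1" by auto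
  have 6: "(1 - s) * (1 - t) = (1 - m) * n" unfolding 1 3 using h k by simp
  show "x * ((1 - s) * (1 - t)) \<noteq> x - 1" unfolding 6 by (rule R3)
  show "s / (1 - x * t + x * s * t) = m" unfolding 5 using l k by (simp add: s)
  show "(1 - t) * (1 - x * t + x * s * t) / (1 - x * t) = n" unfolding 5 unfolding 1 2 using h k l by simp
qed

lemma sum_lhs_term_generic:
  "sum termL {(s, t) \<in> suppL. x * t * (1 - s) \<noteq> 1 \<and> x * ((1 - s) * (1 - t)) \<noteq> x - 1}
   = sum termR {(m, n) \<in> suppR. x * m * n \<noteq> 1 \<and> x * m \<noteq> 1 \<and> x * ((1 - m) * n) \<noteq> x - 1}"
proof (rule sum.reindex_bij_witness[of _
      "\<lambda>(m, n). (m * (1 - x + x * ((1 - m) * n)) / (1 - x * m), (1 - n) / (1 - x * m * n))"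
      "\<lambda>(s, t). (s / (1 - x * t + x * s * t), (1 - t) * (1 - x * t + x * s * t) / (1 - x * t))"],
    goal_cases)
  case (1 a)
  obtain s t where a: "a = (s, t)" by (cases a)
  have *: "(s, t) \<in> suppL" "x * t * (1 - s) \<noteq> 1" "x * ((1 - s) * (1 - t)) \<noteq> x - 1"
    using 1 unfolding a by auto
  show ?case
    unfolding a prod.case mem_Collect_eq by (simp only: forward_map(5,6)[OF *] simp_thms)
next
  case (2 a)
  obtain s t where a: "a = (s, t)" by (cases a)
  have *: "(s, t) \<in> suppL" "x * t * (1 - s) \<noteq> 1" "x * ((1 - s) * (1 - t)) \<noteq> x - 1"
    using 2 unfolding a by auto
  show ?case
    unfolding a prod.case mem_Collect_eq by (simp only: forward_map(1-4)[OF *] simp_thms)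
next
  case (3 a)
  obtain m n where a: "a = (m, n)" by (cases a)
  have *: "(m, n) \<in> suppR" "x * m * n \<noteq> 1" "x * m \<noteq> 1" "x * ((1 - m) * n) \<noteq> x - 1"
    using 3 unfolding a by auto
  show ?case
    unfolding a prod.case mem_Collect_eq by (simp only: backward_map(4,5)[OF *] simp_thms)
next
  case (4 a)
  obtain m n where a: "a = (m, n)" by (cases a)
  have *: "(m, n) \<in> suppR" "x * m * n \<noteq> 1" "x * m \<noteq> 1" "x * ((1 - m) * n) \<noteq> x - 1"
    using 4 unfolding a by auto
  show ?case
    unfolding a prod.case mem_Collect_eq by (simp only: backward_map(1-3)[OF *] simp_thms)
next
  case (5 a)
  obtain s t where a: "a = (s, t)" by (cases a)
  have *: "(s, t) \<in> suppL" "x * t * (1 - s) \<noteq> 1" "x * ((1 - s) * (1 - t)) \<noteq> x - 1"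
    using 5 unfolding a by auto
  show ?case
    unfolding a prod.case mem_Collect_eq by (simp only: forward_map(7)[OF *] simp_thms)
qed

text \<open>On this curve \<open>m\<close> would be infinite. The argument of \<open>A\<close>
  freezes at \<open>- 1\<close>, while those of \<open>B\<close> and \<open>E\<close> depend on
  \<open>t / (1 - t)\<close> alone, quadratically and inversely; so the sum fails to cancel exactly
  for \<open>B * B = E\<close>. The point \<open>t = 1 / x\<close> is missing because it has
  \<open>s = 0\<close>.\<close>

lemma sum_lhs_exceptional_1:
  "sum termL {(s, t) \<in> suppL. x * t * (1 - s) = 1}
   = A (- 1) * B (x - 1) / E x * (\<Sum>t\<in>UNIV - {0, 1, 1 / x}. (B * B * inverse E) (t / (1 - t)))"
  unfolding sum_distrib_left
proof (rule sum.reindex_bij_witness[of _ "\<lambda>t. (1 - 1 / (x * t), t)" snd], goal_cases)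
  case (1 a)
  obtain s t where a: "a = (s, t)" by (cases a)
  have *: "s \<noteq> 0" "s \<noteq> 1" "t \<noteq> 0" "t \<noteq> 1" "x * t \<noteq> 1" "x * t * (1 - s) = 1"
    using 1 by (auto simp: a lhs_supp_def)
  then show ?case
    using x by (simp add: a field_simps)
next
  case (2 a)
  obtain s t where a: "a = (s, t)" by (cases a)
  have "t \<noteq> 0" "t \<noteq> 1" "x * t \<noteq> 1"
    using 2 by (auto simp: a lhs_supp_def)
  then show ?case
    using x by (auto simp: a field_simps)
next
  case (3 t)
  then show ?case by simp
next
  case (4 t)
  then have t: "t \<noteq> 0" "1 - t \<noteq> 0" "x * t \<noteq> 1"
    using x by (auto simp: field_simps)
  define s where "s = 1 - 1 / (x * t)"
  have s1: "1 - s = 1 / (x * t)" by (simp add: s_def)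
  have "1 - v * s = (x * t * (1 - v) + v) / (x * t)"
    using t x by (simp add: s_def field_simps)
  also have "x * t * (1 - v) + v = v * (1 - t)"
    using xv by (simp add: algebra_simps flip: distrib_left) 
  finally have vs: "1 - v * s = v * (1 - t) / (x * t)" .
  have "s \<noteq> 0" "1 - s \<noteq> 0" "1 - v * s \<noteq> 0"
    unfolding s1 vs using t x v_neq_0 by (auto simp: s_def field_simps)
  then show ?case
    using t x s1 by (auto simp: lhs_supp_def simp flip: s_def)
next
  case (5 a)
  obtain s t where a: "a = (s, t)" by (cases a)
  have t: "t \<noteq> 0" "1 - t \<noteq> 0" "1 - x * t \<noteq> 0" and xts: "x * t * (1 - s) = 1"
    using 5 by (auto simp: a lhs_supp_def)
  have s1: "1 - s = 1 / (x * t)" using xts x t by (simp add: field_simps)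
  have s: "s = - ((1 - x * t) / (x * t))"
    using xts x t by (simp add: field_simps)
  have "1 - v * s = (x * t * (1 - v) + v) / (x * t)"
    using t x by (simp add: s field_simps)
  also have "x * t * (1 - v) + v = v * (1 - t)"
    using xv by (simp add: algebra_simps flip: distrib_left)
  finally have vs: "1 - v * s = v * (1 - t) / (x * t)" .
  have Aarg: "s / ((1 - s) * (1 - x * t)) = - 1"
    unfolding s1 using x t by (simp add: s) (simp add: divide_eq_eq)
  have Barg: "t / ((1 - t) * (1 - v * s)) = x / v * (t / (1 - t) * (t / (1 - t)))"
    unfolding vs using x t v_neq_0 by (simp add: mult_ac)
  have Earg: "(1 - s) * (1 - t) = 1 / (x * (t / (1 - t)))"
    unfolding s1 using x t by simp
  show ?case
    unfolding a lhs_term_def prod.case Aarg Barg Earg x_div_v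
    unfolding mult_char_mult[OF B, of "x - 1"]
      mult_char_mult[OF B, of "t / (1 - t)"] mult_char_divide[OF E] mult_char_mult[OF E] mult_char_1[OF E]
    by (simp add: mult_char_divide[OF E] field_simps)
qed

text \<open>On this curve \<open>n\<close> would be \<open>1\<close>. Besides the argument of
  \<open>E\<close>, that of \<open>A\<close> is constant, and only \<open>B\<close> varies. Its
  argument contains \<open>t / (t - (2 - x))\<close>, which is nonconstant unless
  \<open>x = 2\<close>: this is the origin of the term with \<open>delta_elem\<close>.\<close>

lemma sum_lhs_exceptional_2:
  "sum termL {(s, t) \<in> suppL. x * ((1 - s) * (1 - t)) = x - 1}
   = E ((x - 1) / x) * A (1 / (x - 1)) * B (x - 1)
      * (\<Sum>t\<in>UNIV - {0, 1, 1 / x, 2 - x}. B (t / (t - (2 - x))))"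
  unfolding sum_distrib_left
proof (rule sum.reindex_bij_witness[of _ "\<lambda>t. ((1 - x * t) / (x * (1 - t)), t)" snd], goal_cases)
  case (1 a)
  obtain s t where a: "a = (s, t)" by (cases a)
  have *: "1 - t \<noteq> 0" "x * ((1 - s) * (1 - t)) = x - 1"
    using 1 by (auto simp: a lhs_supp_def)
  have "s * (x * (1 - t)) = 1 - x * t + (x - 1 - x * ((1 - s) * (1 - t)))" by (simp add: algebra_simps)
  then have "s * (x * (1 - t)) = 1 - x * t" unfolding * by simp
  then show ?case
    using x * by (simp add: a divide_eq_eq)
next
  case (2 a)
  obtain s t where a: "a = (s, t)" by (cases a)
  have *: "t \<noteq> 0" "t \<noteq> 1" "x * t \<noteq> 1" "x * ((1 - s) * (1 - t)) = x - 1" "v * s \<noteq> 1"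
    using 2 by (auto simp: a lhs_supp_def)
  \<comment> \<open>At \<open>t = 2 - x\<close> the curve would meet \<open>v * s = 1\<close>, which
    is outside the support.\<close>
  have "t \<noteq> 2 - x"
  proof
    assume "t = 2 - x"
    then have "1 - t = x - 1" by simp
    then have "x * (1 - s) * (x - 1) = x - 1" using *(4) by (simp only: mult.assoc)
    then have "x * (1 - s) = 1" using x by simp
    then have "v * (x * s - (x - 1)) = 0" by (simp add: algebra_simps)
    then have "x * (v * s) = x" using vx by (simp add: algebra_simps)
    then show False using x *(5) by simp
  qed
  then show ?case
    using x * by (auto simp: a field_simps)
next
  case (3 t)
  then show ?case by simp
next
  case (4 t)
  then have t: "t \<noteq> 0" "1 - t \<noteq> 0" "1 - x * t \<noteq> 0" "t - (2 - x) \<noteq> 0"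
    using x by (auto simp: field_simps)
  define s where "s = (1 - x * t) / (x * (1 - t))"
  have s1: "1 - s = (x - 1) / (x * (1 - t))"
    using x t by (simp add: s_def field_simps)
  have "v * s = (1 - x * t) / ((x - 1) * (1 - t))"
    using x t by (simp add: s_def v)
  moreover have "(x - 1) * (1 - t) - (1 - x * t) = t - (2 - x)"
    by (simp add: algebra_simps)
  ultimately have vs: "1 - v * s = (t - (2 - x)) / ((x - 1) * (1 - t))"
    using x t by (simp add: diff_divide_eq_iff)
  have "s \<noteq> 0" "1 - s \<noteq> 0" "1 - v * s \<noteq> 0"
    unfolding s1 vs using t x by (simp_all add: s_def)
  moreover have "x * ((1 - s) * (1 - t)) = x - 1"
    unfolding s1 using x t by simp
  ultimately show ?case
    using t by (auto simp: lhs_supp_def simp flip: s_def)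
next
  case (5 a)
  obtain s t where a: "a = (s, t)" by (cases a)
  have t: "t \<noteq> 0" "1 - t \<noteq> 0" "1 - x * t \<noteq> 0" and xst: "x * ((1 - s) * (1 - t)) = x - 1"
    using 5 by (auto simp: a lhs_supp_def)
  have st: "(1 - s) * (1 - t) = (x - 1) / x" using xst x by (simp add: field_simps)
  have s1: "1 - s = (x - 1) / (x * (1 - t))" using st x t by (simp add: field_simps)
  have "s * (x * (1 - t)) = 1 - x * t + (x - 1 - x * ((1 - s) * (1 - t)))" by (simp add: algebra_simps)
  then have "s * (x * (1 - t)) = 1 - x * t" unfolding xst by simp
  then have s: "s = (1 - x * t) / (x * (1 - t))" using x t by (simp add: eq_divide_eq)
  have "v * s = (1 - x * t) / ((x - 1) * (1 - t))"
    using x t by (simp add: s v)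
  moreover have "(x - 1) * (1 - t) - (1 - x * t) = t - (2 - x)"
    by (simp add: algebra_simps)
  ultimately have vs: "1 - v * s = (t - (2 - x)) / ((x - 1) * (1 - t))"
    using x t by (simp add: diff_divide_eq_iff)
  have Aarg: "s / ((1 - s) * (1 - x * t)) = 1 / (x - 1)"
    unfolding s1 using x t by (simp add: s)
  have Barg: "t / ((1 - t) * (1 - v * s)) = (x - 1) * (t / (t - (2 - x)))"
    unfolding vs using x t by simp
  show ?case
    unfolding a lhs_term_def prod.case Aarg Barg st mult_char_mult[OF B, of "x - 1"] by simp
qed

text \<open>The inverse substitution has a pole in \<open>t\<close> here. The factor
  \<open>1 - x * m\<close> cancels in the argument of \<open>B\<close>, which leaves the constant
  \<open>x / v\<close>.\<close>

lemma sum_rhs_exceptional_1: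
  "sum termR {(m, n) \<in> suppR. x * m * n = 1}
   = B (x - 1) / E x * (\<Sum>m\<in>UNIV - {0, 1, 1 / x}. (A * inverse E) (m / (1 - m)))"
  unfolding sum_distrib_left
proof (rule sum.reindex_bij_witness[of _ "\<lambda>m. (m, 1 / (x * m))" fst], goal_cases)
  case (1 a)
  obtain m n where a: "a = (m, n)" by (cases a)
  have *: "m \<noteq> 0" "x * m * n = 1"
    using 1 by (auto simp: a rhs_supp_def)
  then show ?case
    using x by (simp add: a field_simps)
next
  case (2 a)
  obtain m n where a: "a = (m, n)" by (cases a)
  have *: "m \<noteq> 0" "m \<noteq> 1" "n \<noteq> 1" "x * m * n = 1"
    using 2 by (auto simp: a rhs_supp_def)
  then have "x * m \<noteq> 1" by auto
  with * show ?case
    using x by (auto simp: a field_simps)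
next
  case (3 m)
  then show ?case by simp
next
  case (4 m)
  then have m: "m \<noteq> 0" "m \<noteq> 1" "1 - x * m \<noteq> 0"
    using x by (auto simp: field_simps)
  define n where "n = 1 / (x * m)"
  have "1 - x * v * (m * (1 - m) * n) = 1 - v + v * m"
    using x m by (simp add: n_def field_simps)
  also have "\<dots> = - (v * (1 - x * m) / x)"
    using x xv by (simp add: field_simps)
  finally have "1 - x * v * (m * (1 - m) * n) \<noteq> 0"
    using x v_neq_0 m by simp
  moreover have "n \<noteq> 0" "n \<noteq> 1" "x * m * n = 1"
    using x m by (auto simp: n_def field_simps)
  ultimately show ?case
    using m by (auto simp: rhs_supp_def simp flip: n_def)
next
  case (5 a)
  obtain m n where a: "a = (m, n)" by (cases a)
  have m: "m \<noteq> 0" "1 - m \<noteq> 0" "1 - n \<noteq> 0" and xmn: "x * m * n = 1"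
    using 5 by (auto simp: a rhs_supp_def)
  have n: "n = 1 / (x * m)" using xmn x m by (simp add: field_simps)
  have n1: "1 - n = - ((1 - x * m) / (x * m))" using x m by (simp add: n field_simps)
  have xm: "1 - x * m \<noteq> 0" using m n1 by auto
  have "1 - x * v * (m * (1 - m) * n) = 1 - v + v * m"
    using x m by (simp add: n field_simps)
  also have "\<dots> = - (v * (1 - x * m) / x)"
    using x xv by (simp add: field_simps)
  finally have zz: "1 - x * v * (m * (1 - m) * n) = - (v * (1 - x * m) / x)" .
  have Barg: "(1 - n) / (n * (1 - x * v * (m * (1 - m) * n))) = x / v"
    unfolding zz n1 using x m xm v_neq_0 by (simp add: n)
  have Earg: "(1 - m) * n = 1 / (x * (m / (1 - m)))"
    using x m by (simp add: n)
  show ?case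
    unfolding a rhs_term_def prod.case Barg Earg x_div_v
    by (simp add: mult_char_hom[OF A] mult_char_hom[OF E] field_simps)
qed

text \<open>The inverse substitution has a pole in \<open>s\<close> here. By
  \<open>v * (x - 1) = x\<close>, the product \<open>x * v * (m * (1 - m) * n)\<close> collapses to
  \<open>n\<close>, so \<open>B\<close> is evaluated at \<open>1 / n\<close>.\<close>

lemma sum_rhs_exceptional_2:
  "sum termR {(m, n) \<in> suppR. x * m = 1}
   = A (1 / (x - 1)) * E ((x - 1) / x) * (\<Sum>n\<in>UNIV - {0, 1}. (E * inverse B) n)"
  unfolding sum_distrib_left
proof (rule sum.reindex_bij_witness[of _ "\<lambda>n. (1 / x, n)" snd], goal_cases)
  case (1 a)
  then show ?case using x by (cases a) (simp add: field_simps)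
next
  case (2 a)
  then show ?case by (cases a) (auto simp: rhs_supp_def)
next
  case (3 n)
  then show ?case by simp
next
  case (4 n)
  define m where "m = 1 / x"
  have m: "m \<noteq> 0" "m \<noteq> 1" "x * m = 1" using x by (simp_all add: m_def)
  have "x * v * (m * (1 - m) * n) = v * (x - 1) / x * n"
    using x by (simp add: m_def field_simps)
  also have "\<dots> = n" using x by (simp add: vx)
  finally have *: "x * v * (m * (1 - m) * n) = n" .
  have "(m, n) \<in> suppR"
    unfolding rhs_supp_def mem_Collect_eq prod.case * using 4 m by auto
  then show ?case
    using m(3) by (simp flip: m_def)
next
  case (5 a)
  obtain m n where a: "a = (m, n)" by (cases a)
  have n: "n \<noteq> 0" "1 - n \<noteq> 0" and m: "m = 1 / x"
    using 5 x by (auto simp: a rhs_supp_def field_simps)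
  have "x * v * (m * (1 - m) * n) = v * (x - 1) / x * n"
    using x by (simp add: m field_simps)
  also have "\<dots> = n" using x by (simp add: vx)
  finally have zz: "x * v * (m * (1 - m) * n) = n" .
  have Barg: "(1 - n) / (n * (1 - x * v * (m * (1 - m) * n))) = 1 / n"
    unfolding zz using n by simp
  have AEarg: "m / (1 - m) = 1 / (x - 1)" "(1 - m) * n = (x - 1) / x * n"
    using x by (simp_all add: m field_simps)
  show ?case
    unfolding a rhs_term_def prod.case Barg AEarg
    unfolding mult_char_mult[OF E, of "(x - 1) / x"]
      mult_char_divide[OF B] mult_char_1[OF B]
    by (simp add: field_simps)
qed

text \<open>The inverse substitution contracts this curve to the point \<open>s = 0\<close>,
  \<open>x * t = 1\<close> outside \<open>suppL\<close>. The arguments of \<open>B\<close> and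
  \<open>E\<close> are constant on it.\<close>

lemma sum_rhs_exceptional_3:
  "sum termR {(m, n) \<in> suppR. x * ((1 - m) * n) = x - 1}
   = B (1 / (x - 1)) * E ((x - 1) / x) * (\<Sum>m\<in>UNIV - {0, 1, 1 / x}. A (m / (1 - m)))"
  unfolding sum_distrib_left
proof (rule sum.reindex_bij_witness[of _ "\<lambda>m. (m, (x - 1) / (x * (1 - m)))" fst], goal_cases)
  case (1 a)
  obtain m n where a: "a = (m, n)" by (cases a)
  have *: "1 - m \<noteq> 0" "x * ((1 - m) * n) = x - 1"
    using 1 by (auto simp: a rhs_supp_def)
  then show ?case
    using x by (simp add: a divide_eq_eq mult_ac)
next
  case (2 a)
  obtain m n where a: "a = (m, n)" by (cases a)
  have *: "m \<noteq> 0" "m \<noteq> 1" "n \<noteq> 1" "x * ((1 - m) * n) = x - 1"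
    using 2 by (auto simp: a rhs_supp_def)
  have "x * m \<noteq> 1"
  proof
    assume "x * m = 1"
    moreover have "x * ((1 - m) * n) = (x - x * m) * n" by (simp add: algebra_simps)
    ultimately have "(x - 1) * n = x - 1" using *(4) by simp
    then show False using x * by simp
  qed
  with * show ?case
    using x by (auto simp: a field_simps)
next
  case (3 m)
  then show ?case by simp
next
  case (4 m)
  then have m: "m \<noteq> 0" "1 - m \<noteq> 0" "1 - x * m \<noteq> 0"
    using x by (auto simp: field_simps)
  define n where "n = (x - 1) / (x * (1 - m))"
  have n: "x * ((1 - m) * n) = x - 1" using x m by (simp add: n_def)
  have n1: "1 - n = (1 - x * m) / (x * (1 - m))" using x m by (simp add: n_def field_simps)
  have "x * v * (m * (1 - m) * n) = v * m * (x * ((1 - m) * n))" by (simp add: mult_ac)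
  also have "\<dots> = x * m" unfolding n using vx by (metis mult.assoc mult.commute)
  finally have zz: "x * v * (m * (1 - m) * n) = x * m" .
  have "1 - x * v * (m * (1 - m) * n) \<noteq> 0" unfolding zz by (rule m)
  moreover have "n \<noteq> 0" using x m by (simp add: n_def)
  moreover have "1 - n \<noteq> 0" unfolding n1 using x m by simp
  ultimately have "(m, n) \<in> suppR"
    unfolding rhs_supp_def mem_Collect_eq prod.case using m by (metis diff_self)
  then show ?case
    using n by (simp flip: n_def)
next
  case (5 a)
  obtain m n where a: "a = (m, n)" by (cases a)
  have m: "m \<noteq> 0" "1 - m \<noteq> 0" "1 - n \<noteq> 0" and xmn: "x * ((1 - m) * n) = x - 1"
    using 5 by (auto simp: a rhs_supp_def)
  have mn: "(1 - m) * n = (x - 1) / x" using xmn x by (simp add: field_simps)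
  then have n: "n = (x - 1) / (x * (1 - m))" using x m by (simp add: field_simps)
  have n1: "1 - n = (1 - x * m) / (x * (1 - m))" using x m by (simp add: n field_simps)
  have xm: "1 - x * m \<noteq> 0" using m n1 by auto
  have "x * v * (m * (1 - m) * n) = v * m * (x * ((1 - m) * n))" by (simp add: mult_ac)
  also have "\<dots> = x * m" unfolding xmn using vx by (metis mult.assoc mult.commute)
  finally have zz: "x * v * (m * (1 - m) * n) = x * m" .
  have Barg: "(1 - n) / (n * (1 - x * v * (m * (1 - m) * n))) = 1 / (x - 1)"
    unfolding zz n1 using x m xm by (simp add: n)
  show ?case
    unfolding a rhs_term_def prod.case Barg mn by simp
qed

text \<open>Each of the four inequalities makes one full sum vanish: \<open>A \<noteq> E\<close> on
  \<open>x * m * n = 1\<close>, \<open>B \<noteq> E\<close> on \<open>x * m = 1\<close>,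
  \<open>A \<noteq> \<epsilon>\<close> on the third curve of the right side, and
  \<open>B \<noteq> \<epsilon>\<close> on the second curve of the left side if
  \<open>x \<noteq> 2\<close>. The values at the removed points agree on the two sides; only the
  cases \<open>B * B = E\<close> and \<open>x = 2\<close> leave a trace.\<close>

lemma sum_lhs_term_eq:
  assumes nontriv: "A \<noteq> \<epsilon>" "B \<noteq> \<epsilon>" "A \<noteq> E" "B \<noteq> E" and even: "E (- 1) = 1"
  shows "sum termL suppL = sum termR suppR
    + A (- 1) * B (x - 1) / E x * ((of_nat CARD('a) - 1) * delta_char (B * B * inverse E))
    + (if x = 2 then of_nat CARD('a) / E x else 0)"
proof -
  define \<alpha> where "\<alpha> = A (x - 1)"
  define \<beta> where "\<beta> = B (x - 1)"
  define e where "e = E (x - 1)"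
  have nz: "\<alpha> \<noteq> 0" "\<beta> \<noteq> 0" "e \<noteq> 0" "E x \<noteq> 0"
    using x by (simp_all add: \<alpha>_def \<beta>_def e_def mult_char_eq_0_iff A B E)
  have val: "A (1 / (x - 1)) = 1 / \<alpha>" "B (1 / (x - 1)) = 1 / \<beta>" "E (1 / (x - 1)) = 1 / e" "E ((x - 1) / x) = e / E x"
    by (simp_all add: \<alpha>_def \<beta>_def e_def mult_char_divide mult_char_1 A B E)
  have w: "1 / x \<noteq> 0" "1 / x \<noteq> 1" "1 / x / (1 - 1 / x) = 1 / (x - 1)"
    using x by (simp_all add: field_simps)
  have L1: "(\<Sum>t\<in>UNIV - {0, 1, 1 / x}. (B * B * inverse E) (t / (1 - t)))
      = (of_nat CARD('a) - 1) * delta_char (B * B * inverse E) - 1 - e / \<beta>\<^sup>2"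
    using sum_mult_char[of "B * B * inverse E"]
    unfolding sum_ratio_punctured[OF w(1,2)] w(3)
    by (simp add: val A B E mult_char_0 even mult_char_minus_1_square power2_eq_square)
  have R1: "(\<Sum>m\<in>UNIV - {0, 1, 1 / x}. (A * inverse E) (m / (1 - m))) = - A (- 1) - e / \<alpha>"
    using sum_mult_char_nontriv[of "A * inverse E"] nontriv
    unfolding sum_ratio_punctured[OF w(1,2)] w(3)
    by (simp add: val A B E mult_char_0 even times_inverse_eq_triv_iff)
  have R2: "(\<Sum>n\<in>UNIV - {0, 1}. (E * inverse B) n) = - 1"
  proof -
    have "(\<Sum>n\<in>UNIV - {0, 1}. (E * inverse B) n) = (\<Sum>n\<in>UNIV. (E * inverse B) n) - (\<Sum>n\<in>{0, 1}. (E * inverse B) n)"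
      by (rule sum_diff) auto
    moreover have "(\<Sum>n\<in>UNIV. (E * inverse B) n) = 0"
      using sum_mult_char_nontriv[of "E * inverse B"] nontriv(4)[symmetric]
      by (simp add: times_inverse_eq_triv_iff B E)
    ultimately show ?thesis
      by (simp add: mult_char_0 mult_char_1 B E)
  qed
  have R3: "(\<Sum>m\<in>UNIV - {0, 1, 1 / x}. A (m / (1 - m))) = - A (- 1) - 1 / \<alpha>"
    using sum_mult_char_nontriv[OF A nontriv(1)]
    unfolding sum_ratio_punctured[OF w(1,2)] w(3)
    by (simp add: val mult_char_0 A)
  have L2: "e / E x * (1 / \<alpha>) * \<beta> * (\<Sum>t\<in>UNIV - {0, 1, 1 / x, 2 - x}. B (t / (t - (2 - x))))
      = (if x = 2 then of_nat CARD('a) / E x else 0) + e / E x * (1 / \<alpha>) * \<beta> * (- 1 - 1 / \<beta> - 1 / \<beta>\<^sup>2)"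
  proof (cases "x = 2")
    \<comment> \<open>The summand is constantly \<open>1\<close>, and \<open>2 - x\<close> coincides
      with the removed point \<open>0\<close>. The count \<open>CARD('a) - 3\<close> is the term
      \<open>CARD('a)\<close> plus what the general formula gives, as
      \<open>\<alpha> = \<beta> = e = 1\<close>.\<close>
    case True
    have "(\<Sum>t\<in>UNIV - {0, 1, 1 / x, 2 - x}. B (t / (t - (2 - x)))) = (\<Sum>t\<in>UNIV - {0, 1, 1 / x}. 1)"
      by (rule sum.cong) (auto simp: True mult_char_1 B)
    also have "\<dots> = of_nat CARD('a) - 3"
    proof -
      have "card {0, 1, 1 / x} = 3" using w by (auto simp: card_insert_if)
      moreover have "card {0, 1, 1 / x} \<le> CARD('a)" by (rule card_mono) auto
      ultimately show ?thesis by (simp add: card_Diff_subset of_nat_diff)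
    qed
    finally have *: "(\<Sum>t\<in>UNIV - {0, 1, 1 / x, 2 - x}. B (t / (t - (2 - x)))) = of_nat CARD('a) - 3" .
    have "\<alpha> = 1" "\<beta> = 1" "e = 1"
      by (simp_all add: True \<alpha>_def \<beta>_def e_def mult_char_1 A B E)
    then show ?thesis
      unfolding * using True by (simp add: diff_divide_distrib)
  next
    case False
    \<comment> \<open>The perfect square shows that \<open>1 / x\<close> and \<open>2 - x\<close>
      never coincide, and that the value lost at \<open>1 / x\<close> is
      \<open>1 / \<beta>\<^sup>2\<close>.\<close>
    have sq: "1 / x - (2 - x) = (x - 1) * (x - 1) / x"
      using x by (simp add: field_simps)
    have "1 / x - (2 - x) \<noteq> 0" unfolding sq using x by simp
    then have ne: "1 / x \<noteq> 2 - x" by simp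
    have arg: "1 / x / (1 / x - (2 - x)) = 1 / (x - 1) * (1 / (x - 1))"
      unfolding sq using x by simp
    have "UNIV - {0, 1, 1 / x, 2 - x} = (UNIV - {2 - x}) - {0, 1, 1 / x}" by auto
    then have "(\<Sum>t\<in>UNIV - {0, 1, 1 / x, 2 - x}. B (t / (t - (2 - x))))
        = (\<Sum>t\<in>UNIV - {2 - x}. B (t / (t - (2 - x)))) - (\<Sum>t\<in>{0, 1, 1 / x}. B (t / (t - (2 - x))))"
      using False x ne by (simp only:) (rule sum_diff, auto simp: algebra_simps)
    also have "(\<Sum>t\<in>{0, 1, 1 / x}. B (t / (t - (2 - x))))
        = B (0 / (0 - (2 - x))) + (B (1 / (1 - (2 - x))) + B (1 / x / (1 / x - (2 - x))))"
      using w(1,2) by simp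
    also have "\<dots> = B (1 / (x - 1)) + B (1 / (x - 1) * (1 / (x - 1)))"
      unfolding arg by (simp add: mult_char_0 B)
    also have "(\<Sum>t\<in>UNIV - {2 - x}. B (t / (t - (2 - x)))) = - 1"
      using False by (intro sum_char_ratio_shift B nontriv) simp
    also have "B (1 / (x - 1) * (1 / (x - 1))) = 1 / \<beta>\<^sup>2"
      by (simp only: mult_char_mult[OF B] val) (simp add: power2_eq_square)
    finally have *: "(\<Sum>t\<in>UNIV - {0, 1, 1 / x, 2 - x}. B (t / (t - (2 - x))))
        = - 1 - (B (1 / (x - 1)) + 1 / \<beta>\<^sup>2)" .
    show ?thesis
      unfolding * val using False by (simp add: algebra_simps)
  qed
  have fin: "finite suppL" "finite suppR" by auto
  have L: "sum termL suppL = sum termL {(s, t) \<in> suppL. x * t * (1 - s) = 1}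
      + sum termL {(s, t) \<in> suppL. x * ((1 - s) * (1 - t)) = x - 1}
      + sum termL {(s, t) \<in> suppL. x * t * (1 - s) \<noteq> 1 \<and> x * ((1 - s) * (1 - t)) \<noteq> x - 1}"
    unfolding sum_filter_pairs[OF fin(1)] sum.distrib[symmetric]
  proof (intro sum.cong refl)
    \<comment> \<open>The two curves do not meet inside the support, since on both
      \<open>x * fst a\<close> would be \<open>0\<close>.\<close>
    fix a assume "a \<in> suppL"
    then have "fst a \<noteq> 0" by (auto simp: lhs_supp_def)
    have "x * ((1 - fst a) * (1 - snd a)) = x - x * fst a - x * snd a * (1 - fst a)"
      by (simp add: algebra_simps)
    moreover have "x * fst a \<noteq> 0" using x \<open>fst a \<noteq> 0\<close> by simp
    ultimately have "\<not> (x * snd a * (1 - fst a) = 1 \<and> x * ((1 - fst a) * (1 - snd a)) = x - 1)"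
      by auto
    then show "termL a = (if x * snd a * (1 - fst a) = 1 then termL a else 0)
      + (if x * ((1 - fst a) * (1 - snd a)) = x - 1 then termL a else 0)
      + (if x * snd a * (1 - fst a) \<noteq> 1 \<and> x * ((1 - fst a) * (1 - snd a)) \<noteq> x - 1 then termL a else 0)"
      by (simp split: if_split)
  qed
  have R: "sum termR suppR = sum termR {(m, n) \<in> suppR. x * m * n = 1}
      + sum termR {(m, n) \<in> suppR. x * m = 1}
      + sum termR {(m, n) \<in> suppR. x * ((1 - m) * n) = x - 1}
      + sum termR {(m, n) \<in> suppR. x * m * n \<noteq> 1 \<and> x * m \<noteq> 1 \<and> x * ((1 - m) * n) \<noteq> x - 1}"
    unfolding sum_filter_pairs[OF fin(2)] sum.distrib[symmetric]
  proof (intro sum.cong refl)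
    fix a assume "a \<in> suppR"
    then have n: "snd a \<noteq> 1" by (auto simp: rhs_supp_def)
    \<comment> \<open>Any two of the three curves meet only where \<open>n = 1\<close>.\<close>
    have 1: "\<not> (x * fst a * snd a = 1 \<and> x * fst a = 1)"
      using n by auto
    have *: "x * ((1 - fst a) * snd a) = x * snd a - x * fst a * snd a" "(x - 1) * snd a = x * snd a - snd a"
      by (simp_all add: algebra_simps)
    have 2: "\<not> (x * fst a * snd a = 1 \<and> x * ((1 - fst a) * snd a) = x - 1)"
      using n x unfolding *(1) by auto
    have 3: "\<not> (x * fst a = 1 \<and> x * ((1 - fst a) * snd a) = x - 1)"
    proof
      assume "x * fst a = 1 \<and> x * ((1 - fst a) * snd a) = x - 1"
      then have "x * fst a = 1" "x * snd a - x * fst a * snd a = x - 1"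
        unfolding *(1) by auto
      then have "(x - 1) * snd a = x - 1" unfolding *(2) by simp
      then show False using n x by simp
    qed
    have split: "c = (if P then c else 0) + (if Q then c else 0) + (if R then c else 0)
        + (if \<not> P \<and> \<not> Q \<and> \<not> R then c else 0)"
      if "\<not> (P \<and> Q)" "\<not> (P \<and> R)" "\<not> (Q \<and> R)" for P Q R and c :: complex
      using that by auto
    show "termR a = (if x * fst a * snd a = 1 then termR a else 0)
      + (if x * fst a = 1 then termR a else 0)
      + (if x * ((1 - fst a) * snd a) = x - 1 then termR a else 0)
      + (if x * fst a * snd a \<noteq> 1 \<and> x * fst a \<noteq> 1 \<and> x * ((1 - fst a) * snd a) \<noteq> x - 1 then termR a else 0)"
      using 1 2 3 by (rule split)
  qed
  show ?thesis
    unfolding L R sum_lhs_term_generic sum_lhs_exceptional_1 sum_lhs_exceptional_2 sum_rhs_exceptional_1 sum_rhs_exceptional_2 sum_rhs_exceptional_3 val L1 R1 R2 R3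
    unfolding \<beta>_def[symmetric] L2
    using nz by (simp add: field_simps power2_eq_square)
qed

end

section \<open>Greene's series as character sums\<close>

text \<open>The binomial theorem over a finite field: orthogonality keeps only the \<open>w\<close>
  with \<open>w * u = 1 - w\<close>. For \<open>1 + u = 0\<close> there is none, and the right side
  is \<open>0\<close> by the conventions at \<open>0\<close>.\<close>

lemma sum_jacobi_char:
  fixes A :: "'a::{field,finite} \<Rightarrow> complex"
  assumes A: "mult_char A" and u: "u \<noteq> 0"
  shows "(\<Sum>\<chi> | mult_char \<chi>. jacobi_sum (A * \<chi>) (inverse \<chi>) * \<chi> u) = (of_nat CARD('a) - 1) * inverse (A (1 + u))"
proof -
  have "(\<Sum>\<chi> | mult_char \<chi>. jacobi_sum (A * \<chi>) (inverse \<chi>) * \<chi> u)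
      = (\<Sum>\<chi> | mult_char \<chi>. \<Sum>w\<in>UNIV. A w * \<chi> (w * u / (1 - w)))"
    unfolding jacobi_sum_def sum_distrib_right
    by (intro sum.cong refl) (simp add: mult_char_mult mult_char_divide divide_inverse mult_char_inverse mult_ac)
  also have "\<dots> = (\<Sum>w\<in>UNIV. A w * (\<Sum>\<chi> | mult_char \<chi>. \<chi> (w * u / (1 - w))))"
    by (subst sum.swap) (simp add: sum_distrib_left)
  also have "\<dots> = (\<Sum>w\<in>UNIV. if w = 1 / (1 + u) then A w * (of_nat CARD('a) - 1) else 0)"
  proof (intro sum.cong refl)
    fix w :: 'a
    show "A w * (\<Sum>\<chi> | mult_char \<chi>. \<chi> (w * u / (1 - w))) = (if w = 1 / (1 + u) then A w * (of_nat CARD('a) - 1) else 0)"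
    proof (cases "w = 0 \<or> w = 1")
      case True
      then show ?thesis using u by (auto simp: mult_char_0[OF A] sum_all_mult_char divide_simps)
    next
      case False
      then have "w * u / (1 - w) = 1 \<longleftrightarrow> w * (1 + u) = 1"
        by (simp add: divide_eq_eq algebra_simps)
      also have "\<dots> \<longleftrightarrow> w = 1 / (1 + u)"
        by (cases "1 + u = 0") (use False in \<open>auto simp: eq_divide_eq\<close>)
      finally show ?thesis
        by (simp only: sum_all_mult_char) simp
    qed
  qed
  also have "\<dots> = A (1 / (1 + u)) * (of_nat CARD('a) - 1)"
    by simp
  finally show ?thesis
    by (simp add: mult_char_inverse[OF A] divide_inverse mult.commute)
qed

lemma greene_F_2F1:
  "greene_F [A, B] [E] (x::'a::{field,finite}) = of_nat CARD('a) / (of_nat CARD('a) - 1) *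
    (\<Sum>\<chi> | mult_char \<chi>. char_binom (A * \<chi>) \<chi> * char_binom (B * \<chi>) (E * \<chi>) * \<chi> x)"
  by (simp add: greene_F_def)

lemma greene_F_3F2:
  "greene_F [A, B, D] [E, G] (x::'a::{field,finite}) = of_nat CARD('a) / (of_nat CARD('a) - 1) *
    (\<Sum>\<chi> | mult_char \<chi>. char_binom (A * \<chi>) \<chi> *
      (char_binom (B * \<chi>) (E * \<chi>) * char_binom (D * \<chi>) (G * \<chi>)) * \<chi> x)"
  by (simp add: greene_F_def numeral_2_eq_2 atLeastAtMostSuc_conv mult_ac)

lemma greene_F_4F3:
  "greene_F [A, B, D, D'] [E, G, G'] (x::'a::{field,finite}) = of_nat CARD('a) / (of_nat CARD('a) - 1) *
    (\<Sum>\<chi> | mult_char \<chi>. char_binom (A * \<chi>) \<chi> *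
      (char_binom (B * \<chi>) (E * \<chi>) * char_binom (D * \<chi>) (G * \<chi>) * char_binom (D' * \<chi>) (G' * \<chi>)) * \<chi> x)"
  by (simp add: greene_F_def numeral_3_eq_3 atLeastAtMostSuc_conv mult_ac)

lemma card_neq_1: "of_nat CARD('a::{field,finite}) - 1 \<noteq> (0 :: complex)"
proof -
  have "card {0, 1::'a} \<le> CARD('a)" by (rule card_mono) auto
  then have "CARD('a) \<noteq> 1" by simp
  then show ?thesis by (metis of_nat_1 of_nat_eq_iff right_minus_eq)
qed

text \<open>This substitution is what turns \<open>1 + x * t / (1 - t)\<close> into
  \<open>1 - x * t\<close>.\<close>

lemma sum_involution_punctured:
  fixes f :: "'a::{field,finite} \<Rightarrow> complex"
  assumes "f 1 = 0"
  shows "(\<Sum>t\<in>UNIV. f t) = (\<Sum>t\<in>UNIV - {1}. f (t / (t - 1)))"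
proof -
  have "(\<Sum>t\<in>UNIV. f t) = (\<Sum>t\<in>UNIV - {1}. f t)"
    by (rule sum.mono_neutral_right) (use assms in auto)
  also have "\<dots> = (\<Sum>t\<in>UNIV - {1}. f (t / (t - 1)))"
  proof -
    have *: "t / (t - 1) / (t / (t - 1) - 1) = t" "t / (t - 1) \<in> UNIV - {1}" if "t \<in> UNIV - {1}" for t :: 'a
    proof -
      have t: "t - 1 \<noteq> 0" using that by simp
      have 1: "t / (t - 1) - 1 = 1 / (t - 1)" using t by (simp add: field_simps)
      show "t / (t - 1) / (t / (t - 1) - 1) = t" unfolding 1 using t by simp
      have "t / (t - 1) - 1 \<noteq> 0" unfolding 1 using t by simp
      then show "t / (t - 1) \<in> UNIV - {1}" by auto
    qed
    show ?thesis
      by (rule sum.reindex_bij_witness[of _ "\<lambda>t. t / (t - 1)" "\<lambda>t. t / (t - 1)"])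
        (simp_all only: *)
  qed
  finally show ?thesis .
qed

text \<open>The analogue of Euler's integral. Writing out the second binomial coefficient exposes
  \<open>\<chi> (x * t / (1 - t))\<close>, against which \<open>sum_jacobi_char\<close> sums the
  first; the two factors \<open>\<chi> (- 1)\<close> cancel.\<close>

lemma greene_F_sum:
  fixes A B E :: "'a::{field,finite} \<Rightarrow> complex"
  assumes A: "mult_char A" and B: "mult_char B" and E: "mult_char E" and x: "x \<noteq> 0"
  shows "greene_F [A, B] [E] x = E (- 1) * B (- 1) / of_nat CARD('a) *
    (\<Sum>t\<in>UNIV. B t * inverse (B (1 - t)) * E (1 - t) * inverse (A (1 - x * t)))"
proof -
  let ?q = "of_nat CARD('a) :: complex"
  have "(\<Sum>\<chi> | mult_char \<chi>. char_binom (A * \<chi>) \<chi> * char_binom (B * \<chi>) (E * \<chi>) * \<chi> x)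
      = (\<Sum>\<chi> | mult_char \<chi>. \<Sum>t\<in>UNIV. E (- 1) / ?q\<^sup>2 * (B t * inverse (E (1 - t))) *
          (jacobi_sum (A * \<chi>) (inverse \<chi>) * \<chi> (x * t / (1 - t))))"
  proof (intro sum.cong refl)
    fix \<chi> :: "'a \<Rightarrow> complex" assume "\<chi> \<in> {\<chi>. mult_char \<chi>}"
    then have \<chi>: "mult_char \<chi>" by simp
    have "char_binom (A * \<chi>) \<chi> * char_binom (B * \<chi>) (E * \<chi>) * \<chi> x
        = (\<chi> (- 1) * \<chi> (- 1)) * E (- 1) / ?q\<^sup>2 * jacobi_sum (A * \<chi>) (inverse \<chi>) *
          (jacobi_sum (B * \<chi>) (inverse (E * \<chi>)) * \<chi> x)"
      by (simp add: char_binom_jacobi power2_eq_square)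
    also have "jacobi_sum (B * \<chi>) (inverse (E * \<chi>)) * \<chi> x
        = (\<Sum>t\<in>UNIV. (B t * inverse (E (1 - t))) * \<chi> (x * t / (1 - t)))"
      unfolding jacobi_sum_def sum_distrib_right
      by (intro sum.cong refl) (simp add: mult_char_mult[OF \<chi>] mult_char_divide[OF \<chi>]
          mult_char_inverse[OF \<chi>] divide_inverse mult_ac)
    finally have binoms: "char_binom (A * \<chi>) \<chi> * char_binom (B * \<chi>) (E * \<chi>) * \<chi> x
        = (\<chi> (- 1) * \<chi> (- 1)) * E (- 1) / ?q\<^sup>2 * jacobi_sum (A * \<chi>) (inverse \<chi>) *
          (\<Sum>t\<in>UNIV. (B t * inverse (E (1 - t))) * \<chi> (x * t / (1 - t)))" .
    show "char_binom (A * \<chi>) \<chi> * char_binom (B * \<chi>) (E * \<chi>) * \<chi> x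
        = (\<Sum>t\<in>UNIV. E (- 1) / ?q\<^sup>2 * (B t * inverse (E (1 - t))) *
          (jacobi_sum (A * \<chi>) (inverse \<chi>) * \<chi> (x * t / (1 - t))))"
      unfolding binoms mult_char_minus_1_square[OF \<chi>] sum_distrib_left
      by (intro sum.cong refl) (simp add: mult_ac)
  qed
  also have "\<dots> = (\<Sum>t\<in>UNIV. E (- 1) / ?q\<^sup>2 * (B t * inverse (E (1 - t))) *
      (\<Sum>\<chi> | mult_char \<chi>. jacobi_sum (A * \<chi>) (inverse \<chi>) * \<chi> (x * t / (1 - t))))"
    by (subst sum.swap) (simp add: sum_distrib_left)
  also have "\<dots> = (\<Sum>t\<in>UNIV. E (- 1) / ?q\<^sup>2 * (B t * inverse (E (1 - t))) *
      ((?q - 1) * inverse (A (1 + x * t / (1 - t)))))"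
  proof (intro sum.cong refl)
    fix t :: 'a
    show "E (- 1) / ?q\<^sup>2 * (B t * inverse (E (1 - t))) *
        (\<Sum>\<chi> | mult_char \<chi>. jacobi_sum (A * \<chi>) (inverse \<chi>) * \<chi> (x * t / (1 - t)))
      = E (- 1) / ?q\<^sup>2 * (B t * inverse (E (1 - t))) * ((?q - 1) * inverse (A (1 + x * t / (1 - t))))"
    proof (cases "t = 0 \<or> t = 1")
      case True
      then show ?thesis using mult_char_0[OF B] mult_char_0[OF E] by auto
    next
      case False
      then have nz: "x * t / (1 - t) \<noteq> 0" using x by simp
      show ?thesis unfolding sum_jacobi_char[OF A nz] ..
    qed
  qed
  also have "\<dots> = (\<Sum>t\<in>UNIV - {1}. E (- 1) / ?q\<^sup>2 * (B (t / (t - 1)) * inverse (E (1 - t / (t - 1)))) *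
      ((?q - 1) * inverse (A (1 + x * (t / (t - 1)) / (1 - t / (t - 1))))))"
    by (rule sum_involution_punctured) (simp add: mult_char_0[OF E])
  also have "\<dots> = (\<Sum>t\<in>UNIV - {1}. E (- 1) / ?q\<^sup>2 * (?q - 1) * B (- 1) *
      (B t * inverse (B (1 - t)) * E (1 - t) * inverse (A (1 - x * t))))"
  proof (intro sum.cong refl)
    fix t :: 'a assume "t \<in> UNIV - {1}"
    then have t: "t - 1 \<noteq> 0" "1 - t \<noteq> 0" by simp_all
    have 1: "1 - t / (t - 1) = 1 / (1 - t)" using t by (simp add: field_simps)
    have 2: "t / (t - 1) = - 1 * t / (1 - t)" using t by (simp add: field_simps)
    have 3: "1 + x * (t / (t - 1)) / (1 / (1 - t)) = 1 - x * t" unfolding 2 using t by simp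
    have "B (t / (t - 1)) = B (- 1) * B t * inverse (B (1 - t))"
      unfolding 2 mult_char_divide[OF B] mult_char_mult[OF B] by (simp add: divide_inverse)
    then show "E (- 1) / ?q\<^sup>2 * (B (t / (t - 1)) * inverse (E (1 - t / (t - 1)))) *
        ((?q - 1) * inverse (A (1 + x * (t / (t - 1)) / (1 - t / (t - 1)))))
      = E (- 1) / ?q\<^sup>2 * (?q - 1) * B (- 1) *
        (B t * inverse (B (1 - t)) * E (1 - t) * inverse (A (1 - x * t)))"
      unfolding 1 3 by (simp add: mult_char_divide[OF E] mult_char_1[OF E])
  qed
  also have "\<dots> = (\<Sum>t\<in>UNIV. E (- 1) / ?q\<^sup>2 * (?q - 1) * B (- 1) *
      (B t * inverse (B (1 - t)) * E (1 - t) * inverse (A (1 - x * t))))"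
    by (rule sum.mono_neutral_left) (auto simp: mult_char_0[OF E])
  finally show ?thesis
    unfolding greene_F_2F1 sum_distrib_left[symmetric]
    using card_neq_1[where 'a = 'a] by (simp add: power2_eq_square field_simps)
qed

text \<open>As for the classical integral, reflecting \<open>t\<close> to \<open>1 - t\<close>
  undoes the replacement of \<open>B\<close> by \<open>E * inverse B\<close>, and
  \<open>1 - x * (1 - t)\<close> splits into \<open>1 - x\<close> and a factor with the new
  argument.\<close>

lemma greene_F_pfaff:
  fixes A B E :: "'a::{field,finite} \<Rightarrow> complex"
  assumes A: "mult_char A" and B: "mult_char B" and E: "mult_char E" and x: "x \<noteq> 0" "x \<noteq> 1"
  shows "greene_F [A, E * inverse B] [E] x = E (- 1) * inverse (A (1 - x)) * greene_F [A, B] [E] (x / (x - 1))"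
proof -
  let ?f = "\<lambda>t. (E * inverse B) t * inverse ((E * inverse B) (1 - t)) * E (1 - t) * inverse (A (1 - x * t))"
  have "(\<Sum>t\<in>UNIV. ?f t) = (\<Sum>t\<in>UNIV. ?f (1 - t))"
    by (rule sum.reindex_bij_witness[of _ "\<lambda>t. 1 - t" "\<lambda>t. 1 - t"]) auto
  also have "\<dots> = (\<Sum>t\<in>UNIV. inverse (A (1 - x)) *
      (B t * inverse (B (1 - t)) * E (1 - t) * inverse (A (1 - x / (x - 1) * t))))"
  proof (intro sum.cong refl)
    fix t
    have "1 - x * (1 - t) = (1 - x) * (1 - x / (x - 1) * t)"
      using x by (simp add: field_simps)
    then have "A (1 - x * (1 - t)) = A (1 - x) * A (1 - x / (x - 1) * t)"
      by (simp only: mult_char_mult[OF A])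
    moreover have "inverse (E t) * E t = 1" if "t \<noteq> 0"
      using that by (simp add: mult_char_eq_0_iff[OF E])
    ultimately show "?f (1 - t) = inverse (A (1 - x)) *
      (B t * inverse (B (1 - t)) * E (1 - t) * inverse (A (1 - x / (x - 1) * t)))"
      by (cases "t = 0") (simp_all add: mult_char_0[OF B] mult_ac)
  qed
  finally have sum: "(\<Sum>t\<in>UNIV. ?f t) = inverse (A (1 - x)) *
      (\<Sum>t\<in>UNIV. B t * inverse (B (1 - t)) * E (1 - t) * inverse (A (1 - x / (x - 1) * t)))"
    by (simp only: sum_distrib_left)
  have Bm: "inverse (B (- 1)) = B (- 1)" "x / (x - 1) \<noteq> 0"
    using mult_char_inverse[OF B, of "- 1"] x by simp_all
  show ?thesis
    unfolding greene_F_sum[OF A B E Bm(2)] sum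
      greene_F_sum[OF A mult_char_times[OF E mult_char_inv[OF B]] E x(1)]
    by (simp add: Bm(1) mult_ac)
qed

lemma sum_lhs_term_product:
  fixes A B E :: "'a::{field,finite} \<Rightarrow> complex"
  assumes A: "mult_char A" and B: "mult_char B" and E: "mult_char E"
  shows "sum (lhs_term A B E x v) (lhs_supp x v)
    = (\<Sum>s\<in>UNIV. A s * inverse (A (1 - s)) * E (1 - s) * inverse (B (1 - v * s))) *
      (\<Sum>t\<in>UNIV. B t * inverse (B (1 - t)) * E (1 - t) * inverse (A (1 - x * t)))"
proof -
  have "sum (lhs_term A B E x v) (lhs_supp x v) = sum (lhs_term A B E x v) UNIV"
    by (rule sum.mono_neutral_left)
      (auto simp: lhs_supp_def lhs_term_def mult_char_0[OF A] mult_char_0[OF B] mult_char_0[OF E])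
  also have "\<dots> = (\<Sum>s\<in>UNIV. \<Sum>t\<in>UNIV. lhs_term A B E x v (s, t))"
    by (simp add: sum.cartesian_product)
  also have "\<dots> = (\<Sum>s\<in>UNIV. \<Sum>t\<in>UNIV.
      (A s * inverse (A (1 - s)) * E (1 - s) * inverse (B (1 - v * s))) *
      (B t * inverse (B (1 - t)) * E (1 - t) * inverse (A (1 - x * t))))"
    by (intro sum.cong refl)
      (simp add: lhs_term_def mult_char_divide A B mult_char_mult mult_char_inverse E divide_inverse mult_ac)
  finally show ?thesis
    by (simp add: sum_product)
qed

text \<open>Only the first and the third Jacobi sum are written out;
  \<open>jacobi_sum (B * \<chi>) (inverse \<chi>)\<close> stays closed, so that
  \<open>sum_jacobi_char\<close> can carry out the sum over \<open>\<chi>\<close>. The variable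
  \<open>l\<close> of the third sum becomes \<open>n / (n - 1)\<close>.\<close>

lemma sum_jacobi_triple:
  fixes A B E :: "'a::{field,finite} \<Rightarrow> complex"
  assumes A: "mult_char A" and B: "mult_char B" and E: "mult_char E" and even: "E (- 1) = 1" and xv: "x * v \<noteq> 0"
  shows "(\<Sum>\<chi> | mult_char \<chi>. jacobi_sum (A * \<chi>) (inverse A * E * \<chi>) * jacobi_sum (B * \<chi>) (inverse \<chi>) *
      jacobi_sum (inverse B * E * \<chi>) (inverse (E * \<chi>)) * \<chi> (x * v))
    = (of_nat CARD('a) - 1) * B (- 1) * sum (rhs_term A B E x v) (rhs_supp x v)"
proof -
  let ?w = "\<lambda>m l. A m * (inverse A * E) (1 - m) * ((inverse B * E) l * inverse (E (1 - l)))"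
  let ?u = "\<lambda>m l. x * v * (m * (1 - m) * (l / (1 - l)))"
  have "(\<Sum>\<chi> | mult_char \<chi>. jacobi_sum (A * \<chi>) (inverse A * E * \<chi>) * jacobi_sum (B * \<chi>) (inverse \<chi>) *
      jacobi_sum (inverse B * E * \<chi>) (inverse (E * \<chi>)) * \<chi> (x * v))
    = (\<Sum>\<chi> | mult_char \<chi>. \<Sum>m\<in>UNIV. \<Sum>l\<in>UNIV. ?w m l * (jacobi_sum (B * \<chi>) (inverse \<chi>) * \<chi> (?u m l)))"
  proof (intro sum.cong refl)
    fix \<chi> :: "'a \<Rightarrow> complex" assume "\<chi> \<in> {\<chi>. mult_char \<chi>}"
    then have \<chi>: "mult_char \<chi>" by simp
    have "jacobi_sum (A * \<chi>) (inverse A * E * \<chi>) * jacobi_sum (B * \<chi>) (inverse \<chi>) *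
        jacobi_sum (inverse B * E * \<chi>) (inverse (E * \<chi>)) * \<chi> (x * v)
      = jacobi_sum (B * \<chi>) (inverse \<chi>) * \<chi> (x * v) *
        (jacobi_sum (A * \<chi>) (inverse A * E * \<chi>) * jacobi_sum (inverse B * E * \<chi>) (inverse (E * \<chi>)))"
      by (simp only: mult_ac)
    also have "\<dots> = (\<Sum>m\<in>UNIV. \<Sum>l\<in>UNIV. ?w m l * (jacobi_sum (B * \<chi>) (inverse \<chi>) * \<chi> (?u m l)))"
      unfolding jacobi_sum_def[of "A * \<chi>"] jacobi_sum_def[of "inverse B * E * \<chi>"]
        sum_product
      unfolding sum_distrib_left
      by (intro sum.cong refl) (simp add: mult_char_mult[OF \<chi>] mult_char_divide[OF \<chi>]
          mult_char_inverse[OF \<chi>] divide_inverse mult_ac)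
    finally show "jacobi_sum (A * \<chi>) (inverse A * E * \<chi>) * jacobi_sum (B * \<chi>) (inverse \<chi>) *
        jacobi_sum (inverse B * E * \<chi>) (inverse (E * \<chi>)) * \<chi> (x * v)
      = (\<Sum>m\<in>UNIV. \<Sum>l\<in>UNIV. ?w m l * (jacobi_sum (B * \<chi>) (inverse \<chi>) * \<chi> (?u m l)))" .
  qed
  also have "\<dots> = (\<Sum>m\<in>UNIV. \<Sum>l\<in>UNIV. \<Sum>\<chi> | mult_char \<chi>. ?w m l * (jacobi_sum (B * \<chi>) (inverse \<chi>) * \<chi> (?u m l)))"
    by (subst sum.swap) (intro sum.cong refl sum.swap)
  also have "\<dots> = (\<Sum>m\<in>UNIV. \<Sum>l\<in>UNIV. ?w m l * ((of_nat CARD('a) - 1) * inverse (B (1 + ?u m l))))"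
  proof (intro sum.cong refl)
    fix m l :: 'a
    show "(\<Sum>\<chi> | mult_char \<chi>. ?w m l * (jacobi_sum (B * \<chi>) (inverse \<chi>) * \<chi> (?u m l)))
      = ?w m l * ((of_nat CARD('a) - 1) * inverse (B (1 + ?u m l)))"
    proof (cases "m = 0 \<or> m = 1 \<or> l = 0 \<or> l = 1")
      case True
      then have "?w m l = 0" by (auto simp: mult_char_0 A B E)
      then show ?thesis by (simp only: mult_zero_left sum.neutral_const)
    next
      case False
      then have nz: "?u m l \<noteq> 0" using xv by simp
      show ?thesis unfolding sum_distrib_left[symmetric] sum_jacobi_char[OF B nz] ..
    qed
  qed
  also have "\<dots> = (\<Sum>m\<in>UNIV. \<Sum>n\<in>UNIV. (of_nat CARD('a) - 1) * B (- 1) * rhs_term A B E x v (m, n))"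
  proof (rule sum.cong)
    fix m :: 'a
    let ?f = "\<lambda>l. ?w m l * ((of_nat CARD('a) - 1) * inverse (B (1 + ?u m l)))"
    have "sum ?f UNIV = (\<Sum>n\<in>UNIV - {1}. ?f (n / (n - 1)))"
      by (rule sum_involution_punctured) (simp add: mult_char_0[OF E])
    also have "\<dots> = (\<Sum>n\<in>UNIV - {1}. (of_nat CARD('a) - 1) * B (- 1) * rhs_term A B E x v (m, n))"
    proof (intro sum.cong refl)
      fix n :: 'a assume "n \<in> UNIV - {1}"
      then have n: "n - 1 \<noteq> 0" "1 - n \<noteq> 0" by simp_all
      have 1: "1 - n / (n - 1) = 1 / (1 - n)" using n by (simp add: field_simps)
      have 2: "n / (n - 1) = - 1 * n / (1 - n)" using n by (simp add: field_simps)
      have 3: "1 + x * v * (m * (1 - m) * (n / (n - 1) / (1 / (1 - n)))) = 1 - x * v * (m * (1 - m) * n)"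
        unfolding 2 using n by simp
      have vals: "E (n / (n - 1)) = E n / E (1 - n)" "B (n / (n - 1)) = B (- 1) * B n / B (1 - n)"
        "E (1 / (1 - n)) = 1 / E (1 - n)"
        unfolding 2 mult_char_divide[OF E] mult_char_divide[OF B] mult_char_mult[OF E] mult_char_mult[OF B]
        by (simp_all add: even mult_char_1[OF E])
      have nz: "E (1 - n) \<noteq> 0" using n by (simp add: mult_char_eq_0_iff[OF E])
      have Bm: "inverse (B (- 1)) = B (- 1)"
        using mult_char_inverse[OF B, of "- 1"] by simp
      have Bn: "B (n - 1) = B (- 1) * B (1 - n)"
        using mult_char_minus[OF B, of "1 - n"] by simp
      show "?f (n / (n - 1)) = (of_nat CARD('a) - 1) * B (- 1) * rhs_term A B E x v (m, n)"
        unfolding 1 3 rhs_term_def prod.case times_fun_def inverse_fun_apply vals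
          mult_char_divide[OF A] mult_char_divide[OF B] mult_char_mult[OF B, of n] mult_char_mult[OF E, of "1 - m"]
        using nz by (simp add: divide_inverse inverse_mult_distrib Bm Bn mult_ac)
    qed
    also have "\<dots> = (\<Sum>n\<in>UNIV. (of_nat CARD('a) - 1) * B (- 1) * rhs_term A B E x v (m, n))"
      by (rule sum.mono_neutral_left) (auto simp: rhs_term_def mult_char_0[OF B])
    finally show "sum ?f UNIV = (\<Sum>n\<in>UNIV. (of_nat CARD('a) - 1) * B (- 1) * rhs_term A B E x v (m, n))" .
  qed simp
  also have "\<dots> = (of_nat CARD('a) - 1) * B (- 1) * sum (rhs_term A B E x v) UNIV"
    by (simp add: sum.cartesian_product sum_distrib_left)
  also have "sum (rhs_term A B E x v) UNIV = sum (rhs_term A B E x v) (rhs_supp x v)"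
    by (rule sum.mono_neutral_right)
      (auto simp: rhs_supp_def rhs_term_def mult_char_0[OF A] mult_char_0[OF B] mult_char_0[OF E])
  finally show ?thesis .
qed

lemma char_quotient:
  fixes \<chi> :: "'a::{field,finite} \<Rightarrow> complex"
  assumes "mult_char \<chi>" "mult_char P" "mult_char Q"
  shows "P * \<chi> * inverse (Q * \<chi>) = P * inverse Q" "P * \<chi> * inverse \<chi> = P"
proof -
  have "P x * \<chi> x * inverse (Q x * \<chi> x) = P x * inverse (Q x)" "P x * \<chi> x * inverse (\<chi> x) = P x" for x
    using mult_char_eq_0_iff[OF assms(1), of x] mult_char_0[OF assms(2)] by (cases "x = 0"; simp)+
  then show "P * \<chi> * inverse (Q * \<chi>) = P * inverse Q" "P * \<chi> * inverse \<chi> = P"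
    by (simp_all add: fun_eq_iff)
qed

section \<open>Gauss sums in the two series and the product of seven Gauss sums\<close>

context additive_char
begin

text \<open>When the correction of \<open>jacobi_sum_gauss\<close> is present, \<open>P = Q\<close>,
  and its sign cancels against \<open>Q (- 1)\<close>. What remains has a coefficient independent of
  \<open>Q\<close>, so one constant can cancel it for all \<open>\<chi>\<close> at once.\<close>

lemma char_binom_gauss:
  assumes P: "mult_char P" and Q: "mult_char Q"
  shows "char_binom P Q = Q (- 1) / of_nat CARD('a) * (gauss P * gauss (inverse Q) / gauss (P * inverse Q))
    + (of_nat CARD('a) - 1) / of_nat CARD('a) * delta_char (P * inverse Q)"
proof (cases "P = Q")
  case True
  then have "Q (- 1) * P (- 1) = 1" using mult_char_minus_1_square[OF Q] by simp
  then have "Q (- 1) * ((of_nat CARD('a) - 1) * P (- 1) * d) = (of_nat CARD('a) - 1) * d" for d :: complex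
    by (simp add: mult_ac)
  then show ?thesis
    using P Q by (simp add: char_binom_jacobi jacobi_sum_gauss distrib_left add_divide_distrib)
next
  case False
  then show ?thesis
    using P Q by (simp add: char_binom_jacobi jacobi_sum_gauss delta_char_def times_inverse_eq_triv_iff)
qed

text \<open>The symmetry holds term by term: no correction occurs, and up to the stated constants
  each term is symmetric in \<open>A\<close> and \<open>B\<close>.\<close>

lemma greene_F_swap:
  assumes A: "mult_char A" "A \<noteq> \<epsilon>" "A \<noteq> E" and B: "mult_char B" "B \<noteq> \<epsilon>" "B \<noteq> E" and E: "mult_char E"
  shows "gauss A * gauss (B * inverse E) * greene_F [A, B] [E] x = gauss B * gauss (A * inverse E) * greene_F [B, A] [E] x"
proof -
  have "gauss A * gauss (B * inverse E) * (char_binom (A * \<chi>) \<chi> * char_binom (B * \<chi>) (E * \<chi>))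
    = gauss B * gauss (A * inverse E) * (char_binom (B * \<chi>) \<chi> * char_binom (A * \<chi>) (E * \<chi>))"
    if \<chi>: "mult_char \<chi>" for \<chi>
  proof -
    have nz: "gauss A \<noteq> 0" "gauss B \<noteq> 0" "gauss (A * inverse E) \<noteq> 0" "gauss (B * inverse E) \<noteq> 0"
      using A B E by (simp_all add: gauss_nonzero)
    have d: "delta_char A = 0" "delta_char B = 0" "delta_char (A * inverse E) = 0" "delta_char (B * inverse E) = 0"
      using A B E by (simp_all add: delta_char_def times_inverse_eq_triv_iff)
    show ?thesis
      using nz A B E \<chi> by (simp add: char_binom_gauss char_quotient d)
  qed
  then have "gauss A * gauss (B * inverse E) * (\<Sum>\<chi> | mult_char \<chi>. char_binom (A * \<chi>) \<chi> * char_binom (B * \<chi>) (E * \<chi>) * \<chi> x)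
    = gauss B * gauss (A * inverse E) * (\<Sum>\<chi> | mult_char \<chi>. char_binom (B * \<chi>) \<chi> * char_binom (A * \<chi>) (E * \<chi>) * \<chi> x)"
    unfolding sum_distrib_left mult.assoc[symmetric, of _ _ "_ x"]
    by (intro sum.cong refl) (simp add: mult.assoc[symmetric])
  then show ?thesis
    unfolding greene_F_2F1 by (simp add: mult.left_commute)
qed

text \<open>Pfaff moves the second factor to the argument \<open>v\<close>; the swap then gives
  \<open>A\<close> the integration variable \<open>s\<close> and puts \<open>1 - v * s\<close> under
  \<open>B\<close>, the mirror image of the first factor. This pairing is what
  \<open>lhs_term\<close> requires, and the constant comes from the swap.\<close>

lemma greene_F_product:
  assumes A: "mult_char A" "A \<noteq> \<epsilon>" "A \<noteq> E" and B: "mult_char B" "B \<noteq> \<epsilon>" "B \<noteq> E" and E: "mult_char E"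
    and even: "E (- 1) = 1" and x: "x \<noteq> 0" "x \<noteq> 1" and v: "v = x / (x - 1)"
  shows "greene_F [A, B] [E] x * greene_F [A, E * inverse B] [E] x
    = inverse (A (1 - x)) / (gauss A * gauss (inverse B) * gauss (inverse A * E) * gauss (B * inverse E)) *
      sum (lhs_term A B E x v) (lhs_supp x v)"
proof -
  have v0: "v \<noteq> 0" using x by (simp add: v)
  have nz: "gauss A \<noteq> 0" "gauss B \<noteq> 0" "gauss (inverse B) \<noteq> 0" "gauss (inverse A * E) \<noteq> 0" "gauss (B * inverse E) \<noteq> 0"
    using A B E by (simp_all add: gauss_nonzero)
  have AE: "inverse (A * inverse E) = inverse A * E" by (simp add: inverse_times_fun)
  have gB: "gauss B * gauss (inverse B) = B (- 1) * of_nat CARD('a)"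
    using B by (intro gauss_inverse)
  have gA: "gauss (A * inverse E) * gauss (inverse A * E) = A (- 1) * of_nat CARD('a)"
    using gauss_inverse[of "A * inverse E"] A E by (simp add: AE times_inverse_eq_triv_iff even)
  define SA where "SA = (\<Sum>s\<in>UNIV. A s * inverse (A (1 - s)) * E (1 - s) * inverse (B (1 - v * s)))"
  define SB where "SB = (\<Sum>t\<in>UNIV. B t * inverse (B (1 - t)) * E (1 - t) * inverse (A (1 - x * t)))"
  have pfaff: "greene_F [A, E * inverse B] [E] x = inverse (A (1 - x)) * greene_F [A, B] [E] v"
    unfolding greene_F_pfaff[OF A(1) B(1) E x] v even by simp
  have swapped: "greene_F [B, A] [E] v = A (- 1) / of_nat CARD('a) * SA"
    unfolding greene_F_sum[OF B(1) A(1) E v0] even SA_def by simp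
  have "gauss A * gauss (B * inverse E) * greene_F [A, E * inverse B] [E] x
      = inverse (A (1 - x)) * (gauss A * gauss (B * inverse E) * greene_F [A, B] [E] v)"
    unfolding pfaff by (simp only: mult_ac)
  then have 1: "gauss A * gauss (B * inverse E) * greene_F [A, E * inverse B] [E] x
      = inverse (A (1 - x)) * (gauss B * gauss (A * inverse E) * (A (- 1) / of_nat CARD('a) * SA))"
    unfolding greene_F_swap[OF A B E] swapped .
  have 2: "greene_F [A, B] [E] x = B (- 1) / of_nat CARD('a) * SB"
    unfolding greene_F_sum[OF A(1) B(1) E x(1)] even SB_def by simp
  have "(gauss A * gauss (inverse B) * gauss (inverse A * E) * gauss (B * inverse E)) *
      (greene_F [A, B] [E] x * greene_F [A, E * inverse B] [E] x)
    = greene_F [A, B] [E] x * gauss (inverse B) * gauss (inverse A * E) *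
      (gauss A * gauss (B * inverse E) * greene_F [A, E * inverse B] [E] x)"
    by (simp only: mult_ac)
  also have "\<dots> = inverse (A (1 - x)) * (B (- 1) / of_nat CARD('a)) * (A (- 1) / of_nat CARD('a)) *
      (gauss B * gauss (inverse B)) * (gauss (A * inverse E) * gauss (inverse A * E)) * (SA * SB)"
    unfolding 1 2 by (simp only: mult_ac)
  also have "\<dots> = (B (- 1) * B (- 1)) * (A (- 1) * A (- 1)) * (inverse (A (1 - x)) * (SA * SB))"
    unfolding gA gB by simp
  also have "\<dots> = inverse (A (1 - x)) * sum (lhs_term A B E x v) (lhs_supp x v)"
    unfolding sum_lhs_term_product[OF A(1) B(1) E] SA_def SB_def
      mult_char_minus_1_square[OF A(1)] mult_char_minus_1_square[OF B(1)] by simp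
  finally show ?thesis
    unfolding times_divide_eq_left using nz by (simp only: eq_divide_eq mult_eq_0_iff mult.commute simp_thms if_True if_False)
qed

text \<open>If only the product of \<open>P\<close> and \<open>Q\<close> is trivial, the formula
  still holds without correction. For \<open>P = Q = \<epsilon>\<close> the left side is
  \<open>- 1\<close>, and with \<open>q = CARD('a)\<close> the correction is
  \<open>- 1 = q * (q - 2) - (q - 1)\<^sup>2\<close>.\<close>

lemma gauss_triple:
  assumes P: "mult_char P" and Q: "mult_char Q" and even: "(P * Q) (- 1) = 1"
  shows "gauss P * gauss Q * gauss (inverse (P * Q)) = of_nat CARD('a) * jacobi_sum P Q
    - (of_nat CARD('a) - 1)\<^sup>2 * (if P = \<epsilon> \<and> Q = \<epsilon> then 1 else 0)"
proof (cases "P * Q = \<epsilon>")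
  case True
  then have Q_eq: "Q = inverse P"
    using P Q by (metis inverse_inverse_fun times_eq_triv_iff)
  show ?thesis
  proof (cases "P = \<epsilon>")
    case True
    then show ?thesis
      using Q_eq by (simp add: gauss_triv jacobi_sum_triv power2_eq_square algebra_simps)
  next
    case False
    then show ?thesis
      using P True by (simp add: Q_eq gauss_inverse jacobi_sum_inverse gauss_triv)
  qed
next
  case False
  have "gauss P * gauss Q * gauss (inverse (P * Q)) = jacobi_sum P Q * (gauss (P * Q) * gauss (inverse (P * Q)))"
    using gauss_times[OF P Q] False by (simp add: delta_char_def)
  also have "gauss (P * Q) * gauss (inverse (P * Q)) = of_nat CARD('a)"
    using gauss_inverse[of "P * Q"] P Q False even by simp
  finally have eq: "gauss P * gauss Q * gauss (inverse (P * Q)) = jacobi_sum P Q * of_nat CARD('a)" .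
  have "\<not> (P = \<epsilon> \<and> Q = \<epsilon>)" using False by auto
  then show ?thesis
    unfolding eq by (simp only: if_False mult_zero_right mult_zero_left diff_zero mult.commute)
qed

text \<open>The grouping prepares the Jacobi sums: the characters of the first three factors
  multiply to \<open>\<epsilon>\<close>, and those of the two pairs to \<open>B\<close> and
  \<open>inverse B\<close>, independently of \<open>\<chi>\<close>.\<close>

definition gauss_product :: "('a \<Rightarrow> complex) \<Rightarrow> ('a \<Rightarrow> complex) \<Rightarrow> ('a \<Rightarrow> complex) \<Rightarrow> ('a \<Rightarrow> complex) \<Rightarrow> complex" where
  "gauss_product A B E \<chi> = gauss (A * \<chi>) * gauss (inverse A * E * \<chi>) * gauss (inverse (E * \<chi> * \<chi>)) *
     (gauss (B * \<chi>) * gauss (inverse \<chi>)) * (gauss (inverse B * E * \<chi>) * gauss (inverse (E * \<chi>)))"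

lemma gauss_times_cancel:
  assumes "mult_char B" "B \<noteq> \<epsilon>" "mult_char \<chi>"
  shows "gauss (B * \<chi>) * gauss (inverse \<chi>) = gauss B * jacobi_sum (B * \<chi>) (inverse \<chi>)"
  using gauss_times[of "B * \<chi>" "inverse \<chi>"] assms by (simp add: char_quotient delta_char_def)

text \<open>The triple yields one factor \<open>CARD('a)\<close>, and the pairs yield
  \<open>gauss B * gauss (inverse B)\<close>, another one with the sign \<open>B (- 1)\<close>,
  which the sign in \<open>sum_jacobi_triple\<close> cancels. The triple is exceptional only at
  \<open>\<chi> = inverse A\<close> with \<open>A * A = E\<close>; there the four other Gauss sums
  form two inverse pairs, and one of these is trivial when \<open>A = B\<close>.\<close>

lemma sum_gauss_product:
  assumes A: "mult_char A" "A \<noteq> \<epsilon>" and B: "mult_char B" "B \<noteq> \<epsilon>" and E: "mult_char E"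
    and even: "E (- 1) = 1" and xv: "x * v \<noteq> 0"
  shows "(\<Sum>\<chi> | mult_char \<chi>. gauss_product A B E \<chi> * \<chi> (x * v))
    = of_nat CARD('a) ^ 2 * (of_nat CARD('a) - 1) * sum (rhs_term A B E x v) (rhs_supp x v)
    - (of_nat CARD('a) - 1)\<^sup>2 * (if A * A = E then A (- 1) * of_nat CARD('a) * inverse (A (x * v)) *
        (if A = B then 1 else A (- 1) * B (- 1) * of_nat CARD('a)) else 0)"
proof -
  let ?q = "of_nat CARD('a) :: complex"
  let ?J = "\<lambda>\<chi>. jacobi_sum (A * \<chi>) (inverse A * E * \<chi>) * jacobi_sum (B * \<chi>) (inverse \<chi>) *
      jacobi_sum (inverse B * E * \<chi>) (inverse (E * \<chi>)) * \<chi> (x * v)"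
  let ?R = "if A * A = E then A (- 1) * ?q * inverse (A (x * v)) * (if A = B then 1 else A (- 1) * B (- 1) * ?q) else 0"
  have "gauss_product A B E \<chi> * \<chi> (x * v) = ?q ^ 2 * B (- 1) * ?J \<chi>
      - (?q - 1)\<^sup>2 * (if \<chi> = inverse A then ?R else 0)" if \<chi>: "mult_char \<chi>" for \<chi>
  proof -
    have "A x * \<chi> x * (inverse (A x) * E x * \<chi> x) = E x * \<chi> x * \<chi> x" for x
      using mult_char_eq_0_iff[OF A(1), of x] mult_char_0[OF \<chi>] by (cases "x = 0") simp_all
    then have prod: "A * \<chi> * (inverse A * E * \<chi>) = E * \<chi> * \<chi>"
      by (simp add: fun_eq_iff)
    have triple: "gauss (A * \<chi>) * gauss (inverse A * E * \<chi>) * gauss (inverse (E * \<chi> * \<chi>))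
        = ?q * jacobi_sum (A * \<chi>) (inverse A * E * \<chi>)
        - (?q - 1)\<^sup>2 * (if A * \<chi> = \<epsilon> \<and> inverse A * E * \<chi> = \<epsilon> then 1 else 0)"
      using gauss_triple[of "A * \<chi>" "inverse A * E * \<chi>"] A \<chi> E
        even mult_char_minus_1_square[OF \<chi>] unfolding prod by (simp add: mult.assoc)
    have "A * \<chi> = \<epsilon> \<longleftrightarrow> \<chi> = inverse A"
      using A \<chi> times_eq_triv_iff[of \<chi> A] by (simp add: mult.commute)
    moreover have "inverse A * E * inverse A = \<epsilon> \<longleftrightarrow> A * A = E"
    proof -
      have "inverse A * E * inverse A = E * inverse (A * A)" by (simp add: inverse_times_fun mult_ac)
      then show ?thesis using A E by (auto simp: times_inverse_eq_triv_iff)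
    qed
    ultimately have cond: "A * \<chi> = \<epsilon> \<and> inverse A * E * \<chi> = \<epsilon> \<longleftrightarrow> \<chi> = inverse A \<and> A * A = E"
      by auto
    have inv_B: "gauss (inverse B * E * \<chi>) * gauss (inverse (E * \<chi>))
        = gauss (inverse B) * jacobi_sum (inverse B * E * \<chi>) (inverse (E * \<chi>))"
      using gauss_times_cancel[of "inverse B" "E * \<chi>"] B E \<chi> by (simp add: mult.assoc)
    have J: "?q * jacobi_sum (A * \<chi>) (inverse A * E * \<chi>) *
        (gauss (B * \<chi>) * gauss (inverse \<chi>)) * (gauss (inverse B * E * \<chi>) * gauss (inverse (E * \<chi>))) * \<chi> (x * v)
        = ?q ^ 2 * B (- 1) * ?J \<chi>"
    proof -
      have "?q * jacobi_sum (A * \<chi>) (inverse A * E * \<chi>) *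
          (gauss (B * \<chi>) * gauss (inverse \<chi>)) * (gauss (inverse B * E * \<chi>) * gauss (inverse (E * \<chi>))) * \<chi> (x * v)
          = ?q * (gauss B * gauss (inverse B)) * ?J \<chi>"
        unfolding inv_B gauss_times_cancel[OF B \<chi>] by (simp only: mult_ac)
      then show ?thesis
        unfolding gauss_inverse[OF B] by (simp only: mult_ac power2_eq_square)
    qed
    have R: "(if \<chi> = inverse A \<and> A * A = E then 1 else 0) *
        (gauss (B * \<chi>) * gauss (inverse \<chi>)) * (gauss (inverse B * E * \<chi>) * gauss (inverse (E * \<chi>))) * \<chi> (x * v)
        = (if \<chi> = inverse A then ?R else 0)"
    proof (cases "\<chi> = inverse A \<and> A * A = E")
      case True
      then have \<chi>_eq: "\<chi> = inverse A" and E_eq: "E = A * A" by auto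
      have 1: "E * \<chi> = A" unfolding \<chi>_eq E_eq using A char_quotient(2)[of A A] by simp
      have 2: "gauss A * gauss (inverse A) = A (- 1) * ?q" using A by (rule gauss_inverse)
      have 3: "gauss (B * inverse A) * gauss (inverse B * A) = (if A = B then 1 else A (- 1) * B (- 1) * ?q)"
      proof (cases "A = B")
        case False
        then have "B * inverse A \<noteq> \<epsilon>" using A B by (auto simp: times_inverse_eq_triv_iff)
        moreover have "inverse (B * inverse A) = inverse B * A" by (simp add: inverse_times_fun)
        moreover have "inverse (A (- 1)) = A (- 1)" using mult_char_inverse[OF A(1), of "- 1"] by simp
        ultimately show ?thesis
          using gauss_inverse[of "B * inverse A"] A B False by (simp add: mult_ac)
      qed (use B in \<open>simp add: gauss_triv\<close>)
      have "gauss (B * \<chi>) * gauss (inverse \<chi>) * (gauss (inverse B * E * \<chi>) * gauss (inverse (E * \<chi>))) * \<chi> (x * v)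
        = (gauss (B * inverse A) * gauss (inverse B * A)) * (gauss A * gauss (inverse A)) * inverse (A (x * v))"
        unfolding mult.assoc[of "inverse B" E] 1 by (simp add: \<chi>_eq mult_ac)
      then show ?thesis
        using True unfolding 2 3 by (simp add: mult_ac)
    qed auto
    show ?thesis
      unfolding gauss_product_def triple cond left_diff_distrib J
      unfolding R[symmetric] by (simp only: mult_ac)
  qed
  then have "(\<Sum>\<chi> | mult_char \<chi>. gauss_product A B E \<chi> * \<chi> (x * v))
    = (\<Sum>\<chi> | mult_char \<chi>. ?q ^ 2 * B (- 1) * ?J \<chi> - (?q - 1)\<^sup>2 * (if \<chi> = inverse A then ?R else 0))"
    by (intro sum.cong refl) blast
  also have "\<dots> = ?q ^ 2 * B (- 1) * (\<Sum>\<chi> | mult_char \<chi>. ?J \<chi>)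
      - (?q - 1)\<^sup>2 * (\<Sum>\<chi> | mult_char \<chi>. if \<chi> = inverse A then ?R else 0)"
    by (simp only: sum_subtractf sum_distrib_left)
  also have "(\<Sum>\<chi> | mult_char \<chi>. if \<chi> = inverse A then ?R else 0) = ?R"
    using A finite_mult_char by (subst sum.delta) simp_all
  also have "?q ^ 2 * B (- 1) * (\<Sum>\<chi> | mult_char \<chi>. ?J \<chi>)
      = ?q ^ 2 * (?q - 1) * (B (- 1) * B (- 1)) * sum (rhs_term A B E x v) (rhs_supp x v)"
    unfolding sum_jacobi_triple[OF A(1) B(1) E even xv] by (simp only: mult_ac)
  finally show ?thesis
    unfolding mult_char_minus_1_square[OF B(1)] mult_1_right .
qed

end

section \<open>The product formula\<close>

lemma square_eq_square_iff:
  fixes A C :: "'a::{field,finite} \<Rightarrow> complex"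
  assumes odd: "odd CARD('a)" and A: "mult_char A" and C: "mult_char C"
  shows "A * A = C * C \<longleftrightarrow> A = C \<or> A = C * \<phi>"
proof -
  note \<phi> = mult_char_quad[where 'a = 'a, OF odd]
  have "A * A = C * C \<longleftrightarrow> (A * inverse C) * (A * inverse C) = \<epsilon>"
    using times_inverse_eq_triv_iff[of "A * A" "C * C"] A C by (simp add: inverse_times_fun mult_ac)
  also have "\<dots> \<longleftrightarrow> A * inverse C = \<epsilon> \<or> A * inverse C = \<phi>"
    using A C by (intro square_eq_triv_iff[OF odd]) simp
  also have "A * inverse C = \<phi> \<longleftrightarrow> A * inverse (C * \<phi>) = \<epsilon>"
    using times_inverse_eq_triv_iff[of "A * inverse C" \<phi>] A C \<phi> by (simp add: inverse_times_fun mult.assoc)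
  finally show ?thesis
    unfolding times_inverse_eq_triv_iff[OF A C] times_inverse_eq_triv_iff[OF A mult_char_times[OF C \<phi>]] .
qed

lemma delta_char_quotient:
  fixes A C :: "'a::{field,finite} \<Rightarrow> complex"
  assumes odd: "odd CARD('a)" and A: "mult_char A" and C: "mult_char C"
  shows "delta_char (A * inverse C) = (if A = C then 1 else 0)"
    and "delta_char (A * inverse C * \<phi>) = (if A = C * \<phi> then 1 else 0)"
proof -
  note \<phi> = mult_char_quad[where 'a = 'a, OF odd]
  show "delta_char (A * inverse C) = (if A = C then 1 else 0)"
    using A C by (simp add: delta_char_def times_inverse_eq_triv_iff)
  have "A * inverse C * \<phi> = A * inverse (C * \<phi>)"
    by (simp add: inverse_times_fun mult.assoc)
  then show "delta_char (A * inverse C * \<phi>) = (if A = C * \<phi> then 1 else 0)"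
    using A C \<phi> by (simp add: delta_char_def times_inverse_eq_triv_iff)
qed

text \<open>The first summand is left over from the comparison of the double sums, the second from
  the exceptional character in \<open>sum_gauss_product\<close>. Squares are equal only up to
  \<open>\<phi>\<close>, so each of \<open>A\<close> and \<open>B\<close> is \<open>C\<close>,
  \<open>C * \<phi>\<close> or neither, and the nine combinations are checked separately.\<close>

lemma correction_terms:
  fixes A B C :: "'a::{field,finite} \<Rightarrow> complex"
  assumes odd: "odd CARD('a)" and A: "mult_char A" and B: "mult_char B" and C: "mult_char C"
    and x: "x \<noteq> 0" "x \<noteq> 1" and v: "v = x / (x - 1)" and q0: "q \<noteq> 0"
  shows "A (- 1) * B (x - 1) / (C * C) x * ((q - 1) * delta_char (B * B * inverse (C * C)))
      + (q - 1) / q\<^sup>2 * (if A * A = C * C then A (- 1) * q * inverse (A (x * v)) *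
        (if A = B then 1 else A (- 1) * B (- 1) * q) else 0)
    = - ((q - 1) * inverse C (x\<^sup>2) * C (1 - x) / q *
         ((q - 1) * delta_char (A * inverse C) * delta_char (B * inverse C)
          - q * (B * C) (- 1) * delta_char (A * inverse C)
          - q * (A * C) (- 1) * delta_char (B * inverse C)
          + (q - 1) * \<phi> (1 - x) *
              delta_char (A * inverse C * \<phi>) * delta_char (B * inverse C * \<phi>)
          - q * (B * C) (- 1) * \<phi> (x - 1) * delta_char (A * inverse C * \<phi>)
          - q * (A * C) (- 1) * \<phi> (x - 1) * delta_char (B * inverse C * \<phi>)))"
proof -
  note \<phi> = mult_char_quad[where 'a = 'a, OF odd]
  have sign: "a = 1 \<or> a = - 1" if "a * a = 1" for a :: complex
    using that by (simp add: square_eq_1_iff)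
  have \<phi>_sign: "\<phi> u = (1 :: complex) \<or> \<phi> u = - 1" if "u \<noteq> 0" for u :: 'a
    using that by (simp add: quad_char_def)
  define c0 c1 where "c0 = C x" and "c1 = C (1 - x)"
  have nz: "c0 \<noteq> 0" "c1 \<noteq> 0" using x by (simp_all add: c0_def c1_def mult_char_eq_0_iff[OF C])
  have cm: "C (- 1) = 1 \<or> C (- 1) = - 1" by (rule sign) (rule mult_char_minus_1_square[OF C])
  have signs: "\<phi> (- 1 :: 'a) = (1 :: complex) \<or> \<phi> (- 1 :: 'a) = (- 1 :: complex)"
    "\<phi> (1 - x) = (1 :: complex) \<or> \<phi> (1 - x) = (- 1 :: complex)"
    "\<phi> x = (1 :: complex) \<or> \<phi> x = (- 1 :: complex)"
    using \<phi>_sign[of "- 1"] \<phi>_sign[of "1 - x"] \<phi>_sign[of x] x by auto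
  have neg: "C (x - 1) = C (- 1) * c1" "\<phi> (x - 1) = \<phi> (- 1 :: 'a) * (\<phi> (1 - x) :: complex)"
    using mult_char_minus[OF C, of "1 - x"] mult_char_minus[OF \<phi>, of "1 - x"] by (simp_all add: c1_def)
  have C_xv: "C (x * v) = c0 * c0 / (C (- 1) * c1)"
    unfolding v mult_char_mult[OF C] mult_char_divide[OF C] neg by (simp add: c0_def)
  have \<phi>_xv: "\<phi> (x * v) = \<phi> x * \<phi> x / (\<phi> (- 1 :: 'a) * (\<phi> (1 - x) :: complex))"
    unfolding v mult_char_mult[OF \<phi>] mult_char_divide[OF \<phi>] neg by simp
  have V: "inverse C (x\<^sup>2) = 1 / (c0 * c0)"
    by (simp add: mult_char_mult[OF C] c0_def power2_eq_square divide_inverse)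
  have dB: "delta_char (B * B * inverse (C * C)) = (if B = C \<or> B = C * \<phi> then 1 else 0)"
    using B C by (simp add: delta_char_def times_inverse_eq_triv_iff square_eq_square_iff[OF odd B C])
  have ne: "C \<noteq> C * \<phi>"
  proof
    assume "C = C * \<phi>"
    then have "inverse C * C = inverse C * (C * \<phi>)" by simp
    then have "\<phi> = (\<epsilon> :: 'a \<Rightarrow> complex)" using C \<phi> by (simp flip: mult.assoc)
    then show False using quad_char_neq_triv[OF odd] by blast
  qed
  \<comment> \<open>Every remaining character value is a monomial in \<open>c0\<close>,
    \<open>c1\<close> and these four signs, so each case becomes rational arithmetic after the signs
    are chosen.\<close>
  define cm pm p1 px :: complex where "cm = C (- 1)" and "pm = \<phi> (- 1 :: 'a)" and "p1 = \<phi> (1 - x)" and "px = \<phi> x"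
  have sg: "cm = 1 \<or> cm = - 1" "pm = 1 \<or> pm = - 1" "p1 = 1 \<or> p1 = - 1" "px = 1 \<or> px = - 1"
    using cm signs by (simp_all only: cm_def pm_def p1_def px_def)
  have vals: "(C * C) x = c0 * c0" "C (- 1) = cm" "C (x - 1) = cm * c1" "C (x * v) = c0 * c0 / (cm * c1)"
    "\<phi> (1 - x) = p1" "\<phi> (x - 1) = pm * p1"
    "(C * \<phi>) (- 1) = cm * pm" "(C * \<phi>) (x - 1) = cm * c1 * (pm * p1)"
    "(C * \<phi>) (x * v) = c0 * c0 / (cm * c1) * (px * px / (pm * p1))"
    by (simp_all add: neg C_xv \<phi>_xv c0_def cm_def pm_def p1_def px_def)
  have prod_vals: "(B * C) (- 1) = B (- 1) * cm" "(A * C) (- 1) = A (- 1) * cm"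
    by (simp_all add: cm_def)
  note expand = dB delta_char_quotient[OF odd A C] delta_char_quotient[OF odd B C]
    square_eq_square_iff[OF odd A C] V c1_def[symmetric] prod_vals
  show ?thesis
  proof -
    consider "A = C" | "A = C * \<phi>" | "A \<noteq> C" "A \<noteq> C * \<phi>" by blast
    moreover consider "B = C" | "B = C * \<phi>" | "B \<noteq> C" "B \<noteq> C * \<phi>" by blast
    ultimately consider "A = C" "B = C" | "A = C" "B = C * \<phi>" | "A = C" "B \<noteq> C" "B \<noteq> C * \<phi>"
      | "A = C * \<phi>" "B = C" | "A = C * \<phi>" "B = C * \<phi>" | "A = C * \<phi>" "B \<noteq> C" "B \<noteq> C * \<phi>"
      | "A \<noteq> C" "A \<noteq> C * \<phi>" "B = C" | "A \<noteq> C" "A \<noteq> C * \<phi>" "B = C * \<phi>"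
      | "A \<noteq> C" "A \<noteq> C * \<phi>" "B \<noteq> C" "B \<noteq> C * \<phi>"
      by metis
    then show ?thesis
    proof cases
      case 1
      then have conds: "(A = C) = True" "(A = C * \<phi>) = False" "(B = C) = True" "(B = C * \<phi>) = False" "(A = B) = True"
        using ne ne[symmetric] by metis+
      have subst: "A (- 1) = (C) (- 1)" "A (x - 1) = (C) (x - 1)" "A (x * v) = (C) (x * v)" "B (- 1) = (C) (- 1)" "B (x - 1) = (C) (x - 1)" "B (x * v) = (C) (x * v)"
        using 1 by simp_all
      show ?thesis
        by (simp only: expand conds subst vals if_True if_False simp_thms)
          (insert sg nz q0, elim disjE, simp_all add: field_simps power2_eq_square)
    next
      case 2
      then have conds: "(A = C) = True" "(A = C * \<phi>) = False" "(B = C) = False" "(B = C * \<phi>) = True" "(A = B) = False"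
        using ne ne[symmetric] by metis+
      have subst: "A (- 1) = (C) (- 1)" "A (x - 1) = (C) (x - 1)" "A (x * v) = (C) (x * v)" "B (- 1) = (C * \<phi>) (- 1)" "B (x - 1) = (C * \<phi>) (x - 1)" "B (x * v) = (C * \<phi>) (x * v)"
        using 2 by simp_all
      show ?thesis
        by (simp only: expand conds subst vals if_True if_False simp_thms)
          (insert sg nz q0, elim disjE, simp_all add: field_simps power2_eq_square)
    next
      case 3
      then have conds: "(A = C) = True" "(A = C * \<phi>) = False" "(B = C) = False" "(B = C * \<phi>) = False" "(A = B) = False"
        using ne ne[symmetric] by metis+
      have subst: "A (- 1) = (C) (- 1)" "A (x - 1) = (C) (x - 1)" "A (x * v) = (C) (x * v)"
        using 3 by simp_all
      show ?thesis
        by (simp only: expand conds subst vals if_True if_False simp_thms)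
          (insert sg nz q0, elim disjE, simp_all add: field_simps power2_eq_square)
    next
      case 4
      then have conds: "(A = C) = False" "(A = C * \<phi>) = True" "(B = C) = True" "(B = C * \<phi>) = False" "(A = B) = False"
        using ne ne[symmetric] by metis+
      have subst: "A (- 1) = (C * \<phi>) (- 1)" "A (x - 1) = (C * \<phi>) (x - 1)" "A (x * v) = (C * \<phi>) (x * v)" "B (- 1) = (C) (- 1)" "B (x - 1) = (C) (x - 1)" "B (x * v) = (C) (x * v)"
        using 4 by simp_all
      show ?thesis
        by (simp only: expand conds subst vals if_True if_False simp_thms)
          (insert sg nz q0, elim disjE, simp_all add: field_simps power2_eq_square)
    next
      case 5
      then have conds: "(A = C) = False" "(A = C * \<phi>) = True" "(B = C) = False" "(B = C * \<phi>) = True" "(A = B) = True"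
        using ne ne[symmetric] by metis+
      have subst: "A (- 1) = (C * \<phi>) (- 1)" "A (x - 1) = (C * \<phi>) (x - 1)" "A (x * v) = (C * \<phi>) (x * v)" "B (- 1) = (C * \<phi>) (- 1)" "B (x - 1) = (C * \<phi>) (x - 1)" "B (x * v) = (C * \<phi>) (x * v)"
        using 5 by simp_all
      show ?thesis
        by (simp only: expand conds subst vals if_True if_False simp_thms)
          (insert sg nz q0, elim disjE, simp_all add: field_simps power2_eq_square)
    next
      case 6
      then have conds: "(A = C) = False" "(A = C * \<phi>) = True" "(B = C) = False" "(B = C * \<phi>) = False" "(A = B) = False"
        using ne ne[symmetric] by metis+
      have subst: "A (- 1) = (C * \<phi>) (- 1)" "A (x - 1) = (C * \<phi>) (x - 1)" "A (x * v) = (C * \<phi>) (x * v)"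
        using 6 by simp_all
      show ?thesis
        by (simp only: expand conds subst vals if_True if_False simp_thms)
          (insert sg nz q0, elim disjE, simp_all add: field_simps power2_eq_square)
    next
      case 7
      then have conds: "(A = C) = False" "(A = C * \<phi>) = False" "(B = C) = True" "(B = C * \<phi>) = False" "(A = B) = False"
        using ne ne[symmetric] by metis+
      have subst: "B (- 1) = (C) (- 1)" "B (x - 1) = (C) (x - 1)" "B (x * v) = (C) (x * v)"
        using 7 by simp_all
      show ?thesis
        by (simp only: expand conds subst vals if_True if_False simp_thms)
          (insert sg nz q0, elim disjE, simp_all add: field_simps power2_eq_square)
    next
      case 8
      then have conds: "(A = C) = False" "(A = C * \<phi>) = False" "(B = C) = False" "(B = C * \<phi>) = True" "(A = B) = False"
        using ne ne[symmetric] by metis+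
      have subst: "B (- 1) = (C * \<phi>) (- 1)" "B (x - 1) = (C * \<phi>) (x - 1)" "B (x * v) = (C * \<phi>) (x * v)"
        using 8 by simp_all
      show ?thesis
        by (simp only: expand conds subst vals if_True if_False simp_thms)
          (insert sg nz q0, elim disjE, simp_all add: field_simps power2_eq_square)
    next
      case 9
      then have conds: "(A = C) = False" "(A = C * \<phi>) = False" "(B = C) = False" "(B = C * \<phi>) = False"
        using ne ne[symmetric] by metis+
      show ?thesis
        by (simp only: expand conds if_True if_False simp_thms) simp
    qed
  qed
qed

section \<open>The bracketed series as a sum of Gauss sum products, and the assembly\<close>

context additive_char
begin

lemma quotient_CE:
  assumes "mult_char A" "mult_char C" "mult_char \<chi>"
  shows "inverse A * (C * C) * \<chi> * inverse (C * \<chi>) = inverse A * C"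
  using char_quotient(1)[of \<chi> "inverse A * (C * C)" C] char_quotient(2)[of C "inverse A * C" C] assms
  by (simp add: mult.assoc)

lemma sum_4F3:
  assumes odd: "odd CARD('a)" and A: "mult_char A" "A \<noteq> \<epsilon>" and B: "mult_char B" "B \<noteq> \<epsilon>" "B \<noteq> C * C" and C: "mult_char C"
  shows "gauss (inverse A * C) * gauss (inverse B * C * \<phi>) / (\<phi> (- 1 :: 'a) * C 4 * gauss \<phi>) *
     (of_nat CARD('a) * greene_F [A, B, inverse A * (C * C), inverse B * (C * C)] [C * C, C, C * \<phi>] y
      + (of_nat CARD('a) - 1) * ((of_nat CARD('a) - 1) / of_nat CARD('a) * greene_F [A, B] [C * C] y *
            delta_char (inverse A * C) * delta_char (inverse B * C * \<phi>)
          - greene_F [A, B, inverse B * (C * C)] [C * C, C * \<phi>] y * delta_char (inverse A * C)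
          - greene_F [A, B, inverse A * (C * C)] [C * C, C] y * delta_char (inverse B * C * \<phi>)))
    = (\<Sum>\<chi> | mult_char \<chi>. gauss_product A B (C * C) \<chi> * \<chi> (4 * y)) /
      (of_nat CARD('a) ^ 2 * (of_nat CARD('a) - 1) * gauss A * gauss (B * inverse (C * C)))"
proof -
  note \<phi> = mult_char_quad[where 'a = 'a, OF odd]
  let ?q = "of_nat CARD('a) :: complex"
  let ?\<kappa> = "(?q - 1) / ?q"
  let ?b1 = "\<lambda>\<chi>. char_binom (A * \<chi>) \<chi>"
  let ?b2 = "\<lambda>\<chi>. char_binom (B * \<chi>) (C * C * \<chi>)"
  let ?b3 = "\<lambda>\<chi>. char_binom (inverse A * (C * C) * \<chi>) (C * \<chi>)"
  let ?b4 = "\<lambda>\<chi>. char_binom (inverse B * (C * C) * \<chi>) (C * \<phi> * \<chi>)"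
  let ?d3 = "delta_char (inverse A * C)"
  let ?d4 = "delta_char (inverse B * C * \<phi>)"
  let ?G = "gauss (inverse A * C) * gauss (inverse B * C * \<phi>) / (\<phi> (- 1 :: 'a) * C 4 * gauss \<phi>)"
  have q1: "?q - 1 \<noteq> 0" by (rule card_neq_1)
  \<comment> \<open>Subtracting its correction from the third and from the fourth binomial
    coefficient and multiplying out gives four series: the full one, two that lack one of these
    coefficients, and one that lacks both. This explains the shape of the bracket.\<close>
  have series: "?q * greene_F [A, B, inverse A * (C * C), inverse B * (C * C)] [C * C, C, C * \<phi>] y
      + (?q - 1) * (?\<kappa> * greene_F [A, B] [C * C] y * ?d3 * ?d4
          - greene_F [A, B, inverse B * (C * C)] [C * C, C * \<phi>] y * ?d3
          - greene_F [A, B, inverse A * (C * C)] [C * C, C] y * ?d4)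
    = ?q ^ 2 / (?q - 1) * (\<Sum>\<chi> | mult_char \<chi>. ?b1 \<chi> * ?b2 \<chi> * ((?b3 \<chi> - ?\<kappa> * ?d3) * (?b4 \<chi> - ?\<kappa> * ?d4)) * \<chi> y)"
  proof -
    have expand: "(\<Sum>\<chi> | mult_char \<chi>. ?b1 \<chi> * ?b2 \<chi> * ((?b3 \<chi> - ?\<kappa> * ?d3) * (?b4 \<chi> - ?\<kappa> * ?d4)) * \<chi> y)
      = (\<Sum>\<chi> | mult_char \<chi>. ?b1 \<chi> * (?b2 \<chi> * ?b3 \<chi> * ?b4 \<chi>) * \<chi> y)
        + ?\<kappa> * ?\<kappa> * ?d3 * ?d4 * (\<Sum>\<chi> | mult_char \<chi>. ?b1 \<chi> * ?b2 \<chi> * \<chi> y)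
        - ?\<kappa> * ?d3 * (\<Sum>\<chi> | mult_char \<chi>. ?b1 \<chi> * (?b2 \<chi> * ?b4 \<chi>) * \<chi> y)
        - ?\<kappa> * ?d4 * (\<Sum>\<chi> | mult_char \<chi>. ?b1 \<chi> * (?b2 \<chi> * ?b3 \<chi>) * \<chi> y)"
    proof -
      have pointwise: "b1 * b2 * ((b3 - k * d3) * (b4 - k * d4)) * c
          = b1 * (b2 * b3 * b4) * c + k * k * d3 * d4 * (b1 * b2 * c)
            - k * d3 * (b1 * (b2 * b4) * c) - k * d4 * (b1 * (b2 * b3) * c)"
        for b1 b2 b3 b4 k d3 d4 c :: complex
        by (simp add: algebra_simps)
      show ?thesis
        unfolding sum_distrib_left sum.distrib[symmetric] sum_subtractf[symmetric]
        by (intro sum.cong refl) (rule pointwise)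
    qed
    have collect: "n * (n / m * s4) + m * (m / n * (n / m * s2) * d3 * d4 - n / m * s3 * d3 - n / m * s3' * d4)
        = n ^ 2 / m * (s4 + m / n * (m / n) * d3 * d4 * s2 - m / n * d3 * s3 - m / n * d4 * s3')"
      if "n \<noteq> 0" "m \<noteq> 0" for n m s4 s3 s3' s2 d3 d4 :: complex
      using that by (simp add: field_simps power2_eq_square)
    show ?thesis
      unfolding greene_F_2F1 greene_F_3F2 greene_F_4F3 expand
      by (rule collect) (simp, rule q1)
  qed
  have "?G * (?b1 \<chi> * ?b2 \<chi> * ((?b3 \<chi> - ?\<kappa> * ?d3) * (?b4 \<chi> - ?\<kappa> * ?d4)) * \<chi> y)
    = gauss_product A B (C * C) \<chi> * \<chi> (4 * y) / (?q ^ 4 * gauss A * gauss (B * inverse (C * C)))"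
    if \<chi>: "mult_char \<chi>" for \<chi>
  proof -
    define \<rho> where "\<rho> = inverse (C * \<chi>)"
    have \<rho>: "mult_char \<rho>" using C \<chi> by (simp add: \<rho>_def)
    have \<rho>': "inverse (C * \<phi> * \<chi>) = \<rho> * \<phi>" "\<rho> * \<rho> = inverse (C * C * \<chi> * \<chi>)"
      by (simp_all add: \<rho>_def inverse_times_fun mult_ac)
    have q3: "inverse A * (C * C) * \<chi> * inverse (C * \<chi>) = inverse A * C"
      using A C \<chi> by (intro quotient_CE)
    have "inverse B * (C * C) * \<chi> * inverse (C * \<phi> * \<chi>)
        = (inverse B * (C * C) * \<chi> * inverse (C * \<chi>)) * \<phi>"
      by (simp add: inverse_times_fun mult_ac)
    then have q4: "inverse B * (C * C) * \<chi> * inverse (C * \<phi> * \<chi>) = inverse B * C * \<phi>"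
      unfolding quotient_CE[OF B(1) C \<chi>] .
    have b1: "?b1 \<chi> = \<chi> (- 1) / ?q * (gauss (A * \<chi>) * gauss (inverse \<chi>) / gauss A)"
      using A \<chi> by (simp add: char_binom_gauss char_quotient delta_char_def)
    have b2: "?b2 \<chi> = \<chi> (- 1) / ?q * (gauss (B * \<chi>) * gauss (inverse (C * C * \<chi>)) / gauss (B * inverse (C * C)))"
      using B C \<chi> mult_char_minus_1_square[OF C]
      by (simp add: char_binom_gauss char_quotient delta_char_def times_inverse_eq_triv_iff)
    have b3: "?b3 \<chi> - ?\<kappa> * ?d3 = C (- 1) * \<chi> (- 1) / ?q *
        (gauss (inverse A * (C * C) * \<chi>) * gauss \<rho> / gauss (inverse A * C))"
      using char_binom_gauss[of "inverse A * (C * C) * \<chi>" "C * \<chi>"] A C \<chi>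
      unfolding q3 by (simp add: \<rho>_def)
    have b4: "?b4 \<chi> - ?\<kappa> * ?d4 = C (- 1) * \<phi> (- 1 :: 'a) * \<chi> (- 1) / ?q *
        (gauss (inverse B * (C * C) * \<chi>) * gauss (\<rho> * \<phi>) / gauss (inverse B * C * \<phi>))"
      using char_binom_gauss[of "inverse B * (C * C) * \<chi>" "C * \<phi> * \<chi>"] B C \<chi> \<phi>
      unfolding q4 unfolding \<rho>' by simp
    \<comment> \<open>The lower parameters \<open>C\<close> and \<open>C * \<phi>\<close> enter
      through the inverses \<open>\<rho>\<close> and \<open>\<rho> * \<phi>\<close>, a pair for the
      duplication formula. Its factor \<open>\<chi> 4\<close> changes the argument from
      \<open>y\<close> to \<open>4 * y\<close>, and \<open>C 4\<close> cancels against the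
      denominator of \<open>M\<close>.\<close>
    have hd: "gauss \<rho> * gauss (\<rho> * \<phi>) = C 4 * \<chi> 4 * gauss \<phi> * gauss (inverse (C * C * \<chi> * \<chi>))"
      unfolding hasse_davenport_quad[OF odd \<rho>] \<rho>' by (simp add: \<rho>_def)
    have 4: "(4::'a) \<noteq> 0" by (rule four_neq_0[OF odd])
    have nz: "gauss A \<noteq> 0" "gauss (B * inverse (C * C)) \<noteq> 0" "gauss (inverse A * C) \<noteq> 0"
      "gauss (inverse B * C * \<phi>) \<noteq> 0" "gauss \<phi> \<noteq> 0" "C 4 \<noteq> 0" "\<phi> (- 1 :: 'a) \<noteq> (0 :: complex)"
      using A B C \<phi> 4 by (simp_all add: gauss_nonzero mult_char_eq_0_iff)
    have "?G * (?b1 \<chi> * ?b2 \<chi> * ((?b3 \<chi> - ?\<kappa> * ?d3) * (?b4 \<chi> - ?\<kappa> * ?d4)) * \<chi> y)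
      = (\<chi> (- 1) * \<chi> (- 1)) * (\<chi> (- 1) * \<chi> (- 1)) * (C (- 1) * C (- 1)) / (C 4 * gauss \<phi>) *
        (gauss (A * \<chi>) * gauss (inverse \<chi>) * gauss (B * \<chi>) * gauss (inverse (C * C * \<chi>)) *
         gauss (inverse A * (C * C) * \<chi>) * gauss (inverse B * (C * C) * \<chi>) * (gauss \<rho> * gauss (\<rho> * \<phi>))) * \<chi> y
        / (?q ^ 4 * gauss A * gauss (B * inverse (C * C)))"
      unfolding b1 b2 b3 b4 using nz by (simp add: field_simps eval_nat_numeral)
    also have "\<dots> = gauss_product A B (C * C) \<chi> * \<chi> (4 * y) / (?q ^ 4 * gauss A * gauss (B * inverse (C * C)))"
      unfolding hd mult_char_minus_1_square[OF \<chi>] mult_char_minus_1_square[OF C] mult_char_mult[OF \<chi>] gauss_product_def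
      using nz by (simp add: mult_ac)
    finally show ?thesis .
  qed
  then have "?G * (\<Sum>\<chi> | mult_char \<chi>. ?b1 \<chi> * ?b2 \<chi> * ((?b3 \<chi> - ?\<kappa> * ?d3) * (?b4 \<chi> - ?\<kappa> * ?d4)) * \<chi> y)
    = (\<Sum>\<chi> | mult_char \<chi>. gauss_product A B (C * C) \<chi> * \<chi> (4 * y)) / (?q ^ 4 * gauss A * gauss (B * inverse (C * C)))"
    unfolding sum_distrib_left sum_divide_distrib by (intro sum.cong refl) blast
  then have "?G * (?q ^ 2 / (?q - 1) * (\<Sum>\<chi> | mult_char \<chi>. ?b1 \<chi> * ?b2 \<chi> * ((?b3 \<chi> - ?\<kappa> * ?d3) * (?b4 \<chi> - ?\<kappa> * ?d4)) * \<chi> y))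
    = ?q ^ 2 / (?q - 1) * ((\<Sum>\<chi> | mult_char \<chi>. gauss_product A B (C * C) \<chi> * \<chi> (4 * y)) / (?q ^ 4 * gauss A * gauss (B * inverse (C * C))))"
    by (simp only: mult.left_commute)
  also have "\<dots> = (\<Sum>\<chi> | mult_char \<chi>. gauss_product A B (C * C) \<chi> * \<chi> (4 * y)) /
      (?q ^ 2 * (?q - 1) * gauss A * gauss (B * inverse (C * C)))"
    by (simp add: eval_nat_numeral)
  finally show ?thesis
    unfolding series .
qed

theorem bailey_product:
  fixes A B C :: "'a \<Rightarrow> complex" and x y :: 'a and M :: complex
  assumes odd: "odd CARD('a)" and A: "mult_char A" and B: "mult_char B" and C: "mult_char C"
    and nontriv: "A \<noteq> \<epsilon>" "B \<noteq> \<epsilon>" "A \<noteq> C\<^sup>2" "B \<noteq> C\<^sup>2" and x: "x \<noteq> 1"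
    and y: "y = - (x\<^sup>2) / (4 * (1 - x))"
    and M: "M = inverse A (1 - x) * gauss (inverse A * C) * gauss (inverse B * C * \<phi>) /
                 (\<phi> (- 1 :: 'a) * C 4 * gauss \<phi> * gauss (inverse A * C\<^sup>2) * gauss (inverse B))"
  defines "q \<equiv> of_nat CARD('a) :: complex"
  shows
    "greene_F [A, B] [C\<^sup>2] x * greene_F [A, C\<^sup>2 * inverse B] [C\<^sup>2] x =
       q * (A * B) (- 1) * (inverse (A\<^sup>2) * B) (1 - x) * inverse (C\<^sup>2) x /
         (gauss A * gauss (inverse B) * gauss (inverse A * C\<^sup>2) * gauss (B * inverse (C\<^sup>2))) *
         delta_elem ((x - 2) / (x - 1))
     + q * M *
         greene_F [A, B, inverse A * C\<^sup>2, inverse B * C\<^sup>2] [C\<^sup>2, C, C * \<phi>] y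
     + (q - 1) * M *
         ((q - 1) / q * greene_F [A, B] [C\<^sup>2] y *
            delta_char (inverse A * C) * delta_char (inverse B * C * \<phi>)
          - greene_F [A, B, inverse B * C\<^sup>2] [C\<^sup>2, C * \<phi>] y * delta_char (inverse A * C)
          - greene_F [A, B, inverse A * C\<^sup>2] [C\<^sup>2, C] y * delta_char (inverse B * C * \<phi>))
     - (q - 1) * inverse A (1 - x) * inverse C (x\<^sup>2) * C (1 - x) /
         (q * gauss A * gauss (inverse B) * gauss (B * inverse (C\<^sup>2)) * gauss (inverse A * C\<^sup>2)) *
         ((q - 1) * delta_char (A * inverse C) * delta_char (B * inverse C)
          - q * (B * C) (- 1) * delta_char (A * inverse C)
          - q * (A * C) (- 1) * delta_char (B * inverse C)
          + (q - 1) * \<phi> (1 - x) *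
              delta_char (A * inverse C * \<phi>) * delta_char (B * inverse C * \<phi>)
          - q * (B * C) (- 1) * \<phi> (x - 1) * delta_char (A * inverse C * \<phi>)
          - q * (A * C) (- 1) * \<phi> (x - 1) * delta_char (B * inverse C * \<phi>))"
  (is "?L = ?T1 + q * M * ?F4 + (q - 1) * M * ?D - ?T3")
proof (cases "x = 0")
  \<comment> \<open>At \<open>x = 0\<close> each summand contains a character evaluated at
    \<open>0\<close>, so both sides vanish.\<close>
  case True
  have "greene_F As Bs (0::'a) = 0" for As Bs
    unfolding greene_F_def by (simp add: mult_char_0)
  moreover have "y = 0" "inverse C (x\<^sup>2) = 0" "inverse (C\<^sup>2) x = 0"
    using True mult_char_0[OF C] by (simp_all add: y power2_eq_square)
  ultimately show ?thesis
    using True by simp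
next
  case False
  let ?E = "C * C"
  have E: "mult_char ?E" using C by simp
  have sq: "C\<^sup>2 = ?E" by (rule power2_eq_square)
  have even: "?E (- 1) = 1" using mult_char_minus_1_square[OF C] by simp
  have ne: "A \<noteq> ?E" "B \<noteq> ?E" using nontriv by (simp_all add: sq)
  define v where "v = x / (x - 1)"
  have xv: "x * v \<noteq> 0" using x False by (simp add: v_def)
  have 4: "(4::'a) \<noteq> 0" by (rule four_neq_0[OF odd])
  have y4: "4 * y = x * v"
  proof -
    have "4 * y = - (x\<^sup>2) / (1 - x)"
      unfolding y times_divide_eq_right using 4 by (rule mult_divide_mult_cancel_left)
    also have "\<dots> = x\<^sup>2 / (x - 1)" by (metis minus_diff_eq minus_divide_divide minus_minus)
    finally show ?thesis by (simp add: v_def power2_eq_square)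
  qed
  \<comment> \<open>All parts of the formula are multiples of \<open>a * N\<close>; comparing the
    cofactors \<open>R\<close>, \<open>W\<close>, \<open>P\<close>, \<open>P2\<close> and
    \<open>Z\<close> is then linear.\<close>
  define N where "N = 1 / (gauss A * gauss (inverse B) * gauss (inverse A * ?E) * gauss (B * inverse ?E))"
  define a where "a = inverse (A (1 - x))"
  define R where "R = sum (rhs_term A B ?E x v) (rhs_supp x v)"
  define W where "W = (if A * A = ?E then A (- 1) * q * inverse (A (x * v)) * (if A = B then 1 else A (- 1) * B (- 1) * q) else 0)"
  define P where "P = A (- 1) * B (x - 1) / ?E x * ((q - 1) * delta_char (B * B * inverse ?E))"
  define P2 where "P2 = (if x = 2 then q / ?E x else 0)"
  define Z where "Z = (q - 1) * inverse C (x\<^sup>2) * C (1 - x) / q *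
         ((q - 1) * delta_char (A * inverse C) * delta_char (B * inverse C)
          - q * (B * C) (- 1) * delta_char (A * inverse C)
          - q * (A * C) (- 1) * delta_char (B * inverse C)
          + (q - 1) * \<phi> (1 - x) *
              delta_char (A * inverse C * \<phi>) * delta_char (B * inverse C * \<phi>)
          - q * (B * C) (- 1) * \<phi> (x - 1) * delta_char (A * inverse C * \<phi>)
          - q * (A * C) (- 1) * \<phi> (x - 1) * delta_char (B * inverse C * \<phi>))"
  have q0: "q \<noteq> 0" and q1: "q - 1 \<noteq> 0"
    unfolding q_def by (simp, rule card_neq_1)
  have "?L = a * N * sum (lhs_term A B ?E x v) (lhs_supp x v)"
    unfolding sq greene_F_product[OF A nontriv(1) ne(1) B nontriv(2) ne(2) E even False x v_def]
    by (simp add: a_def N_def)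
  also have "\<dots> = a * N * (R + P + P2)"
    unfolding sum_lhs_term_eq[OF A B E False x v_def nontriv(1,2) ne even] R_def P_def P2_def q_def ..
  finally have L: "?L = a * N * (R + P + P2)" .
  have main: "q * M * ?F4 + (q - 1) * M * ?D = a * N * (R - (q - 1) / q\<^sup>2 * W)"
  proof -
    define G where "G = gauss (inverse A * C) * gauss (inverse B * C * \<phi>) / (\<phi> (- 1 :: 'a) * C 4 * gauss \<phi>)"
    \<comment> \<open>\<open>M\<close> splits into \<open>G\<close>, which turns the series into
      Gauss sum products, and the two Gauss sums that complete the denominator of
      \<open>sum_4F3\<close> to that of \<open>N\<close>.\<close>
    have MG: "M = a / (gauss (inverse A * ?E) * gauss (inverse B)) * G"
      by (simp add: M a_def G_def sq mult_ac)
    have "q * M * ?F4 + (q - 1) * M * ?D = a / (gauss (inverse A * ?E) * gauss (inverse B)) * (G * (q * ?F4 + (q - 1) * ?D))"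
    proof -
      have "n * (k * G') * f + (n - 1) * (k * G') * d = k * (G' * (n * f + (n - 1) * d))" for n k G' f d :: complex
        by (simp add: algebra_simps)
      then show ?thesis unfolding MG .
    qed
    also have "G * (q * ?F4 + (q - 1) * ?D) = (q ^ 2 * (q - 1) * R - (q - 1)\<^sup>2 * W) /
        (q ^ 2 * (q - 1) * gauss A * gauss (B * inverse ?E))"
      using sum_4F3[OF odd A nontriv(1) B nontriv(2) ne(2) C, of y]
      unfolding y4 sum_gauss_product[OF A nontriv(1) B nontriv(2) E even xv] sq G_def R_def W_def q_def .
    also have "\<dots> = (R - (q - 1) / q\<^sup>2 * W) / (gauss A * gauss (B * inverse ?E))"
    proof -
      have "n ^ 2 * m * r - m\<^sup>2 * w = n ^ 2 * m * (r - m / n\<^sup>2 * w)" if "n \<noteq> 0" for n m r w :: complex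
        using that by (simp add: field_simps power2_eq_square)
      then show ?thesis
        using q0 q1 by (simp add: mult.assoc)
    qed
    also have "a / (gauss (inverse A * ?E) * gauss (inverse B)) * ((R - (q - 1) / q\<^sup>2 * W) / (gauss A * gauss (B * inverse ?E)))
        = a * N * (R - (q - 1) / q\<^sup>2 * W)"
      by (simp add: N_def mult_ac)
    finally show ?thesis .
  qed
  have T1: "?T1 = a * N * P2"
  proof (cases "x = 2")
    case True
    \<comment> \<open>For \<open>x = 2\<close> one has \<open>1 - x = - 1\<close>, so the prefactor
      is a product of signs and reduces to \<open>a\<close>.\<close>
    have "(A * B) (- 1) * (inverse (A\<^sup>2) * B) (1 - x) = (B (- 1) * B (- 1)) * inverse (A (- 1))"
      using True mult_char_eq_0_iff[OF A, of "- 1"] by (simp add: power2_eq_square)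
    then have "(A * B) (- 1) * (inverse (A\<^sup>2) * B) (1 - x) = a"
      unfolding mult_char_minus_1_square[OF B] a_def using True by simp
    then have "?T1 = q * a * inverse (?E) x * N * delta_elem ((x - 2) / (x - 1))"
      unfolding sq N_def by (simp add: mult_ac)
    also have "\<dots> = a * N * P2"
      using True by (simp add: P2_def delta_elem_def divide_inverse mult_ac)
    finally show ?thesis .
  next
    case False
    then have "(x - 2) / (x - 1) \<noteq> 0" using x by simp
    then show ?thesis using False by (simp add: P2_def delta_elem_def)
  qed
  have T3: "?T3 = a * N * Z"
    unfolding Z_def a_def N_def sq by (simp add: mult_ac)
  have PW: "P + (q - 1) / q\<^sup>2 * W = - Z"
    using correction_terms[OF odd A B C False x v_def q0] unfolding P_def W_def Z_def .
  have combine: "l = t1 + u + w - t3"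
    if "l = k * (r + p + p2)" "u + w = k * (r - s)" "t1 = k * p2" "t3 = k * z" "p + s = - z"
    for l t1 u w t3 k r p p2 s z :: complex
  proof -
    have "t1 + u + w - t3 = k * (r - s + p2 - z)"
      using that(2) by (simp add: that(3,4) algebra_simps)
    also have "p = - z - s"
      using that(5) by (simp only: eq_diff_eq)
    then have "r - s + p2 - z = r + p + p2" by simp
    finally show ?thesis using that(1) by simp
  qed
  show ?thesis
    by (rule combine[OF L main T1 T3 PW])
qed

end

theorem theorem1p5:
  fixes p r q :: nat
    and \<zeta> :: complex
    and g :: "('a::{field,finite} \<Rightarrow> complex) \<Rightarrow> complex"
    and A B C :: "'a \<Rightarrow> complex"
    and x y :: 'a
    and M :: complex
  assumes "prime p" and "odd p"
    and "q = p ^ r" and "CARD('a) = q"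
    and "primitive_root_of_unity p \<zeta>"
    and g_def: "g = gauss_sum p r \<zeta>"
    and "mult_char A" and "mult_char B" and "mult_char C"
    and "A \<noteq> \<epsilon>" and "B \<noteq> \<epsilon>" and "C\<^sup>2 \<noteq> \<epsilon>" and "A \<noteq> C\<^sup>2" and "B \<noteq> C\<^sup>2"
    and "x \<noteq> 1"
    and y_def: "y = - (x\<^sup>2) / (4 * (1 - x))"
    and M_def: "M = inverse A (1 - x) * g (inverse A * C) * g (inverse B * C * \<phi>) /
                 (\<phi> (- 1 :: 'a) * C 4 * g \<phi> * g (inverse A * C\<^sup>2) * g (inverse B))"
  shows
    "greene_F [A, B] [C\<^sup>2] x * greene_F [A, C\<^sup>2 * inverse B] [C\<^sup>2] x =
       of_nat q * (A * B) (- 1) * (inverse (A\<^sup>2) * B) (1 - x) * inverse (C\<^sup>2) x /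
         (g A * g (inverse B) * g (inverse A * C\<^sup>2) * g (B * inverse (C\<^sup>2))) *
         delta_elem ((x - 2) / (x - 1))
     + of_nat q * M *
         greene_F [A, B, inverse A * C\<^sup>2, inverse B * C\<^sup>2] [C\<^sup>2, C, C * \<phi>] y
     + (of_nat q - 1) * M *
         ((of_nat q - 1) / of_nat q * greene_F [A, B] [C\<^sup>2] y *
            delta_char (inverse A * C) * delta_char (inverse B * C * \<phi>)
          - greene_F [A, B, inverse B * C\<^sup>2] [C\<^sup>2, C * \<phi>] y * delta_char (inverse A * C)
          - greene_F [A, B, inverse A * C\<^sup>2] [C\<^sup>2, C] y * delta_char (inverse B * C * \<phi>))
     - (of_nat q - 1) * inverse A (1 - x) * inverse C (x\<^sup>2) * C (1 - x) /
         (of_nat q * g A * g (inverse B) * g (B * inverse (C\<^sup>2)) * g (inverse A * C\<^sup>2)) *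
         ((of_nat q - 1) * delta_char (A * inverse C) * delta_char (B * inverse C)
          - of_nat q * (B * C) (- 1) * delta_char (A * inverse C)
          - of_nat q * (A * C) (- 1) * delta_char (B * inverse C)
          + (of_nat q - 1) * \<phi> (1 - x) *
              delta_char (A * inverse C * \<phi>) * delta_char (B * inverse C * \<phi>)
          - of_nat q * (B * C) (- 1) * \<phi> (x - 1) * delta_char (A * inverse C * \<phi>)
          - of_nat q * (A * C) (- 1) * \<phi> (x - 1) * delta_char (B * inverse C * \<phi>))"
proof -
  have odd: "odd CARD('a)" using assms by simp
  interpret additive_char "add_char p r \<zeta> :: 'a \<Rightarrow> complex"
    using assms by (intro additive_char_add_char) simp_all
  have g: "g = gauss"
    by (simp add: fun_eq_iff g_def gauss_sum_def gauss_def)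
  show ?thesis
    unfolding g using bailey_product[OF odd assms(7,8,9,10,11,13,14,15) y_def M_def[unfolded g]] assms(4) by simp
qed

end
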